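(* Let $k$ be a field. For every finitely generated commutative $k$-algebra $A$ and every ideal $I$ of $A$, we have $$\sqrt[e]{I}=\{a\in A : I\cap \Sigma_a\neq\emptyset\}.$$
   Context: All rings are commutative and unital; $k$ is an arbitrary field. A maximal ideal $\mathfrak m$ of a $k$-algebra $A$ is called essential if the structural morphism $k\to A/\mathfrak m$ is an isomorphism. The equiresidual radical (equiradical) $\sqrt[e]{I}$ of an ideal $I$ of $A$ is the intersection of all essential maximal ideals of $A$ containing $I$ (equal to $A$ if there are none). The algebraic signature $\mathcal D$ of $k$ is the set of all polynomials $D(X_1,\ldots,X_r)$ in finitely many variables over $k$ which have no zero rational in $k$, i.e. no zero in $k^r$ (in particular nonzero constants belong to $\mathcal D$). For $D=\sum_{\bar i} a_{\bar i}\bar X^{\bar i}$ of total degree $d$, its homogenisation is $D^\#(\bar X,Y)=\sum_{\bar i} a_{\bar i}\bar X^{\bar i}Y^{d-|\bar i|}$, where $|\bar i|=i_1+\cdots+i_r$. For $a\in A$, $\Sigma_a$ is the multiplicative subset of $A$ generated by all elements of the form $a^mD^\#(\bar b,a^n)$, for $D\in\mathcal D$, $m,n\in\mathbb N$ (including $0$, with $a^0=1$) and $\bar b$ a tuple from $A$ of appropriate length. *)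

theory Defs
  imports "HOL-Algebra.Algebra"
begin

text \<open>
  Polynomials are those of \<open>Indexed_Polynomials\<close>: functions from monomials (multisets of
  variables) to coefficients. The set \<open>ring.indexed_pset k I (carrier k)\<close> consists of
  the polynomials over \<open>k\<close> in the variables from \<open>I\<close>.
\<close>

definition structure_map :: "('k, 'a, 'm) module_scheme \<Rightarrow> 'k \<Rightarrow> 'a" where
  "structure_map A c = c \<odot>\<^bsub>A\<^esub> \<one>\<^bsub>A\<^esub>"

definition finitely_generated_algebra ::
    "('k, 'n) ring_scheme \<Rightarrow> ('k, 'a, 'm) module_scheme \<Rightarrow> bool" where
  "finitely_generated_algebra k A \<longleftrightarrow> algebra k A \<and>
     (\<exists>S. finite S \<and> S \<subseteq> carrier A \<and>
          generate_ring A (structure_map A ` carrier k \<union> S) = carrier A)"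

definition essential_maximal_ideal ::
    "('k, 'n) ring_scheme \<Rightarrow> ('k, 'a, 'm) module_scheme \<Rightarrow> 'a set \<Rightarrow> bool" where
  "essential_maximal_ideal k A M \<longleftrightarrow> maximalideal M A \<and>
     (\<lambda>c. M +>\<^bsub>A\<^esub> structure_map A c) \<in> ring_iso k (A Quot M)"

text \<open>Intersecting with the carrier gives the whole algebra when there is no such ideal.\<close>

definition equiradical ::
    "('k, 'n) ring_scheme \<Rightarrow> ('k, 'a, 'm) module_scheme \<Rightarrow> 'a set \<Rightarrow> 'a set" where
  "equiradical k A I = carrier A \<inter> \<Inter>{M. essential_maximal_ideal k A M \<and> I \<subseteq> M}"

definition poly_support :: "('k, 'n) ring_scheme \<Rightarrow> ('v multiset \<Rightarrow> 'k) \<Rightarrow> 'v multiset set" where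
  "poly_support k P = {m. P m \<noteq> \<zero>\<^bsub>k\<^esub>}"

text \<open>The value of \<open>P\<close> at the point \<open>x\<close> of \<open>S\<close>, with coefficients mapped into \<open>S\<close> by \<open>\<phi>\<close>.\<close>

definition poly_value ::
    "('k, 'n) ring_scheme \<Rightarrow> ('s, 'p) ring_scheme \<Rightarrow> ('k \<Rightarrow> 's) \<Rightarrow>
     ('v multiset \<Rightarrow> 'k) \<Rightarrow> ('v \<Rightarrow> 's) \<Rightarrow> 's" where
  "poly_value k S \<phi> P x =
     (\<Oplus>\<^bsub>S\<^esub>m\<in>poly_support k P.
        \<phi> (P m) \<otimes>\<^bsub>S\<^esub> (\<Otimes>\<^bsub>S\<^esub>i\<in>set_mset m. x i [^]\<^bsub>S\<^esub> count m i))"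

text \<open>
  An element \<open>(r, D)\<close> is a polynomial \<open>D\<close> regarded as one in the \<open>r\<close> variables
  \<open>0, \<dots>, r - 1\<close>; only the values \<open>x 0, \<dots>, x (r - 1)\<close> of a point \<open>x\<close> matter.
\<close>

definition algebraic_signature :: "('k, 'n) ring_scheme \<Rightarrow> (nat \<times> (nat multiset \<Rightarrow> 'k)) set" where
  "algebraic_signature k =
     {(r, D). D \<in> ring.indexed_pset k {..<r} (carrier k) \<and>
              (\<forall>x \<in> {..<r} \<rightarrow> carrier k. poly_value k k (\<lambda>c. c) D x \<noteq> \<zero>\<^bsub>k\<^esub>)}"

text \<open>Unspecified for the zero polynomial, which does not belong to the algebraic signature.\<close>

definition total_degree :: "('k, 'n) ring_scheme \<Rightarrow> ('v multiset \<Rightarrow> 'k) \<Rightarrow> nat" where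
  "total_degree k D = Max (size ` poly_support k D)"

text \<open>
  The variable \<open>X\<^sub>i\<close> becomes \<open>Some i\<close>, and \<open>Y\<close> is \<open>None\<close>. A monomial \<open>M\<close> in these variables
  is \<open>X\<^sup>m Y\<^sup>j\<close> with \<open>m\<close> obtained by deleting \<open>None\<close>; its coefficient is that of
  \<open>X\<^sup>m\<close> in \<open>D\<close> if \<open>j = d - \<bar>m\<bar>\<close>, and zero otherwise. The truncated
  subtraction is harmless, since \<open>D m\<close> is zero when \<open>\<bar>m\<bar> > d\<close>.
\<close>

definition homogenisation ::
    "('k, 'n) ring_scheme \<Rightarrow> ('v multiset \<Rightarrow> 'k) \<Rightarrow> ('v option multiset \<Rightarrow> 'k)" where
  "homogenisation k D M =
     (let m = image_mset the (filter_mset (\<lambda>v. v \<noteq> None) M)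
      in if count M None = total_degree k D - size m then D m else \<zero>\<^bsub>k\<^esub>)"

definition Sigma_set ::
    "('k, 'n) ring_scheme \<Rightarrow> ('k, 'a, 'm) module_scheme \<Rightarrow> 'a \<Rightarrow> 'a set" where
  "Sigma_set k A a =
     (\<lambda>S. submonoid S A) hull
       {a [^]\<^bsub>A\<^esub> m \<otimes>\<^bsub>A\<^esub>
          poly_value k A (structure_map A) (homogenisation k D) (case_option (a [^]\<^bsub>A\<^esub> n) b)
        | (m::nat) (n::nat) r D b.
          (r, D) \<in> algebraic_signature k \<and> b \<in> {..<r} \<rightarrow> carrier A}"

end

theory Submission
  imports Defs
begin

text \<open>
  A point \<open>A \<rightarrow> k\<close> at which \<open>a\<close> does not vanish maps \<open>\<Sigma>\<^sub>a\<close> into \<open>k - {0}\<close>, because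
  \<open>D\<^sup>#(x, y) = y\<^sup>d D(x / y)\<close>; this gives one inclusion. For the other, suppose that \<open>a\<close> vanishes at
  all points of \<open>A / I\<close>.

  If \<open>k\<close> is algebraically closed, some power of \<open>a\<close> lies in \<open>I\<close> (Nullstellensatz).

  Otherwise a polynomial \<open>p\<close> of degree \<open>d > 0\<close> without roots yields the form \<open>N(s, t) = t\<^sup>d p(s / t)\<close>,
  whose only zero is \<open>(0, 0)\<close>. With Hilbert's basis theorem, \<open>N\<close> combines the equations of \<open>A / I\<close>
  into a single \<open>f\<close> with image in \<open>I\<close>. If \<open>\<alpha>\<close> is a polynomial representing \<open>a\<close>, then
  \<open>D(X, T) = N(f(X), 1 - \<alpha>(X) T)\<close> has no zero. In the localisation \<open>A\<^sub>a\<close> we have \<open>D(x, 1/a) \<in> I A\<^sub>a\<close>;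
  clearing denominators puts \<open>a\<^sup>m D\<^sup>#(a x, 1, a)\<close> in \<open>I\<close>.
\<close>

section \<open>Hilbert's basis theorem\<close>

text \<open>The case split is forced: over an algebraically closed field every binary form of
  positive degree has a nontrivial zero, over any other field an anisotropic one exists. Such a form
  merges two equations at a time, so the ideal of equations must be reduced to finitely many
  generators; this is the purpose of the basis theorem. The term \<open>1 - \<alpha> T\<close> is
  Rabinowitsch's trick: a zero of it would be a point at which \<open>a\<close> is invertible.
  Setting \<open>Y = a\<close> in a homogenisation divides every variable by \<open>a\<close> up to
  a power of \<open>a\<close>, so the substitution of \<open>(x, 1/a)\<close> becomes that of
  \<open>(a x, 1)\<close>. The localisation is never constructed. Each polynomial is accompanied by
  the value in \<open>A\<close> of its homogenisation in a prescribed degree, and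
  \<open>1 - a (1/a) = 0\<close> turns into an identity between powers of \<open>a\<close> in
  \<open>A\<close>. The prescribed degree only bounds the total degree, because terms may cancel;
  the factor \<open>a^m\<close> in the generators of \<open>Sigma_set\<close> absorbs the
  excess.\<close>

context UP_cring
begin

text \<open>Polynomials of degree below \<open>n\<close> contribute zero, so cancellation of leading
  terms in a sum needs no separate case and the set is an ideal.\<close>

definition lead_coeffs :: "(nat \<Rightarrow> 'a) set \<Rightarrow> nat \<Rightarrow> 'a set" where
  "lead_coeffs J n = {up_ring.coeff P p n | p. p \<in> J \<and> deg R p \<le> n}"

lemma lead_coeffs_ideal:
  assumes "ideal J P"
  shows "ideal (lead_coeffs J n) R"
proof -
  interpret J: ideal J P by fact
  have add: "x \<oplus> y \<in> lead_coeffs J n" if xy: "x \<in> lead_coeffs J n" "y \<in> lead_coeffs J n" for x y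
  proof -
    obtain p q where p: "p \<in> J" "deg R p \<le> n" "x = up_ring.coeff P p n"
      and q: "q \<in> J" "deg R q \<le> n" "y = up_ring.coeff P q n"
      using xy unfolding lead_coeffs_def by auto
    have pq: "p \<in> carrier P" "q \<in> carrier P" using p q J.Icarr by auto
    have "deg R (p \<oplus>\<^bsub>P\<^esub> q) \<le> n" using p q by (intro order_trans[OF deg_add[OF pq]]) simp
    moreover have "x \<oplus> y = up_ring.coeff P (p \<oplus>\<^bsub>P\<^esub> q) n" using p q pq by simp
    ultimately show ?thesis using p q unfolding lead_coeffs_def by blast
  qed
  have mult: "c \<otimes> x \<in> lead_coeffs J n" if x: "x \<in> lead_coeffs J n" and c: "c \<in> carrier R" for c x
  proof -
    obtain p where p: "p \<in> J" "deg R p \<le> n" "x = up_ring.coeff P p n"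
      using x unfolding lead_coeffs_def by blast
    have pc: "p \<in> carrier P" using p J.Icarr by auto
    have "c \<odot>\<^bsub>P\<^esub> p = up_ring.monom P c 0 \<otimes>\<^bsub>P\<^esub> p" using monom_mult_is_smult that pc by simp
    hence "c \<odot>\<^bsub>P\<^esub> p \<in> J" using J.I_l_closed p that by simp
    moreover have "deg R (c \<odot>\<^bsub>P\<^esub> p) \<le> n" using p that pc by (intro order_trans[OF deg_smult_decr]) simp_all
    moreover have "c \<otimes> x = up_ring.coeff P (c \<odot>\<^bsub>P\<^esub> p) n" using p pc that by simp
    ultimately show ?thesis unfolding lead_coeffs_def by blast
  qed
  have carr: "lead_coeffs J n \<subseteq> carrier R"
    unfolding lead_coeffs_def using J.Icarr by auto
  have "up_ring.coeff P \<zero>\<^bsub>P\<^esub> n \<in> lead_coeffs J n"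
    unfolding lead_coeffs_def using J.zero_closed deg_zero
    by (intro CollectI exI[of _ "\<zero>\<^bsub>P\<^esub>"]) simp
  hence zero: "\<zero> \<in> lead_coeffs J n" by simp
  show ?thesis
  proof (rule idealI)
    show "ring R" by (rule R.ring_axioms)
    show "subgroup (lead_coeffs J n) (add_monoid R)"
    proof (rule group.subgroupI)
      show "group (add_monoid R)" by (rule R.add.is_group)
      show "lead_coeffs J n \<subseteq> carrier (add_monoid R)" using carr by simp
      show "lead_coeffs J n \<noteq> {}" using zero by blast
      fix x assume x: "x \<in> lead_coeffs J n"
      hence "(\<ominus>\<^bsub>R\<^esub> \<one>\<^bsub>R\<^esub>) \<otimes> x \<in> lead_coeffs J n" using mult by simp
      moreover have "(\<ominus>\<^bsub>R\<^esub> \<one>\<^bsub>R\<^esub>) \<otimes> x = \<ominus> x" using x carr R.l_minus[of "\<one>\<^bsub>R\<^esub>" x] by auto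
      ultimately show "inv\<^bsub>add_monoid R\<^esub> x \<in> lead_coeffs J n"
        unfolding a_inv_def[symmetric] by simp
      fix y assume "y \<in> lead_coeffs J n"
      thus "x \<otimes>\<^bsub>add_monoid R\<^esub> y \<in> lead_coeffs J n" using add x by simp
    qed
    show "c \<otimes> x \<in> lead_coeffs J n" if "x \<in> lead_coeffs J n" "c \<in> carrier R" for c x
      using mult that by auto
    show "x \<otimes> c \<in> lead_coeffs J n" if "x \<in> lead_coeffs J n" "c \<in> carrier R" for c x
      using mult[OF that] that carr R.m_comm by auto
  qed
qed

text \<open>Multiplication by \<open>X^(n - m)\<close> keeps a polynomial in \<open>J\<close> and
  moves its coefficient at \<open>m\<close> to \<open>n\<close>; hence these ideals form an
  increasing chain.\<close>

lemma lead_coeffs_mono: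
  assumes "ideal J P" and "m \<le> n"
  shows "lead_coeffs J m \<subseteq> lead_coeffs J n"
proof
  fix x assume "x \<in> lead_coeffs J m"
  then obtain p where p: "p \<in> J" "deg R p \<le> m" "x = up_ring.coeff P p m"
    unfolding lead_coeffs_def by auto
  interpret J: ideal J P by fact
  have pc: "p \<in> carrier P" using p J.Icarr by auto
  let ?X = "up_ring.monom P \<one> (n - m)"
  have "?X \<otimes>\<^bsub>P\<^esub> p \<in> J" using p J.I_l_closed by simp
  moreover have "deg R (?X \<otimes>\<^bsub>P\<^esub> p) \<le> n"
    using deg_mult_ring[of ?X p] deg_monom_le[of \<one> "n - m"] pc p(2) assms(2) by simp
  moreover have "up_ring.coeff P (?X \<otimes>\<^bsub>P\<^esub> p) n = x"
    using coeff_monom_mult[OF R.one_closed pc, of "n - m" m] assms(2) p pc by simp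
  ultimately show "x \<in> lead_coeffs J n" unfolding lead_coeffs_def by blast
qed

text \<open>Induction on the degree: an element of \<open>J'\<close> with the same coefficient at
  \<open>deg R f\<close> is subtracted from \<open>f\<close>, which leaves an element of
  \<open>J\<close> that is zero or of smaller degree.\<close>

lemma ideal_subset_by_lead_coeffs:
  assumes J: "ideal J P" and J': "ideal J' P" and sub: "J' \<subseteq> J"
    and lead: "\<And>n. lead_coeffs J n \<subseteq> lead_coeffs J' n"
  shows "J \<subseteq> J'"
proof
  interpret J: ideal J P by fact
  interpret J': ideal J' P by fact
  fix f assume "f \<in> J"
  thus "f \<in> J'"
  proof (induction "deg R f" arbitrary: f rule: less_induct)
    case less
    have fc: "f \<in> carrier P" using less.prems J.Icarr by auto
    have "up_ring.coeff P f (deg R f) \<in> lead_coeffs J (deg R f)"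
      using less.prems unfolding lead_coeffs_def by blast
    then obtain g where g: "g \<in> J'" "deg R g \<le> deg R f" "up_ring.coeff P g (deg R f) = up_ring.coeff P f (deg R f)"
      using lead[of "deg R f"] unfolding lead_coeffs_def by auto
    have gc: "g \<in> carrier P" using g J'.Icarr by auto
    let ?h = "f \<ominus>\<^bsub>P\<^esub> g"
    have hJ: "?h \<in> J" unfolding a_minus_def
      using less.prems g sub J.a_inv_closed J.a_closed by blast
    have hc: "?h \<in> carrier P" using fc gc by simp
    \<comment> \<open>The zero polynomial has degree 0, so for constant \<open>f\<close> the degree
      does not drop and the case of a zero difference stands apart.\<close>
    have "?h \<in> J'"
    proof (cases "?h = \<zero>\<^bsub>P\<^esub>")
      case True
      thus ?thesis using J'.zero_closed by simp
    next
      case False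
      have "deg R ?h \<le> deg R f"
        unfolding a_minus_def using deg_uminus[OF gc] fc gc g(2) by (intro order_trans[OF deg_add]) simp_all
      moreover have "up_ring.coeff P ?h (deg R f) = \<zero>" using g fc gc by (simp add: R.r_neg R.minus_eq)
      ultimately have "deg R ?h < deg R f"
        using lcoeff_nonzero[OF False hc] le_neq_implies_less by metis
      thus ?thesis using less.hyps hJ by blast
    qed
    moreover have "f = ?h \<oplus>\<^bsub>P\<^esub> g" using fc gc
      by (simp add: P.minus_eq P.a_assoc P.l_neg)
    ultimately show ?case using g J'.a_closed by metis
  qed
qed

text \<open>The chain \<open>lead_coeffs J n\<close> stabilises at some \<open>N\<close>. Finite
  generating sets of its members up to \<open>N\<close>, lifted to elements of \<open>J\<close>,
  generate an ideal inside \<open>J\<close> with the same leading coefficients in every degree,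
  hence all of \<open>J\<close>.\<close>

theorem hilbert_basis:
  assumes "noetherian_ring R"
  shows "noetherian_ring P"
proof (rule P.noetherian_ringI)
  interpret N: noetherian_ring R by fact
  fix J assume J: "ideal J P"
  interpret J: ideal J P by fact
  \<comment> \<open>A nonempty chain of ideals of a noetherian ring contains its union; the index of
    this member is the level \<open>N\<close>.\<close>
  have "\<Union>(range (lead_coeffs J)) \<in> range (lead_coeffs J)"
  proof (rule N.ideal_chain_is_trivial, simp)
    show "subset.chain {I. ideal I R} (range (lead_coeffs J))"
      unfolding subset_chain_def
    proof (intro conjI ballI)
      show "range (lead_coeffs J) \<subseteq> {I. ideal I R}" using lead_coeffs_ideal[OF J] by auto
      fix L L' assume "L \<in> range (lead_coeffs J)" "L' \<in> range (lead_coeffs J)"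
      then obtain m n where "L = lead_coeffs J m" "L' = lead_coeffs J n" by blast
      thus "L \<subseteq> L' \<or> L' \<subseteq> L"
        using lead_coeffs_mono[OF J, of m n] lead_coeffs_mono[OF J, of n m] by (cases m n rule: le_cases) simp_all
    qed
  qed
  then obtain N where N: "lead_coeffs J N = \<Union>(range (lead_coeffs J))" by auto
  have "\<forall>n. \<exists>G. finite G \<and> G \<subseteq> {p \<in> J. deg R p \<le> n} \<and>
          lead_coeffs J n = genideal R ((\<lambda>p. up_ring.coeff P p n) ` G)"
  proof
    fix n
    obtain C where C: "finite C" "C \<subseteq> carrier R" "lead_coeffs J n = genideal R C"
      using N.finetely_gen[OF lead_coeffs_ideal[OF J]] by blast
    have "C \<subseteq> (\<lambda>p. up_ring.coeff P p n) ` {p \<in> J. deg R p \<le> n}"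
      using R.genideal_self[OF C(2)] unfolding C(3)[symmetric] lead_coeffs_def by auto
    then obtain G where "G \<subseteq> {p \<in> J. deg R p \<le> n}" "finite G" "C = (\<lambda>p. up_ring.coeff P p n) ` G"
      using C(1) by (meson finite_subset_image)
    thus "\<exists>G. finite G \<and> G \<subseteq> {p \<in> J. deg R p \<le> n} \<and>
          lead_coeffs J n = genideal R ((\<lambda>p. up_ring.coeff P p n) ` G)"
      using C(3) by (intro exI[of _ G]) simp
  qed
  from choice[OF this]
  obtain G where G: "\<And>n. finite (G n)" "\<And>n. G n \<subseteq> {p \<in> J. deg R p \<le> n}"
    "\<And>n. lead_coeffs J n = genideal R ((\<lambda>p. up_ring.coeff P p n) ` G n)"
    by blast
  let ?A = "\<Union>n\<le>N. G n"
  have AJ: "?A \<subseteq> J" using G(2) by blast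
  have A: "?A \<subseteq> carrier P" using AJ J.Icarr by auto
  have id: "ideal (genideal P ?A) P" using P.genideal_ideal[OF A] .
  have sub: "genideal P ?A \<subseteq> J" using P.genideal_minimal[OF J AJ] .
  have le: "lead_coeffs J n \<subseteq> lead_coeffs (genideal P ?A) n" if "n \<le> N" for n
  proof -
    have "G n \<subseteq> genideal P ?A" using P.genideal_self[OF A] that by blast
    hence "(\<lambda>p. up_ring.coeff P p n) ` G n \<subseteq> lead_coeffs (genideal P ?A) n"
      using G(2)[of n] unfolding lead_coeffs_def by blast
    thus ?thesis using R.genideal_minimal[OF lead_coeffs_ideal[OF id]] G(3) by simp
  qed
  have "lead_coeffs J n \<subseteq> lead_coeffs (genideal P ?A) n" for n
  proof (cases "n \<le> N")
    case False
    have "lead_coeffs J n \<subseteq> lead_coeffs J N" using N by blast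
    thus ?thesis using le[of N] lead_coeffs_mono[OF id, of N n] False by auto
  qed (use le in simp)
  hence "J \<subseteq> genideal P ?A" using ideal_subset_by_lead_coeffs[OF J id sub] by blast
  hence "J = genideal P ?A" using sub by blast
  moreover have "finite ?A" using G(1) by blast
  ultimately show "\<exists>A\<subseteq>carrier P. finite A \<and> J = genideal P A" using A by blast
qed

end

section \<open>Finitely generated rings over a noetherian subring\<close>

lemma noetherian_ring_surj_hom:
  assumes "noetherian_ring R" and "ring_hom_ring R S h" and "h ` carrier R = carrier S"
  shows "noetherian_ring S"
proof -
  interpret N: noetherian_ring R by fact
  interpret h: ring_hom_ring R S h by fact
  show ?thesis
  proof (rule h.S.noetherian_ringI)
    fix J assume J: "ideal J S"
    interpret J: ideal J S by fact
    have v: "ideal {r \<in> carrier R. h r \<in> J} R" using h.ideal_vimage[OF J] .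
    then obtain A where A: "A \<subseteq> carrier R" "finite A" "{r \<in> carrier R. h r \<in> J} = genideal R A"
      using N.finetely_gen by blast
    have hA: "h ` A \<subseteq> carrier S" using A by auto
    have hJ: "h ` A \<subseteq> J" using A N.genideal_self[OF A(1)] by auto
    have sub: "genideal R A \<subseteq> {r \<in> carrier R. h r \<in> genideal S (h ` A)}"
      using h.S.genideal_self[OF hA] A(1)
      by (intro N.genideal_minimal[OF h.ideal_vimage[OF h.S.genideal_ideal[OF hA]]]) auto
    have "y \<in> genideal S (h ` A)" if "y \<in> J" for y
    proof -
      have "y \<in> h ` carrier R" using J.Icarr[OF that] assms(3) by simp
      then obtain r where "r \<in> carrier R" "h r = y" by blast
      thus ?thesis using that A(3) sub by auto
    qed
    hence "J \<subseteq> genideal S (h ` A)" by blast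
    hence "J = genideal S (h ` A)" using h.S.genideal_minimal[OF J hJ] by blast
    thus "\<exists>A\<subseteq>carrier S. finite A \<and> J = genideal S A" using hA A(2) by blast
  qed
qed

text \<open>Lets generators be adjoined one at a time, each over the subring generated so
  far.\<close>

lemma (in ring) generate_ring_generate_ring_insert:
  assumes "H \<subseteq> carrier R" and "x \<in> carrier R"
  shows "generate_ring R (insert x (generate_ring R H)) = generate_ring R (insert x H)"
proof (rule generate_ringI)
  let ?G = "generate_ring R H"
  have G: "insert x ?G \<subseteq> carrier R" using assms generate_ring_incl by blast
  show "insert x H \<subseteq> carrier R" using assms by blast
  show "subring (generate_ring R (insert x ?G)) R" using generate_ring_is_subring[OF G] .
  show "insert x H \<subseteq> generate_ring R (insert x ?G)"
    using generate_ringE(2)[OF assms(1) refl] generate_ringE(2)[OF G refl] by auto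
  show "generate_ring R (insert x ?G) \<subseteq> L" if "subring L R" "insert x H \<subseteq> L" for L
    using generate_ring_min_subring1[OF G that(1)] generate_ring_min_subring1[OF assms(1) that(1)]
      that(2) by auto
qed

lemma (in ring) generate_ring_subring: "subring K R \<Longrightarrow> generate_ring R K = K"
  using generate_ringI[of K K] subringE(1) by blast

lemma (in cring) UP_pre_univ_prop_subring:
  assumes "subring K R"
  shows "UP_pre_univ_prop (R\<lparr>carrier := K\<rparr>) R id"
proof (rule UP_pre_univ_propI)
  show "cring (R\<lparr>carrier := K\<rparr>)" using subring_iff subcringI' assms subcring_iff
    by (meson subringE(1))
  show "cring R" by (rule is_cring)
  show "id \<in> ring_hom (R\<lparr>carrier := K\<rparr>) R"
    using subringE(1)[OF assms] by (auto intro!: ring_hom_memI)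
qed

text \<open>The image of evaluation at \<open>x\<close> is a subring containing \<open>K\<close> and
  \<open>x\<close>, and each value is a finite sum of terms \<open>c x^i\<close>. Thus
  \<open>K[x]\<close> is a quotient of \<open>K[X]\<close>, to which the basis theorem and, later,
  pseudo-division apply.\<close>

lemma (in cring) generate_ring_insert_eval:
  assumes K: "subring K R" and x: "x \<in> carrier R"
  shows "generate_ring R (insert x K) =
    UnivPoly.eval (R\<lparr>carrier := K\<rparr>) R id x ` carrier (UP (R\<lparr>carrier := K\<rparr>))" (is "_ = ?ev ` carrier ?P")
proof -
  interpret U: UP_pre_univ_prop "R\<lparr>carrier := K\<rparr>" R id "UP (R\<lparr>carrier := K\<rparr>)"
    using UP_pre_univ_prop_subring[OF K] by simp_all
  have sub: "insert x K \<subseteq> carrier R" using x subringE(1)[OF K] by blast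
  have hom: "?ev \<in> ring_hom ?P R" using U.eval_ring_hom[OF x] .
  interpret h: ring_hom_ring ?P R ?ev
    using hom by (intro ring_hom_ringI2) (auto simp: U.P.ring_axioms ring_axioms)
  have "subring (?ev ` carrier ?P) R"
    using h.img_is_subring[OF U.P.carrier_is_subring] .
  moreover have "insert x K \<subseteq> ?ev ` carrier ?P"
  proof -
    have "x = ?ev (up_ring.monom ?P \<one> 1)" using U.eval_monom1[OF x] by simp
    moreover have "up_ring.monom ?P \<one> 1 \<in> carrier ?P" using U.R.one_closed U.monom_closed by simp
    ultimately have "x \<in> ?ev ` carrier ?P" by blast
    moreover have "c \<in> ?ev ` carrier ?P" if "c \<in> K" for c
      using U.eval_const[OF x, of c] that U.monom_closed[of c 0]
      by (intro image_eqI[of _ _ "up_ring.monom ?P c 0"]) simp_all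
    ultimately show ?thesis by blast
  qed
  ultimately have "generate_ring R (insert x K) \<subseteq> ?ev ` carrier ?P"
    using generate_ring_min_subring1[OF sub] by blast
  moreover have "?ev p \<in> generate_ring R (insert x K)" if "p \<in> carrier ?P" for p
  proof -
    let ?G = "generate_ring R (insert x K)"
    have G: "subring ?G R" using generate_ring_is_subring[OF sub] .
    have pow: "x [^] (i::nat) \<in> ?G" for i
      by (induct i) (auto intro: generate_ring.intros)
    have cf: "up_ring.coeff ?P p i \<in> K" for i using U.coeff_closed[OF that, of i] by simp
    have "(\<Oplus>\<^bsub>R\<^esub>i \<in> F. up_ring.coeff ?P p i \<otimes> x [^] i) \<in> ?G" if "finite F" for F
      using that
    proof (induct F)
      case empty
      show ?case using zero_in_generate by simp
    next
      case (insert i F)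
      have "up_ring.coeff ?P p i \<otimes> x [^] i \<in> ?G"
        using cf pow by (auto intro: generate_ring.intros)
      moreover have "(\<lambda>i. up_ring.coeff ?P p i \<otimes> x [^] i) \<in> UNIV \<rightarrow> carrier R"
        using cf x subringE(1)[OF K] by auto
      ultimately show ?case using insert finsum_insert[of F i "\<lambda>i. up_ring.coeff ?P p i \<otimes> x [^] i"]
        by (auto simp: Pi_def intro: generate_ring.eng_add)
    qed
    thus ?thesis using U.eval_on_carrier[OF that, where S=R and phi=id and s=x] by simp
  qed
  ultimately show ?thesis by blast
qed

lemma (in cring) noetherian_generate_ring_insert:
  assumes K: "subring K R" and x: "x \<in> carrier R" and N: "noetherian_ring (R\<lparr>carrier := K\<rparr>)"
  shows "noetherian_ring (R\<lparr>carrier := generate_ring R (insert x K)\<rparr>)"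
proof -
  interpret U: UP_pre_univ_prop "R\<lparr>carrier := K\<rparr>" R id "UP (R\<lparr>carrier := K\<rparr>)"
    using UP_pre_univ_prop_subring[OF K] by simp_all
  let ?P = "UP (R\<lparr>carrier := K\<rparr>)" and ?ev = "UnivPoly.eval (R\<lparr>carrier := K\<rparr>) R id x"
  have sub: "insert x K \<subseteq> carrier R" using x subringE(1)[OF K] by blast
  let ?S = "R\<lparr>carrier := generate_ring R (insert x K)\<rparr>"
  have hom: "?ev \<in> ring_hom ?P R" using U.eval_ring_hom[OF x] .
  have hom': "ring_hom_ring ?P ?S ?ev"
  proof (rule ring_hom_ringI2)
    show "ring ?S" using generate_ring_is_ring[OF sub] .
    show "?ev \<in> ring_hom ?P ?S"
      using hom generate_ring_insert_eval[OF K x] by (auto simp: ring_hom_def)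
  qed (rule U.P.ring_axioms)
  show ?thesis
    using noetherian_ring_surj_hom[OF U.hilbert_basis[OF N] hom'] generate_ring_insert_eval[OF K x]
    by simp
qed

lemma (in cring) noetherian_generate_ring:
  assumes K: "subring K R" and N: "noetherian_ring (R\<lparr>carrier := K\<rparr>)"
    and "finite S" and "S \<subseteq> carrier R"
  shows "noetherian_ring (R\<lparr>carrier := generate_ring R (K \<union> S)\<rparr>)"
  using assms(3,4)
proof (induct S)
  case empty
  thus ?case using N generate_ring_subring[OF K] by simp
next
  case (insert x S)
  have KS: "K \<union> S \<subseteq> carrier R" and x: "x \<in> carrier R"
    using insert.prems subringE(1)[OF K] by auto
  have "noetherian_ring (R\<lparr>carrier := generate_ring R (K \<union> S)\<rparr>)" using insert by simp
  from noetherian_generate_ring_insert[OF generate_ring_is_subring[OF KS] x this]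
  show ?case using generate_ring_generate_ring_insert[OF KS x] by simp
qed

section \<open>The Nullstellensatz\<close>

text \<open>For a field this is algebraic closedness, with a polynomial of degree \<open>d\<close>
  given by its coefficient sequence. The negation directly supplies the coefficients of an
  anisotropic form.\<close>

definition polys_have_roots :: "('k, 'n) ring_scheme \<Rightarrow> bool" where
  "polys_have_roots k \<longleftrightarrow>
     (\<forall>d c. d > 0 \<longrightarrow> c \<in> UNIV \<rightarrow> carrier k \<longrightarrow> c d \<noteq> \<zero>\<^bsub>k\<^esub> \<longrightarrow>
        (\<exists>s\<in>carrier k. (\<Oplus>\<^bsub>k\<^esub>i\<in>{..d::nat}. c i \<otimes>\<^bsub>k\<^esub> s [^]\<^bsub>k\<^esub> i) = \<zero>\<^bsub>k\<^esub>))"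

text \<open>The universal property of the image of \<open>h\<close>: since \<open>h'\<close> kills
  the kernel of \<open>h\<close>, the element \<open>h' g\<close> depends on \<open>h g\<close>
  only. Points of a ring can thus be defined through polynomial representatives.\<close>

lemma ring_hom_factor:
  assumes P: "ring P" and R: "ring R" and S: "ring S"
    and h: "h \<in> ring_hom P R" and h': "h' \<in> ring_hom P S"
    and ker: "\<And>g. g \<in> carrier P \<Longrightarrow> h g = \<zero>\<^bsub>R\<^esub> \<Longrightarrow> h' g = \<zero>\<^bsub>S\<^esub>"
  obtains \<psi> where "\<psi> \<in> ring_hom (R\<lparr>carrier := h ` carrier P\<rparr>) S"
    and "\<And>g. g \<in> carrier P \<Longrightarrow> \<psi> (h g) = h' g"
proof -
  interpret h: ring_hom_ring P R h by (rule ring_hom_ringI2[OF P R h])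
  interpret h': ring_hom_ring P S h' by (rule ring_hom_ringI2[OF P S h'])
  have eq: "h' g = h' g'" if "g \<in> carrier P" "g' \<in> carrier P" "h g = h g'" for g g'
  proof -
    have "h (g \<ominus>\<^bsub>P\<^esub> g') = \<zero>\<^bsub>R\<^esub>"
      using that by (simp add: h.R.minus_eq h.S.r_neg)
    hence "h' (g \<ominus>\<^bsub>P\<^esub> g') = \<zero>\<^bsub>S\<^esub>" using ker that by simp
    hence "h' g \<ominus>\<^bsub>S\<^esub> h' g' = \<zero>\<^bsub>S\<^esub>" using that by (simp add: h.R.minus_eq h'.S.minus_eq)
    thus ?thesis using that by simp
  qed
  define \<psi> where "\<psi> y = h' (SOME g. g \<in> carrier P \<and> h g = y)" for y
  have \<psi>: "\<psi> (h g) = h' g" if "g \<in> carrier P" for g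
  proof -
    have "(SOME g'. g' \<in> carrier P \<and> h g' = h g) \<in> carrier P \<and>
          h (SOME g'. g' \<in> carrier P \<and> h g' = h g) = h g"
      by (rule someI[of "\<lambda>g'. g' \<in> carrier P \<and> h g' = h g" g]) (simp add: that)
    thus ?thesis unfolding \<psi>_def using eq that by blast
  qed
  have "\<psi> \<in> ring_hom (R\<lparr>carrier := h ` carrier P\<rparr>) S"
  proof (rule ring_hom_memI)
    fix x assume "x \<in> carrier (R\<lparr>carrier := h ` carrier P\<rparr>)"
    then obtain p where p: "p \<in> carrier P" "x = h p" by auto
    show "\<psi> x \<in> carrier S" using p \<psi> by simp
    fix y assume "y \<in> carrier (R\<lparr>carrier := h ` carrier P\<rparr>)"
    then obtain q where q: "q \<in> carrier P" "y = h q" by auto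
    show "\<psi> (x \<otimes>\<^bsub>R\<lparr>carrier := h ` carrier P\<rparr>\<^esub> y) = \<psi> x \<otimes>\<^bsub>S\<^esub> \<psi> y"
      using p q \<psi>[of "p \<otimes>\<^bsub>P\<^esub> q"] \<psi> by simp
    show "\<psi> (x \<oplus>\<^bsub>R\<lparr>carrier := h ` carrier P\<rparr>\<^esub> y) = \<psi> x \<oplus>\<^bsub>S\<^esub> \<psi> y"
      using p q \<psi>[of "p \<oplus>\<^bsub>P\<^esub> q"] \<psi> by simp
  next
    show "\<psi> \<one>\<^bsub>R\<lparr>carrier := h ` carrier P\<rparr>\<^esub> = \<one>\<^bsub>S\<^esub>"
      using \<psi>[of "\<one>\<^bsub>P\<^esub>"] by simp
  qed
  thus ?thesis using that \<psi> by blast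
qed

text \<open>The map \<open>h\<close> acts on the coefficients of \<open>g\<close>. As it does not
  kill the leading one, the resulting polynomial still has positive degree.\<close>

lemma (in UP_pre_univ_prop) eval_root:
  assumes "polys_have_roots S" and g: "g \<in> carrier P" and d: "deg R g > 0"
    and lc: "h (up_ring.coeff P g (deg R g)) \<noteq> \<zero>\<^bsub>S\<^esub>"
  shows "\<exists>t\<in>carrier S. UnivPoly.eval R S h t g = \<zero>\<^bsub>S\<^esub>"
proof -
  have "(\<lambda>i. h (up_ring.coeff P g i)) \<in> UNIV \<rightarrow> carrier S" using g by simp
  thus ?thesis using assms eval_on_carrier[OF g, of S h]
    unfolding polys_have_roots_def by simp
qed

text \<open>For nonconstant \<open>g\<close>, a root of \<open>g - 1\<close> is a point where
  \<open>g\<close> takes the value 1. A constant \<open>g\<close> has only its leading coefficient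
  as value, and \<open>h\<close> does not kill it.\<close>

lemma (in UP_pre_univ_prop) eval_nonroot:
  assumes roots: "polys_have_roots S" and g: "g \<in> carrier P"
    and lc: "h (up_ring.coeff P g (deg R g)) \<noteq> \<zero>\<^bsub>S\<^esub>"
  shows "\<exists>t\<in>carrier S. UnivPoly.eval R S h t g \<noteq> \<zero>\<^bsub>S\<^esub>"
proof (cases "deg R g = 0")
  case True
  hence "g = up_ring.monom P (up_ring.coeff P g 0) 0" using deg_zero_impl_monom[OF g] by simp
  hence "UnivPoly.eval R S h \<zero>\<^bsub>S\<^esub> g = h (up_ring.coeff P g 0)"
    using eval_const[OF S.zero_closed, of "up_ring.coeff P g 0"] g coeff_closed by metis
  thus ?thesis using lc True by (metis S.zero_closed)
next
  case False
  let ?f = "g \<ominus>\<^bsub>P\<^esub> \<one>\<^bsub>P\<^esub>"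
  have f: "?f \<in> carrier P" using g by simp
  have cf: "up_ring.coeff P ?f (deg R g) = up_ring.coeff P g (deg R g)"
    using g False by (simp add: R.minus_eq)
  have "up_ring.coeff P g (deg R g) \<noteq> \<zero>\<^bsub>R\<^esub>" using lc by auto
  hence "deg R ?f \<ge> deg R g" using deg_belowI[of "deg R g" ?f] f cf by simp
  moreover have "deg R ?f \<le> deg R g"
    unfolding a_minus_def using g by (intro order_trans[OF deg_add]) simp_all
  ultimately have "deg R ?f = deg R g" by simp
  then obtain t where t: "t \<in> carrier S" "UnivPoly.eval R S h t ?f = \<zero>\<^bsub>S\<^esub>"
    using eval_root[OF roots f] cf lc False by auto
  interpret e: ring_hom_cring P S "UnivPoly.eval R S h t"
    using eval_ring_hom[OF t(1)] by unfold_locales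
  have "UnivPoly.eval R S h t g = \<one>\<^bsub>S\<^esub>"
    using t(2) g by (simp add: P.minus_eq S.minus_eq[symmetric])
  moreover have "\<one>\<^bsub>S\<^esub> \<noteq> \<zero>\<^bsub>S\<^esub>"
  proof
    assume "\<one>\<^bsub>S\<^esub> = \<zero>\<^bsub>S\<^esub>"
    hence "carrier S = {\<zero>\<^bsub>S\<^esub>}" using S.one_zeroD by metis
    moreover have "h (up_ring.coeff P g (deg R g)) \<in> carrier S" using g by simp
    ultimately show False using lc by blast
  qed
  ultimately show ?thesis using t(1) by metis
qed


lemma (in domain) nat_pow_nonzero:
  "x \<in> carrier R \<Longrightarrow> x \<noteq> \<zero> \<Longrightarrow> x [^] (n::nat) \<noteq> \<zero>"
  by (induct n) (auto simp: integral_iff)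

lemma (in cring) UP_eval_subring_hom:
  assumes "subring K R" and "x \<in> carrier R"
  shows "ring_hom_cring (UP (R\<lparr>carrier := K\<rparr>)) R (UnivPoly.eval (R\<lparr>carrier := K\<rparr>) R id x)"
proof -
  interpret U: UP_pre_univ_prop "R\<lparr>carrier := K\<rparr>" R id "UP (R\<lparr>carrier := K\<rparr>)"
    using UP_pre_univ_prop_subring[OF assms(1)] by simp_all
  show ?thesis using U.eval_ring_hom[OF assms(2)] by unfold_locales
qed

text \<open>In the algebraic case, \<open>f\<close> is a relation of least degree for \<open>x\<close> and \<open>h\<close> a polynomial of
  least degree representing a nonzero multiple of \<open>b\<close>. Pseudo-division of \<open>f\<close> by \<open>h\<close> shows that
  \<open>h\<close> is constant.\<close>

lemma extend_hom_simple:
  assumes R: "domain R" and K: "subring K R" and x: "x \<in> carrier R"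
    and k: "field k" and roots: "polys_have_roots k"
    and b: "b \<in> generate_ring R (insert x K)" "b \<noteq> \<zero>\<^bsub>R\<^esub>"
  shows "\<exists>c\<in>K. c \<noteq> \<zero>\<^bsub>R\<^esub> \<and>
    (\<forall>\<phi>\<in>ring_hom (R\<lparr>carrier := K\<rparr>) k. \<phi> c \<noteq> \<zero>\<^bsub>k\<^esub> \<longrightarrow>
      (\<exists>\<psi>\<in>ring_hom (R\<lparr>carrier := generate_ring R (insert x K)\<rparr>) k.
         (\<forall>y\<in>K. \<psi> y = \<phi> y) \<and> \<psi> b \<noteq> \<zero>\<^bsub>k\<^esub>))"
proof -
  interpret R: domain R by fact
  interpret k: field k by fact
  let ?Q = "R\<lparr>carrier := K\<rparr>"
  let ?P = "UP ?Q"
  let ?ev = "UnivPoly.eval ?Q R id x"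
  let ?G = "generate_ring R (insert x K)"
  have KR: "K \<subseteq> carrier R" using subringE(1)[OF K] .
  have Qdom: "domain ?Q" using R.subring_is_domain[OF K] .
  interpret Q: domain ?Q by fact
  interpret UQ: UP_domain ?Q ?P by unfold_locales simp
  interpret ev: ring_hom_cring ?P R ?ev using R.UP_eval_subring_hom[OF K x] .
  interpret U: UP_pre_univ_prop ?Q R id ?P
    using R.UP_pre_univ_prop_subring[OF K] by simp_all
  have G: "?G = ?ev ` carrier ?P" using R.generate_ring_insert_eval[OF K x] .
  have evc: "?ev (up_ring.monom ?P c 0) = c" if "c \<in> K" for c
    using U.eval_const[OF x, of c] that by simp
  have evs: "?ev (c \<odot>\<^bsub>?P\<^esub> p) = c \<otimes>\<^bsub>R\<^esub> ?ev p" if "c \<in> K" "p \<in> carrier ?P" for c p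
    using UQ.monom_mult_is_smult[of c p] that evc[of c] ev.hom_mult[of "up_ring.monom ?P c 0" p] by simp
  have cf: "up_ring.coeff ?P p i \<in> K" if "p \<in> carrier ?P" for p i
    using UQ.coeff_closed[OF that] by simp
  have lc0: "up_ring.coeff ?P p (deg ?Q p) \<noteq> \<zero>\<^bsub>R\<^esub>" if "p \<in> carrier ?P" "p \<noteq> \<zero>\<^bsub>?P\<^esub>" for p
    using UQ.lcoeff_nonzero[OF that(2,1)] by simp
  have pw: "c [^]\<^bsub>?Q\<^esub> (j::nat) \<in> K" "c [^]\<^bsub>?Q\<^esub> j \<noteq> \<zero>\<^bsub>R\<^esub>" if "c \<in> K" "c \<noteq> \<zero>\<^bsub>R\<^esub>" for c j
    using Q.nat_pow_closed[of c j] Q.nat_pow_nonzero[of c j] that by (auto) 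
  have const: "p = up_ring.monom ?P (up_ring.coeff ?P p 0) 0" "?ev p = up_ring.coeff ?P p 0"
    if "p \<in> carrier ?P" "deg ?Q p = 0" for p
    using UQ.deg_zero_impl_monom[OF that] evc[OF cf[OF that(1)], of 0] by auto
  \<comment> \<open>An evaluation at \<open>t\<close> that kills all relations of \<open>x\<close>
    depends only on the element of \<open>K[x]\<close> that a polynomial represents, so it descends
    to \<open>K[x]\<close>.\<close>
  have descend: "\<exists>\<psi>\<in>ring_hom (R\<lparr>carrier := ?G\<rparr>) k. (\<forall>y\<in>K. \<psi> y = \<phi> y) \<and>
      (\<forall>g\<in>carrier ?P. \<psi> (?ev g) = UnivPoly.eval ?Q k \<phi> t g)"
    if \<phi>: "\<phi> \<in> ring_hom ?Q k" and t: "t \<in> carrier k"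
      and ker: "\<And>g. g \<in> carrier ?P \<Longrightarrow> ?ev g = \<zero>\<^bsub>R\<^esub> \<Longrightarrow> UnivPoly.eval ?Q k \<phi> t g = \<zero>\<^bsub>k\<^esub>"
    for \<phi> t
  proof -
    interpret V: UP_pre_univ_prop ?Q k \<phi> ?P
      using \<phi> by (intro UP_pre_univ_propI Q.is_cring k.is_cring) simp_all
    obtain \<psi> where \<psi>: "\<psi> \<in> ring_hom (R\<lparr>carrier := ?G\<rparr>) k"
      "\<And>g. g \<in> carrier ?P \<Longrightarrow> \<psi> (?ev g) = UnivPoly.eval ?Q k \<phi> t g"
      using ring_hom_factor[OF UQ.P.ring_axioms R.ring_axioms k.ring_axioms ev.homh
          V.eval_ring_hom[OF t] ker] unfolding G by metis
    have "\<psi> y = \<phi> y" if "y \<in> K" for y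
      using \<psi>(2)[of "up_ring.monom ?P y 0"] V.eval_const[OF t, of y] that evc[OF that] by simp
    thus ?thesis using \<psi> by blast
  qed
  obtain g0 where g0: "g0 \<in> carrier ?P" "b = ?ev g0" using b G by auto
  show ?thesis
  proof (cases "\<exists>f\<in>carrier ?P. f \<noteq> \<zero>\<^bsub>?P\<^esub> \<and> ?ev f = \<zero>\<^bsub>R\<^esub>")
    \<comment> \<open>Here \<open>x\<close> is transcendental over \<open>K\<close>, so any
      \<open>t\<close> may become the image of \<open>x\<close>. The leading coefficient of
      \<open>g0\<close> serves as \<open>c\<close>: if it survives, some \<open>t\<close> keeps the
      value of \<open>g0\<close> nonzero.\<close>
    case False
    have g0n: "g0 \<noteq> \<zero>\<^bsub>?P\<^esub>" using b(2) g0(2) by auto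
    show ?thesis
    proof (intro bexI[of _ "up_ring.coeff ?P g0 (deg ?Q g0)"] conjI ballI impI)
      let ?c = "up_ring.coeff ?P g0 (deg ?Q g0)"
      show "?c \<in> K" using cf g0 by blast
      show "?c \<noteq> \<zero>\<^bsub>R\<^esub>" using lc0 g0(1) g0n by blast
      fix \<phi> assume \<phi>: "\<phi> \<in> ring_hom ?Q k" "\<phi> ?c \<noteq> \<zero>\<^bsub>k\<^esub>"
      interpret V: UP_pre_univ_prop ?Q k \<phi> ?P
        using \<phi> by (intro UP_pre_univ_propI Q.is_cring k.is_cring) simp_all
      obtain t where t: "t \<in> carrier k" "UnivPoly.eval ?Q k \<phi> t g0 \<noteq> \<zero>\<^bsub>k\<^esub>"
        using V.eval_nonroot[OF roots g0(1)] \<phi>(2) by blast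
      interpret e: ring_hom_cring ?P k "UnivPoly.eval ?Q k \<phi> t"
        using V.eval_ring_hom[OF t(1)] by unfold_locales
      obtain \<psi> where "\<psi>\<in>ring_hom (R\<lparr>carrier := ?G\<rparr>) k" "\<forall>y\<in>K. \<psi> y = \<phi> y"
        "\<forall>g\<in>carrier ?P. \<psi> (?ev g) = UnivPoly.eval ?Q k \<phi> t g"
        using descend[OF \<phi>(1) t(1)] False e.hom_zero by metis
      thus "\<exists>\<psi>\<in>ring_hom (R\<lparr>carrier := ?G\<rparr>) k. (\<forall>y\<in>K. \<psi> y = \<phi> y) \<and> \<psi> b \<noteq> \<zero>\<^bsub>k\<^esub>"
        using g0 t(2) by metis
    qed
  next
    case True
    define rel where "rel f \<longleftrightarrow> f \<in> carrier ?P \<and> f \<noteq> \<zero>\<^bsub>?P\<^esub> \<and> ?ev f = \<zero>\<^bsub>R\<^esub>" for f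
    obtain f where f: "rel f" and fmin: "\<And>g. rel g \<Longrightarrow> deg ?Q f \<le> deg ?Q g"
    proof -
      obtain f' where "rel f'" using True unfolding rel_def by blast
      thus ?thesis using that ex_has_least_nat[of rel f' "deg ?Q"] by blast
    qed
    \<comment> \<open>Passing from \<open>b\<close> to a multiple is harmless, because a
      homomorphism that does not kill the multiple does not kill \<open>b\<close>. This freedom
      permits the degree of the representative to be lowered.\<close>
    define mul where "mul h \<longleftrightarrow> h \<in> carrier ?P \<and> ?ev h \<noteq> \<zero>\<^bsub>R\<^esub> \<and>
      (\<exists>v\<in>carrier ?P. ?ev h = b \<otimes>\<^bsub>R\<^esub> ?ev v)" for h
    have mul0: "mul g0" unfolding mul_def using g0 b(2)
      by (intro conjI bexI[of _ "\<one>\<^bsub>?P\<^esub>"]) simp_all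
    obtain h where h: "mul h" and hmin: "\<And>g. mul g \<Longrightarrow> deg ?Q h \<le> deg ?Q g"
      using ex_has_least_nat[of mul _ "deg ?Q", OF mul0] by blast
    have fP: "f \<in> carrier ?P" "f \<noteq> \<zero>\<^bsub>?P\<^esub>" "?ev f = \<zero>\<^bsub>R\<^esub>" using f rel_def by auto
    obtain v where hP: "h \<in> carrier ?P" "?ev h \<noteq> \<zero>\<^bsub>R\<^esub>" "v \<in> carrier ?P" "?ev h = b \<otimes>\<^bsub>R\<^esub> ?ev v"
      using h mul_def by auto
    have h0: "h \<noteq> \<zero>\<^bsub>?P\<^esub>" using hP by auto
    have small: "g = \<zero>\<^bsub>?P\<^esub>" if "g \<in> carrier ?P" "?ev g = \<zero>\<^bsub>R\<^esub>" "deg ?Q g < deg ?Q f" for g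
      using fmin[of g] that unfolding rel_def by auto
    define lf where "lf = up_ring.coeff ?P f (deg ?Q f)"
    have lf: "lf \<in> K" "lf \<noteq> \<zero>\<^bsub>R\<^esub>" unfolding lf_def using cf lc0 fP by auto
    have m: "deg ?Q f > 0"
    proof (rule ccontr)
      assume "\<not> ?thesis"
      thus False using const[OF fP(1)] lf fP(3) unfolding lf_def by simp
    qed
    have bR: "b \<in> carrier R" using g0 by simp
    \<comment> \<open>Pseudo-division by \<open>f\<close> replaces \<open>h\<close> by a remainder
      of degree below \<open>deg f\<close>, whose value at \<open>x\<close> is a nonzero multiple of
      \<open>h(x)\<close>, hence of \<open>b\<close>.\<close>
    have hf: "deg ?Q h < deg ?Q f"
    proof -
      obtain q r j where d: "q \<in> carrier ?P" "r \<in> carrier ?P"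
        "lf [^]\<^bsub>?Q\<^esub> (j::nat) \<odot>\<^bsub>?P\<^esub> h = f \<otimes>\<^bsub>?P\<^esub> q \<oplus>\<^bsub>?P\<^esub> r" "r = \<zero>\<^bsub>?P\<^esub> \<or> deg ?Q r < deg ?Q f"
        using UQ.long_div_theorem[OF fP(1) hP(1) fP(2)] unfolding lf_def by blast
      have "?ev (lf [^]\<^bsub>?Q\<^esub> j \<odot>\<^bsub>?P\<^esub> h) = ?ev r" unfolding d(3) using d(1,2) fP by simp
      hence r: "?ev r = lf [^]\<^bsub>?Q\<^esub> j \<otimes>\<^bsub>R\<^esub> ?ev h" using evs[OF pw(1)[OF lf] hP(1)] by simp
      have lfj: "lf [^]\<^bsub>?Q\<^esub> j \<in> carrier R" using pw(1)[OF lf] KR by blast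
      hence rn: "?ev r \<noteq> \<zero>\<^bsub>R\<^esub>" unfolding r using R.integral_iff[of "lf [^]\<^bsub>?Q\<^esub> j" "?ev h"] pw(2)[OF lf] hP(1,2) by simp
      have "?ev r = b \<otimes>\<^bsub>R\<^esub> ?ev (lf [^]\<^bsub>?Q\<^esub> j \<odot>\<^bsub>?P\<^esub> v)"
        unfolding r evs[OF pw(1)[OF lf] hP(3)] hP(4) using lfj bR hP(3) by (simp add: R.m_lcomm)
      moreover have "lf [^]\<^bsub>?Q\<^esub> j \<odot>\<^bsub>?P\<^esub> v \<in> carrier ?P" using pw(1)[OF lf] hP by simp
      ultimately have "mul r" unfolding mul_def using d(2) rn by blast
      moreover have "deg ?Q r < deg ?Q f" using d(4) rn ev.hom_zero by metis
      ultimately show ?thesis using hmin[of r] by simp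
    qed
    \<comment> \<open>In \<open>lh^j f = h q + r\<close> the value \<open>r(x) = - h(x) q(x)\<close>
      is a multiple of \<open>b\<close>, so minimality of \<open>h\<close> forces
      \<open>r(x) = 0\<close>, and minimality of \<open>f\<close> then gives \<open>r = 0\<close>.
      Now \<open>q(x) = 0\<close>, although \<open>q\<close> is nonzero of degree
      \<open>deg f - deg h < deg f\<close>.\<close>
    have e0: "deg ?Q h = 0"
    proof (rule ccontr)
      assume e: "deg ?Q h \<noteq> 0"
      define lh where "lh = up_ring.coeff ?P h (deg ?Q h)"
      have lh: "lh \<in> K" "lh \<noteq> \<zero>\<^bsub>R\<^esub>" unfolding lh_def using cf lc0 hP h0 by auto
      obtain q r j where d: "q \<in> carrier ?P" "r \<in> carrier ?P"
        "lh [^]\<^bsub>?Q\<^esub> (j::nat) \<odot>\<^bsub>?P\<^esub> f = h \<otimes>\<^bsub>?P\<^esub> q \<oplus>\<^bsub>?P\<^esub> r" "r = \<zero>\<^bsub>?P\<^esub> \<or> deg ?Q r < deg ?Q h"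
        using UQ.long_div_theorem[OF hP(1) fP(1) h0] unfolding lh_def by blast
      let ?l = "lh [^]\<^bsub>?Q\<^esub> j"
      have "?ev (?l \<odot>\<^bsub>?P\<^esub> f) = \<zero>\<^bsub>R\<^esub>" 
        unfolding evs[OF pw(1)[OF lh] fP(1)] fP(3) using pw(1)[OF lh] KR R.r_null by blast
      hence s: "?ev h \<otimes>\<^bsub>R\<^esub> ?ev q \<oplus>\<^bsub>R\<^esub> ?ev r = \<zero>\<^bsub>R\<^esub>" unfolding d(3) using d(1,2) hP(1) by simp
      have "?ev r = \<zero>\<^bsub>R\<^esub>"
      proof (rule ccontr)
        assume rn: "?ev r \<noteq> \<zero>\<^bsub>R\<^esub>"
        have "?ev r = \<ominus>\<^bsub>R\<^esub> (?ev h \<otimes>\<^bsub>R\<^esub> ?ev q)"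
          using s d(1,2) hP(1) R.minus_equality[of "?ev r" "?ev h \<otimes>\<^bsub>R\<^esub> ?ev q"] by (simp add: R.a_comm)
        also have "\<dots> = b \<otimes>\<^bsub>R\<^esub> ?ev (\<ominus>\<^bsub>?P\<^esub> (v \<otimes>\<^bsub>?P\<^esub> q))"
          unfolding hP(4) using d(1) hP(3) bR by (simp add: R.m_assoc R.r_minus)
        finally have "mul r" unfolding mul_def using d(1,2) hP(3) rn
          by (intro conjI bexI[of _ "\<ominus>\<^bsub>?P\<^esub> (v \<otimes>\<^bsub>?P\<^esub> q)"]) simp_all
        hence "deg ?Q h \<le> deg ?Q r" using hmin by blast
        thus False using d(4) rn ev.hom_zero by (metis linorder_not_le)
      qed
      hence r0: "r = \<zero>\<^bsub>?P\<^esub>" using small[OF d(2)] d(4) hf less_trans by blast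
      have "?ev q = \<zero>\<^bsub>R\<^esub>"
        using s \<open>?ev r = \<zero>\<^bsub>R\<^esub>\<close> hP(1,2) d(1) R.integral_iff[of "?ev h" "?ev q"] by simp
      moreover have eq: "?l \<odot>\<^bsub>?P\<^esub> f = h \<otimes>\<^bsub>?P\<^esub> q" unfolding d(3) r0 using d(1) hP(1) by simp
      have lf0: "deg ?Q (?l \<odot>\<^bsub>?P\<^esub> f) = deg ?Q f"
        using UQ.deg_smult[of ?l f] pw[OF lh] fP(1) by simp
      have q0: "q \<noteq> \<zero>\<^bsub>?P\<^esub>"
      proof
        assume "q = \<zero>\<^bsub>?P\<^esub>"
        hence "?l \<odot>\<^bsub>?P\<^esub> f = \<zero>\<^bsub>?P\<^esub>" using eq hP(1) by simp
        thus False using lf0 m by simp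
      qed
      have "deg ?Q f = deg ?Q h + deg ?Q q"
        using UQ.deg_mult[OF h0 q0 hP(1) d(1)] eq lf0 by simp
      ultimately show False using small[OF d(1)] q0 e by auto
    qed
    have hc: "?ev h = up_ring.coeff ?P h 0" by (rule const(2)[OF hP(1) e0])
    show ?thesis
    \<comment> \<open>The factor \<open>lf\<close> preserves the degree of \<open>f\<close> under
      \<open>\<phi>\<close>, so that a root \<open>t\<close> exists; the factor \<open>h(x)\<close>,
      a multiple of \<open>b\<close> that lies in \<open>K\<close>, keeps \<open>\<psi> b\<close>
      nonzero.\<close>
    proof (intro bexI[of _ "lf \<otimes>\<^bsub>R\<^esub> ?ev h"] conjI ballI impI)
      have hK: "?ev h \<in> K" unfolding hc by (rule cf[OF hP(1)])
      let ?c = "lf \<otimes>\<^bsub>R\<^esub> ?ev h"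
      show "?c \<in> K" using subringE(6)[OF K] lf hK by blast
      show "?c \<noteq> \<zero>\<^bsub>R\<^esub>" using R.integral_iff[of lf "?ev h"] lf hP(1,2) KR by auto
      fix \<phi> assume \<phi>: "\<phi> \<in> ring_hom ?Q k" "\<phi> ?c \<noteq> \<zero>\<^bsub>k\<^esub>"
      have \<phi>c: "\<phi> ?c = \<phi> lf \<otimes>\<^bsub>k\<^esub> \<phi> (?ev h)" using ring_hom_mult[OF \<phi>(1), of lf "?ev h"] lf hK by simp
      have \<phi>K: "\<phi> y \<in> carrier k" if "y \<in> K" for y using ring_hom_closed[OF \<phi>(1)] that by simp
      have \<phi>lf: "\<phi> lf \<noteq> \<zero>\<^bsub>k\<^esub>" and \<phi>h: "\<phi> (?ev h) \<noteq> \<zero>\<^bsub>k\<^esub>"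
        using \<phi>(2) k.integral_iff[OF \<phi>K[OF lf(1)] \<phi>K[OF hK]] unfolding \<phi>c by simp_all
      interpret V: UP_pre_univ_prop ?Q k \<phi> ?P
        using \<phi> by (intro UP_pre_univ_propI Q.is_cring k.is_cring) simp_all
      obtain t where t: "t \<in> carrier k" "UnivPoly.eval ?Q k \<phi> t f = \<zero>\<^bsub>k\<^esub>"
        using V.eval_root[OF roots fP(1) m \<phi>lf[unfolded lf_def]] by blast
      let ?e = "UnivPoly.eval ?Q k \<phi> t"
      interpret e: ring_hom_cring ?P k ?e
        using V.eval_ring_hom[OF t(1)] by unfold_locales
      have es: "?e (c \<odot>\<^bsub>?P\<^esub> p) = \<phi> c \<otimes>\<^bsub>k\<^esub> ?e p" if "c \<in> K" "p \<in> carrier ?P" for c p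
        using UQ.monom_mult_is_smult[of c p] that V.eval_const[OF t(1), of c]
          e.hom_mult[of "up_ring.monom ?P c 0" p] by simp
      \<comment> \<open>By minimality of \<open>f\<close>, every relation \<open>g\<close> satisfies
        an equation \<open>lf^j g = f q\<close>. As \<open>\<phi>\<close> does not kill
        \<open>lf\<close>, the root \<open>t\<close> of the image of \<open>f\<close> is a root of
        the image of every relation.\<close>
      have "?e g = \<zero>\<^bsub>k\<^esub>" if g: "g \<in> carrier ?P" "?ev g = \<zero>\<^bsub>R\<^esub>" for g
      proof -
        obtain q r j where d: "q \<in> carrier ?P" "r \<in> carrier ?P"
          "lf [^]\<^bsub>?Q\<^esub> (j::nat) \<odot>\<^bsub>?P\<^esub> g = f \<otimes>\<^bsub>?P\<^esub> q \<oplus>\<^bsub>?P\<^esub> r" "r = \<zero>\<^bsub>?P\<^esub> \<or> deg ?Q r < deg ?Q f"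
          using UQ.long_div_theorem[OF fP(1) g(1) fP(2)] unfolding lf_def by blast
        have pK: "lf [^]\<^bsub>?Q\<^esub> j \<in> K" using pw(1)[OF lf] .
        have "?ev (lf [^]\<^bsub>?Q\<^esub> j \<odot>\<^bsub>?P\<^esub> g) = ?ev r" unfolding d(3) using d(1,2) fP by simp
        moreover have "?ev (lf [^]\<^bsub>?Q\<^esub> j \<odot>\<^bsub>?P\<^esub> g) = \<zero>\<^bsub>R\<^esub>" 
          unfolding evs[OF pK g(1)] g(2) using pK KR R.r_null by blast
        ultimately have "r = \<zero>\<^bsub>?P\<^esub>" using small[OF d(2)] d(4) by metis
        hence "?e (lf [^]\<^bsub>?Q\<^esub> j \<odot>\<^bsub>?P\<^esub> g) = \<zero>\<^bsub>k\<^esub>" unfolding d(3) using d(1) fP(1) t(2) by simp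
        hence "\<phi> (lf [^]\<^bsub>?Q\<^esub> j) \<otimes>\<^bsub>k\<^esub> ?e g = \<zero>\<^bsub>k\<^esub>" using es[OF pK g(1)] by simp
        moreover have "\<phi> (lf [^]\<^bsub>?Q\<^esub> j) = \<phi> lf [^]\<^bsub>k\<^esub> j" using V.hom_pow[of lf j] lf by simp
        moreover have "\<phi> lf [^]\<^bsub>k\<^esub> j \<noteq> \<zero>\<^bsub>k\<^esub>" using \<phi>lf \<phi>K[OF lf(1)] k.nat_pow_nonzero[of "\<phi> lf" j] by auto
        ultimately show ?thesis using k.integral e.hom_closed[OF g(1)] k.nat_pow_closed[OF \<phi>K[OF lf(1)]] by metis
      qed
      then obtain \<psi> where \<psi>: "\<psi>\<in>ring_hom (R\<lparr>carrier := ?G\<rparr>) k" "\<forall>y\<in>K. \<psi> y = \<phi> y"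
        using descend[OF \<phi>(1) t(1)] by blast
      have "\<psi> (?ev h) = \<psi> b \<otimes>\<^bsub>k\<^esub> \<psi> (?ev v)"
        unfolding hP(4) using ring_hom_mult[OF \<psi>(1), of b "?ev v"] b(1) G hP(3) by simp
      moreover have "\<psi> (?ev v) \<in> carrier k"
        using ring_hom_closed[OF \<psi>(1), of "?ev v"] G hP(3) by simp
      moreover have "\<psi> (?ev h) \<noteq> \<zero>\<^bsub>k\<^esub>" using \<psi>(2) hK \<phi>h by simp
      ultimately have "\<psi> b \<noteq> \<zero>\<^bsub>k\<^esub>" by auto
      thus "\<exists>\<psi>\<in>ring_hom (R\<lparr>carrier := ?G\<rparr>) k. (\<forall>y\<in>K. \<psi> y = \<phi> y) \<and> \<psi> b \<noteq> \<zero>\<^bsub>k\<^esub>"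
        using \<psi> by blast
    qed
  qed
qed

text \<open>Induction on the generators: the element \<open>c'\<close> obtained for the generator
  \<open>x\<close> becomes the element to be kept nonzero by the extension to the others.\<close>

lemma extend_hom:
  assumes R: "domain R" and K: "subring K R" and S: "finite S" "S \<subseteq> carrier R"
    and k: "field k" and roots: "polys_have_roots k"
    and b: "b \<in> generate_ring R (K \<union> S)" "b \<noteq> \<zero>\<^bsub>R\<^esub>"
  shows "\<exists>c\<in>K. c \<noteq> \<zero>\<^bsub>R\<^esub> \<and>
    (\<forall>\<phi>\<in>ring_hom (R\<lparr>carrier := K\<rparr>) k. \<phi> c \<noteq> \<zero>\<^bsub>k\<^esub> \<longrightarrow>
      (\<exists>\<psi>\<in>ring_hom (R\<lparr>carrier := generate_ring R (K \<union> S)\<rparr>) k.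
         (\<forall>y\<in>K. \<psi> y = \<phi> y) \<and> \<psi> b \<noteq> \<zero>\<^bsub>k\<^esub>))"
  using S b
proof (induction S arbitrary: b)
  case empty
  interpret R: domain R by fact
  show ?case using empty(2,3) R.generate_ring_subring[OF K] by auto
next
  case (insert x S)
  interpret R: domain R by fact
  let ?G = "generate_ring R (K \<union> S)"
  have KS: "K \<union> S \<subseteq> carrier R" and x: "x \<in> carrier R"
    using insert.prems subringE(1)[OF K] by auto
  have G: "subring ?G R" using R.generate_ring_is_subring[OF KS] .
  have KG: "K \<subseteq> ?G" using R.generate_ringE(2)[OF KS refl] by blast
  have eq: "generate_ring R (insert x ?G) = generate_ring R (K \<union> insert x S)"
    using R.generate_ring_generate_ring_insert[OF KS x] by simp
  obtain c' where c': "c' \<in> ?G" "c' \<noteq> \<zero>\<^bsub>R\<^esub>"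
    "\<And>\<phi>. \<phi>\<in>ring_hom (R\<lparr>carrier := ?G\<rparr>) k \<Longrightarrow> \<phi> c' \<noteq> \<zero>\<^bsub>k\<^esub> \<Longrightarrow>
       \<exists>\<psi>\<in>ring_hom (R\<lparr>carrier := generate_ring R (K \<union> insert x S)\<rparr>) k.
         (\<forall>y\<in>?G. \<psi> y = \<phi> y) \<and> \<psi> b \<noteq> \<zero>\<^bsub>k\<^esub>"
    using extend_hom_simple[OF R G x k roots, unfolded eq, OF insert.prems(2,3)] by blast
  obtain c where c: "c \<in> K" "c \<noteq> \<zero>\<^bsub>R\<^esub>"
    "\<And>\<phi>. \<phi>\<in>ring_hom (R\<lparr>carrier := K\<rparr>) k \<Longrightarrow> \<phi> c \<noteq> \<zero>\<^bsub>k\<^esub> \<Longrightarrow>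
       \<exists>\<psi>\<in>ring_hom (R\<lparr>carrier := ?G\<rparr>) k. (\<forall>y\<in>K. \<psi> y = \<phi> y) \<and> \<psi> c' \<noteq> \<zero>\<^bsub>k\<^esub>"
    using insert.IH[OF _ c'(1,2)] insert.prems(1) by blast
  show ?case
  proof (intro bexI[of _ c] conjI ballI impI c(1,2))
    fix \<phi> assume "\<phi> \<in> ring_hom (R\<lparr>carrier := K\<rparr>) k" "\<phi> c \<noteq> \<zero>\<^bsub>k\<^esub>"
    then obtain \<psi>1 where 1: "\<psi>1\<in>ring_hom (R\<lparr>carrier := ?G\<rparr>) k" "\<forall>y\<in>K. \<psi>1 y = \<phi> y" "\<psi>1 c' \<noteq> \<zero>\<^bsub>k\<^esub>"
      using c(3) by blast
    then obtain \<psi> where "\<psi>\<in>ring_hom (R\<lparr>carrier := generate_ring R (K \<union> insert x S)\<rparr>) k"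
      "\<forall>y\<in>?G. \<psi> y = \<psi>1 y" "\<psi> b \<noteq> \<zero>\<^bsub>k\<^esub>" using c'(3) by blast
    thus "\<exists>\<psi>\<in>ring_hom (R\<lparr>carrier := generate_ring R (K \<union> insert x S)\<rparr>) k.
         (\<forall>y\<in>K. \<psi> y = \<phi> y) \<and> \<psi> b \<noteq> \<zero>\<^bsub>k\<^esub>"
      using 1(2) KG by (metis subsetD)
  qed
qed

text \<open>The image of \<open>\<sigma>\<close> is a copy of \<open>k\<close> and carries the
  inverse of \<open>\<sigma>\<close> as homomorphism to \<open>k\<close>. This inverse is nonzero at
  every nonzero \<open>c\<close>, so it extends to all of \<open>R\<close>.\<close>

lemma exists_rational_point_nonzero:
  assumes k: "field k" and roots: "polys_have_roots k" and R: "domain R"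
    and \<sigma>: "\<sigma> \<in> ring_hom k R" and S: "finite S" "S \<subseteq> carrier R"
    and gen: "generate_ring R (\<sigma> ` carrier k \<union> S) = carrier R"
    and b: "b \<in> carrier R" "b \<noteq> \<zero>\<^bsub>R\<^esub>"
  shows "\<exists>\<psi>\<in>ring_hom R k. (\<forall>c\<in>carrier k. \<psi> (\<sigma> c) = c) \<and> \<psi> b \<noteq> \<zero>\<^bsub>k\<^esub>"
proof -
  interpret R: domain R by fact
  interpret k: field k by fact
  interpret \<sigma>: ring_hom_ring k R \<sigma> using \<sigma> by (intro ring_hom_ringI2) (simp_all add: k.ring_axioms R.ring_axioms)
  let ?K = "\<sigma> ` carrier k"
  have K: "subring ?K R" using \<sigma>.img_is_subring[OF k.carrier_is_subring] .
  have \<sigma>0: "g = \<zero>\<^bsub>k\<^esub>" if "g \<in> carrier k" "\<sigma> g = \<zero>\<^bsub>R\<^esub>" for g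
  proof -
    have "\<sigma> \<one>\<^bsub>k\<^esub> \<in> ?K" by blast
    hence "?K \<noteq> {\<zero>\<^bsub>R\<^esub>}" using R.one_not_zero \<sigma>.hom_one by (metis singletonD)
    hence "inj_on \<sigma> (carrier k)" using \<sigma>.non_trivial_field_hom_imp_inj[OF k] by blast
    thus ?thesis using that \<sigma>.hom_zero k.zero_closed by (metis inj_onD)
  qed
  obtain \<phi> where \<phi>: "\<phi> \<in> ring_hom (R\<lparr>carrier := ?K\<rparr>) k" "\<And>c. c \<in> carrier k \<Longrightarrow> \<phi> (\<sigma> c) = c"
    using ring_hom_factor[OF k.ring_axioms R.ring_axioms k.ring_axioms \<sigma> id_ring_hom] \<sigma>0
    by (metis id_apply)
  obtain c where c: "c \<in> ?K" "c \<noteq> \<zero>\<^bsub>R\<^esub>"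
    "\<And>\<phi>. \<phi>\<in>ring_hom (R\<lparr>carrier := ?K\<rparr>) k \<Longrightarrow> \<phi> c \<noteq> \<zero>\<^bsub>k\<^esub> \<Longrightarrow>
      \<exists>\<psi>\<in>ring_hom (R\<lparr>carrier := generate_ring R (?K \<union> S)\<rparr>) k.
         (\<forall>y\<in>?K. \<psi> y = \<phi> y) \<and> \<psi> b \<noteq> \<zero>\<^bsub>k\<^esub>"
    using extend_hom[OF R K S k roots, of b] gen b by auto
  have "\<phi> c \<noteq> \<zero>\<^bsub>k\<^esub>" using c(1,2) \<phi>(2) \<sigma>.hom_zero by auto
  then obtain \<psi> where "\<psi> \<in> ring_hom R k" "\<forall>y\<in>?K. \<psi> y = \<phi> y" "\<psi> b \<noteq> \<zero>\<^bsub>k\<^esub>"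
    using c(3)[OF \<phi>(1)] gen by auto
  thus ?thesis using \<phi>(2) by (metis imageI)
qed

text \<open>Zorn's lemma yields an ideal maximal among those that contain \<open>I\<close> and no
  power of \<open>a\<close>; such an ideal is prime.\<close>

lemma (in cring) exists_primeideal_avoiding_powers:
  assumes I: "ideal I R" and a: "a \<in> carrier R" and pow: "\<And>n::nat. a [^] n \<notin> I"
  shows "\<exists>M. primeideal M R \<and> I \<subseteq> M \<and> a \<notin> M"
proof -
  define \<A> where "\<A> = {J. ideal J R \<and> I \<subseteq> J \<and> (\<forall>n::nat. a [^] n \<notin> J)}"
  have "\<exists>M\<in>\<A>. \<forall>J\<in>\<A>. M \<subseteq> J \<longrightarrow> J = M"
  proof (rule subset_Zorn_nonempty)
    show "\<A> \<noteq> {}" using I pow unfolding \<A>_def by blast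
    fix C assume C: "C \<noteq> {}" "subset.chain \<A> C"
    hence CA: "C \<subseteq> \<A>" unfolding subset_chain_def by simp
    have "subset.chain {J. ideal J R} C"
      using C(2) unfolding subset_chain_def \<A>_def by auto
    hence id: "ideal (\<Union>C) R" using chain_Union_is_ideal[of C] C(1) by simp
    obtain J where J: "J \<in> C" using C(1) by blast
    have "I \<subseteq> J" using J CA unfolding \<A>_def by auto
    hence "I \<subseteq> \<Union>C" using J by auto
    moreover have "\<forall>n::nat. a [^] n \<notin> \<Union>C" using CA unfolding \<A>_def by auto
    ultimately show "\<Union>C \<in> \<A>" using id unfolding \<A>_def by simp
  qed
  then obtain M where MA: "M \<in> \<A>" and maxA: "\<forall>J\<in>\<A>. M \<subseteq> J \<longrightarrow> J = M" by (elim bexE)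
  have M: "ideal M R" "I \<subseteq> M" "\<And>n::nat. a [^] n \<notin> M" using MA unfolding \<A>_def by auto
  have max: "J = M" if "ideal J R" "I \<subseteq> J" "\<And>n::nat. a [^] n \<notin> J" "M \<subseteq> J" for J
    using maxA that unfolding \<A>_def by simp
  interpret M: ideal M R by fact
  \<comment> \<open>By maximality, adding any \<open>x\<close> outside \<open>M\<close> brings in a
    power of \<open>a\<close>. If neither \<open>x\<close> nor \<open>y\<close> were in
    \<open>M\<close> but their product were, multiplying two such expressions would put a power of
    \<open>a\<close> into \<open>M\<close>.\<close>
  have ex: "\<exists>n m r. m \<in> M \<and> r \<in> carrier R \<and> a [^] (n::nat) = m \<oplus> r \<otimes> x"
    if x: "x \<in> carrier R" "x \<notin> M" for x
  proof -
    let ?X = "M <+>\<^bsub>R\<^esub> PIdl x"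
    have id: "ideal ?X R" using add_ideals[OF M(1) cgenideal_ideal[OF x(1)]] .
    have mem: "y \<in> ?X \<longleftrightarrow> (\<exists>m\<in>M. \<exists>r\<in>carrier R. y = m \<oplus> r \<otimes> x)" for y
      unfolding set_add_def' cgenideal_def by auto
    have "M \<subseteq> ?X"
    proof
      fix m assume m: "m \<in> M"
      hence "m = m \<oplus> \<zero> \<otimes> x" using M.Icarr x by simp
      thus "m \<in> ?X" unfolding mem using m by blast
    qed
    moreover have "x \<in> ?X"
      unfolding mem using x M.zero_closed
      by (intro bexI[of _ \<zero>] bexI[of _ \<one>]) simp_all
    ultimately obtain n where "a [^] (n::nat) \<in> ?X" using max[OF id] x(2) M(2) by (metis subset_trans)
    thus ?thesis unfolding mem by blast
  qed
  have "primeideal M R"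
  proof (rule primeidealI)
    show "ideal M R" by fact
    show "cring R" by (rule is_cring)
    show "carrier R \<noteq> M" using M(3)[of 0] by auto
    fix x y assume xy: "x \<in> carrier R" "y \<in> carrier R" "x \<otimes> y \<in> M"
    show "x \<in> M \<or> y \<in> M"
    proof (rule ccontr)
      assume "\<not> (x \<in> M \<or> y \<in> M)"
      then obtain i m r j m' r' where
        1: "m \<in> M" "r \<in> carrier R" "a [^] (i::nat) = m \<oplus> r \<otimes> x" and
        2: "m' \<in> M" "r' \<in> carrier R" "a [^] (j::nat) = m' \<oplus> r' \<otimes> y"
        using ex xy by meson
      have mc: "m \<in> carrier R" "m' \<in> carrier R" using 1 2 M.Icarr by auto
      have "a [^] (i + j) = a [^] i \<otimes> a [^] j" using a nat_pow_mult by simp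
      also have "\<dots> = m \<otimes> (m' \<oplus> r' \<otimes> y) \<oplus> ((r \<otimes> x) \<otimes> m' \<oplus> (r \<otimes> r') \<otimes> (x \<otimes> y))"
        unfolding 1(3) 2(3) using mc 1(2) 2(2) xy(1,2) by algebra
      also have "\<dots> \<in> M"
        using M.I_r_closed[OF 1(1), of "m' \<oplus> r' \<otimes> y"] M.I_l_closed[OF 2(1), of "r \<otimes> x"]
          M.I_l_closed[OF xy(3), of "r \<otimes> r'"] 1(2) 2(2) mc xy(1,2) by simp
      finally show False using M(3) by blast
    qed
  qed
  thus ?thesis using M(2) M(3)[of 1] a by auto
qed

section \<open>Essential maximal ideals\<close>

lemma structure_map_ring_hom:
  assumes "algebra k A"
  shows "structure_map A \<in> ring_hom k A"
proof -
  interpret algebra k A by fact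
  show ?thesis
    by (rule ring_hom_memI)
      (simp_all add: structure_map_def smult_assoc2 smult_assoc1 smult_l_distr)
qed

text \<open>Since \<open>\<psi>\<close> splits the structure map, each \<open>x\<close> is congruent
  to the scalar \<open>\<psi> x\<close> modulo the kernel, and every coset contains exactly one
  scalar.\<close>

lemma essential_maximal_ideal_kernel:
  assumes k: "field k" and A: "algebra k A" and \<psi>: "\<psi> \<in> ring_hom A k"
    and str: "\<And>c. c \<in> carrier k \<Longrightarrow> \<psi> (structure_map A c) = c"
  shows "essential_maximal_ideal k A (a_kernel A k \<psi>)"
proof -
  interpret k: field k by fact
  interpret A: cring A using A by (simp add: algebra_def)
  interpret \<psi>: ring_hom_ring A k \<psi>
    using \<psi> by (intro ring_hom_ringI2) (simp_all add: k.ring_axioms A.ring_axioms)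
  interpret \<sigma>: ring_hom_ring k A "structure_map A"
    using structure_map_ring_hom[OF A]
    by (intro ring_hom_ringI2) (simp_all add: k.ring_axioms A.ring_axioms)
  let ?M = "a_kernel A k \<psi>"
  have mem: "x \<in> ?M \<longleftrightarrow> x \<in> carrier A \<and> \<psi> x = \<zero>\<^bsub>k\<^esub>" for x
    unfolding a_kernel_def' by blast
  have M: "ideal ?M A" using \<psi>.kernel_is_ideal .
  interpret M: ideal ?M A by fact
  have "maximalideal ?M A"
  proof (rule maximalidealI[OF M])
    show "carrier A \<noteq> ?M" using mem[of "\<one>\<^bsub>A\<^esub>"] A.one_closed \<psi>.hom_one k.one_not_zero by metis
    fix J assume J: "ideal J A" "?M \<subseteq> J" "J \<subseteq> carrier A"
    interpret J: ideal J A by fact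
    show "J = ?M \<or> J = carrier A"
    proof (cases "J \<subseteq> ?M")
      case False
      then obtain j where j: "j \<in> J" "\<psi> j \<noteq> \<zero>\<^bsub>k\<^esub>" using mem J(3) by (meson subset_iff)
      have jc: "j \<in> carrier A" "\<psi> j \<in> carrier k" using J.Icarr[OF j(1)] by simp_all
      \<comment> \<open>With this scalar, \<open>1 - i j\<close> lies in the kernel, so an ideal
        that contains both the kernel and \<open>j\<close> contains 1.\<close>
      let ?i = "structure_map A (inv\<^bsub>k\<^esub> \<psi> j)"
      have u: "\<psi> j \<in> Units k" using jc j(2) k.field_Units by simp
      have ic: "inv\<^bsub>k\<^esub> \<psi> j \<in> carrier k" using u by simp
      have "\<psi> (?i \<otimes>\<^bsub>A\<^esub> j) = \<one>\<^bsub>k\<^esub>" using str[OF ic] jc ic u by simp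
      hence "\<psi> (\<one>\<^bsub>A\<^esub> \<ominus>\<^bsub>A\<^esub> ?i \<otimes>\<^bsub>A\<^esub> j) = \<zero>\<^bsub>k\<^esub>"
        using jc ic by (simp add: A.minus_eq k.r_neg)
      hence "\<one>\<^bsub>A\<^esub> \<ominus>\<^bsub>A\<^esub> ?i \<otimes>\<^bsub>A\<^esub> j \<in> ?M"
        unfolding mem using jc ic by simp
      hence "\<one>\<^bsub>A\<^esub> \<ominus>\<^bsub>A\<^esub> ?i \<otimes>\<^bsub>A\<^esub> j \<in> J" using J(2) by (rule subsetD[rotated])
      moreover have "?i \<otimes>\<^bsub>A\<^esub> j \<in> J" using J.I_l_closed[OF j(1)] ic by simp
      ultimately have "(\<one>\<^bsub>A\<^esub> \<ominus>\<^bsub>A\<^esub> ?i \<otimes>\<^bsub>A\<^esub> j) \<oplus>\<^bsub>A\<^esub> ?i \<otimes>\<^bsub>A\<^esub> j \<in> J" by simp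
      moreover have "(\<one>\<^bsub>A\<^esub> \<ominus>\<^bsub>A\<^esub> ?i \<otimes>\<^bsub>A\<^esub> j) \<oplus>\<^bsub>A\<^esub> ?i \<otimes>\<^bsub>A\<^esub> j = \<one>\<^bsub>A\<^esub>"
        using jc ic by (simp add: A.minus_eq A.a_assoc A.l_neg)
      ultimately show ?thesis using J.one_imp_carrier by simp
    qed (use J(2) in blast)
  qed
  moreover have "(\<lambda>c. ?M +>\<^bsub>A\<^esub> structure_map A c) \<in> ring_iso k (A Quot ?M)"
    unfolding ring_iso_def
  proof (intro CollectI conjI)
    have "(+>\<^bsub>A\<^esub>) ?M \<circ> structure_map A \<in> ring_hom k (A Quot ?M)"
      using ring_hom_trans[OF \<sigma>.homh M.rcos_ring_hom] .
    thus "(\<lambda>c. ?M +>\<^bsub>A\<^esub> structure_map A c) \<in> ring_hom k (A Quot ?M)" by (simp add: comp_def)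
    have eq: "?M +>\<^bsub>A\<^esub> x = ?M +>\<^bsub>A\<^esub> y \<longleftrightarrow> \<psi> x = \<psi> y" if "x \<in> carrier A" "y \<in> carrier A" for x y
    proof -
      have "?M +>\<^bsub>A\<^esub> x = ?M +>\<^bsub>A\<^esub> y \<longleftrightarrow> x \<ominus>\<^bsub>A\<^esub> y \<in> ?M"
        using A.quotient_eq_iff_same_a_r_cos[OF M that] by simp
      also have "\<dots> \<longleftrightarrow> \<psi> x \<ominus>\<^bsub>k\<^esub> \<psi> y = \<zero>\<^bsub>k\<^esub>"
        unfolding mem using that by (simp add: A.minus_eq k.minus_eq)
      also have "\<dots> \<longleftrightarrow> \<psi> x = \<psi> y" using that by simp
      finally show ?thesis .
    qed
    show "bij_betw (\<lambda>c. ?M +>\<^bsub>A\<^esub> structure_map A c) (carrier k) (carrier (A Quot ?M))"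
      unfolding bij_betw_def
    proof
      show "inj_on (\<lambda>c. ?M +>\<^bsub>A\<^esub> structure_map A c) (carrier k)"
      proof (rule inj_onI)
        fix c d assume cd: "c \<in> carrier k" "d \<in> carrier k"
          "?M +>\<^bsub>A\<^esub> structure_map A c = ?M +>\<^bsub>A\<^esub> structure_map A d"
        have "\<psi> (structure_map A c) = \<psi> (structure_map A d)"
          using eq[of "structure_map A c" "structure_map A d"] cd(3) \<sigma>.hom_closed cd(1,2) by metis
        thus "c = d" using str[OF cd(1)] str[OF cd(2)] by simp
      qed
      show "(\<lambda>c. ?M +>\<^bsub>A\<^esub> structure_map A c) ` carrier k = carrier (A Quot ?M)"
      proof
        show "(\<lambda>c. ?M +>\<^bsub>A\<^esub> structure_map A c) ` carrier k \<subseteq> carrier (A Quot ?M)"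
          by (rule image_subsetI) (simp add: ring_hom_closed[OF M.rcos_ring_hom])
        show "carrier (A Quot ?M) \<subseteq> (\<lambda>c. ?M +>\<^bsub>A\<^esub> structure_map A c) ` carrier k"
        proof
          fix C assume "C \<in> carrier (A Quot ?M)"
          then obtain x where x: "x \<in> carrier A" "C = ?M +>\<^bsub>A\<^esub> x"
            unfolding FactRing_def A_RCOSETS_def' partial_object.select_convs by blast
          have "C = ?M +>\<^bsub>A\<^esub> structure_map A (\<psi> x)"
            unfolding x(2) using x(1) by (intro eq[THEN iffD2]) (simp_all add: str)
          thus "C \<in> (\<lambda>c. ?M +>\<^bsub>A\<^esub> structure_map A c) ` carrier k" 
            using x(1) by (intro image_eqI[of _ _ "\<psi> x"]) simp_all
        qed
      qed
    qed
  qed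
  ultimately show ?thesis unfolding essential_maximal_ideal_def by blast
qed

text \<open>The homomorphism is reduction modulo \<open>M\<close> followed by the inverse of the
  isomorphism from \<open>k\<close> to \<open>A/M\<close>. Together with
  \<open>essential_maximal_ideal_kernel\<close> this identifies the essential maximal ideals with
  the kernels of the \<open>k\<close>-algebra homomorphisms from \<open>A\<close> to
  \<open>k\<close>.\<close>

lemma essential_maximal_ideal_hom:
  assumes k: "field k" and A: "algebra k A" and M: "essential_maximal_ideal k A M"
  obtains \<psi> where "\<psi> \<in> ring_hom A k" "\<And>c. c \<in> carrier k \<Longrightarrow> \<psi> (structure_map A c) = c"
    "\<And>x. x \<in> carrier A \<Longrightarrow> \<psi> x = \<zero>\<^bsub>k\<^esub> \<longleftrightarrow> x \<in> M"
proof -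
  interpret k: field k by fact
  interpret A: cring A using A by (simp add: algebra_def)
  interpret M: maximalideal M A using M unfolding essential_maximal_ideal_def by blast
  let ?\<tau> = "\<lambda>c. M +>\<^bsub>A\<^esub> structure_map A c"
  let ?\<psi> = "inv_into (carrier k) ?\<tau> \<circ> (+>\<^bsub>A\<^esub>) M"
  have \<tau>: "?\<tau> \<in> ring_iso k (A Quot M)" using M unfolding essential_maximal_ideal_def by blast
  hence bij: "bij_betw ?\<tau> (carrier k) (carrier (A Quot M))" unfolding ring_iso_def by blast
  have i: "inv_into (carrier k) ?\<tau> \<in> ring_hom (A Quot M) k"
    using ring_iso_set_sym[OF k.ring_axioms \<tau>] unfolding ring_iso_def by blast
  have 1: "?\<psi> \<in> ring_hom A k" using ring_hom_trans[OF M.rcos_ring_hom i] .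
  interpret \<psi>: ring_hom_ring A k ?\<psi>
    using 1 by (intro ring_hom_ringI2) (simp_all add: k.ring_axioms A.ring_axioms)
  have 2: "?\<psi> (structure_map A c) = c" if "c \<in> carrier k" for c
    using bij_betw_inv_into_left[OF bij that] by simp
  have s0: "structure_map A \<zero>\<^bsub>k\<^esub> = \<zero>\<^bsub>A\<^esub>"
    using ring_hom_zero[OF structure_map_ring_hom[OF A] k.ring_axioms A.ring_axioms] .
  have 3: "?\<psi> x = \<zero>\<^bsub>k\<^esub> \<longleftrightarrow> x \<in> M" if x: "x \<in> carrier A" for x
  proof -
    have X: "M +>\<^bsub>A\<^esub> x \<in> carrier (A Quot M)" using ring_hom_closed[OF M.rcos_ring_hom x] .
    have "?\<psi> x = \<zero>\<^bsub>k\<^esub> \<longleftrightarrow> M +>\<^bsub>A\<^esub> x = ?\<tau> \<zero>\<^bsub>k\<^esub>"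
      using bij_betw_inv_into_right[OF bij X] bij_betw_inv_into_left[OF bij k.zero_closed]
      unfolding comp_def by metis
    also have "\<dots> \<longleftrightarrow> x \<ominus>\<^bsub>A\<^esub> \<zero>\<^bsub>A\<^esub> \<in> M"
      using A.quotient_eq_iff_same_a_r_cos[OF M.is_ideal x A.zero_closed] s0 by simp
    also have "\<dots> \<longleftrightarrow> x \<in> M" using x by (simp add: A.minus_eq)
    finally show ?thesis .
  qed
  show ?thesis using that 1 2 3 by blast
qed

section \<open>Values of homogenisations\<close>

text \<open>The monomial factor inside \<open>poly_value\<close>, named so that it can be computed
  by induction on the multiset.\<close>

definition mono_value :: "('s, 'p) ring_scheme \<Rightarrow> ('v \<Rightarrow> 's) \<Rightarrow> 'v multiset \<Rightarrow> 's" where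
  "mono_value S x m = (\<Otimes>\<^bsub>S\<^esub>i\<in>set_mset m. x i [^]\<^bsub>S\<^esub> count m i)"

context cring
begin

lemma mono_value_empty [simp]: "mono_value R x {#} = \<one>"
  unfolding mono_value_def by simp

lemma mono_value_closed [simp]:
  "x \<in> set_mset m \<rightarrow> carrier R \<Longrightarrow> mono_value R x m \<in> carrier R"
  unfolding mono_value_def by (rule finprod_closed) auto

text \<open>The product runs over the support, which grows only if \<open>i\<close> is new.
  Splitting off the factor at \<open>i\<close> covers both cases, with exponent 0 if
  \<open>i\<close> does not occur in \<open>m\<close>.\<close>

lemma mono_value_add_mset:
  assumes x: "x \<in> set_mset (add_mset i m) \<rightarrow> carrier R"
  shows "mono_value R x (add_mset i m) = x i \<otimes> mono_value R x m"
proof -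
  let ?T = "set_mset m - {i}"
  let ?p = "\<Otimes>j\<in>?T. x j [^] count m j"
  have xi: "x i \<in> carrier R" using x by auto
  have p: "?p \<in> carrier R" using x by (intro finprod_closed) auto
  have 1: "mono_value R x m = x i [^] count m i \<otimes> ?p"
  proof (cases "i \<in># m")
    case True
    hence "mono_value R x m = (\<Otimes>j\<in>insert i ?T. x j [^] count m j)"
      unfolding mono_value_def by (simp add: insert_absorb)
    also have "\<dots> = x i [^] count m i \<otimes> ?p"
      using x by (intro finprod_insert) auto
    finally show ?thesis .
  next
    case False
    hence "?T = set_mset m" by auto
    hence "mono_value R x m = ?p" unfolding mono_value_def by simp
    moreover have "count m i = 0" using False by (simp add: not_in_iff)
    ultimately show ?thesis using p by simp
  qed
  have eq: "(\<Otimes>j\<in>?T. x j [^] count (add_mset i m) j) = ?p"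
    using x by (intro finprod_cong') auto
  have "mono_value R x (add_mset i m) = (\<Otimes>j\<in>insert i ?T. x j [^] count (add_mset i m) j)"
    unfolding mono_value_def by simp
  also have "\<dots> = x i [^] count (add_mset i m) i \<otimes> (\<Otimes>j\<in>?T. x j [^] count (add_mset i m) j)"
    using x by (intro finprod_insert) auto
  also have "\<dots> = x i [^] Suc (count m i) \<otimes> ?p" unfolding eq by simp
  also have "\<dots> = x i \<otimes> mono_value R x m"
    unfolding 1 nat_pow_Suc2[OF xi] using xi p by (simp add: m_assoc)
  finally show ?thesis .
qed

lemma mono_value_union:
  assumes "x \<in> set_mset m \<union> set_mset m' \<rightarrow> carrier R"
  shows "mono_value R x (m + m') = mono_value R x m \<otimes> mono_value R x m'"
  using assms
proof (induct m)
  case empty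
  thus ?case by simp
next
  case (add i m)
  have "mono_value R x (add_mset i m + m') = x i \<otimes> mono_value R x (m + m')"
    using mono_value_add_mset[of x i "m + m'"] add.prems by (simp add: Pi_def)
  also have "\<dots> = x i \<otimes> (mono_value R x m \<otimes> mono_value R x m')" using add by (simp add: Pi_def)
  also have "\<dots> = mono_value R x (add_mset i m) \<otimes> mono_value R x m'"
    using mono_value_add_mset[of x i m] add.prems by (simp add: Pi_def m_assoc)
  finally show ?case .
qed

lemma mono_value_scale:
  assumes "x \<in> set_mset m \<rightarrow> carrier R" and "y \<in> carrier R"
  shows "mono_value R (\<lambda>i. y \<otimes> x i) m = y [^] size m \<otimes> mono_value R x m"
  using assms(1)
proof (induct m)
  case empty
  thus ?case by simp
next
  case (add i m)
  have "mono_value R (\<lambda>i. y \<otimes> x i) (add_mset i m) = (y \<otimes> x i) \<otimes> mono_value R (\<lambda>i. y \<otimes> x i) m"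
    using mono_value_add_mset[of "\<lambda>i. y \<otimes> x i" i m] add.prems assms(2) by (simp add: Pi_def)
  also have "\<dots> = (y \<otimes> x i) \<otimes> (y [^] size m \<otimes> mono_value R x m)" using add by (simp add: Pi_def)
  also have "\<dots> = (y [^] size m \<otimes> y) \<otimes> (x i \<otimes> mono_value R x m)"
    using assms(2) add.prems mono_value_closed[of x m] by (simp add: Pi_def m_ac)
  also have "\<dots> = y [^] size (add_mset i m) \<otimes> mono_value R x (add_mset i m)"
    using mono_value_add_mset[of x i m] add.prems by simp
  finally show ?case .
qed

lemma mono_value_image_Some:
  assumes "b \<in> set_mset m \<rightarrow> carrier R"
  shows "mono_value R (case_option y b) (image_mset Some m) = mono_value R b m"
  using assms
proof (induct m)
  case (add i m)
  have "case_option y b \<in> set_mset (add_mset (Some i) (image_mset Some m)) \<rightarrow> carrier R"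
    using add.prems by auto
  from mono_value_add_mset[OF this] show ?case
    using add mono_value_add_mset[of b i m] by simp
qed simp

lemma mono_value_replicate:
  assumes "x i \<in> carrier R"
  shows "mono_value R x (replicate_mset n i) = x i [^] n"
proof (induct n)
  case (Suc n)
  thus ?case
    using mono_value_add_mset[of x i "replicate_mset n i"] assms
    by (auto simp: Pi_def m_comm split: if_splits)
qed simp

end

lemma (in ring_hom_cring) hom_mono_value:
  assumes "x \<in> set_mset m \<rightarrow> carrier R"
  shows "h (mono_value R x m) = mono_value S (\<lambda>i. h (x i)) m"
proof -
  have "h (mono_value R x m) = (\<Otimes>\<^bsub>S\<^esub>i\<in>set_mset m. (h \<circ> (\<lambda>i. x i [^]\<^bsub>R\<^esub> count m i)) i)"
    unfolding mono_value_def using assms by (subst hom_finprod) auto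
  also have "\<dots> = mono_value S (\<lambda>i. h (x i)) m"
    unfolding mono_value_def using assms by (intro S.finprod_cong') (auto simp: Pi_def)
  finally show ?thesis .
qed

lemma (in cring) mono_value_cong:
  assumes "\<And>i. i \<in># m \<Longrightarrow> x i = y i" and "y \<in> set_mset m \<rightarrow> carrier R"
  shows "mono_value R x m = mono_value R y m"
  unfolding mono_value_def using assms by (intro finprod_cong') auto

text \<open>The monomial \<open>X^m Y^(d - |m|)\<close>. While \<open>homogenisation\<close>
  recovers \<open>m\<close> from a given \<open>M\<close>, this is the opposite direction, along
  which sums over the homogenised support are reindexed.\<close>

definition homog_mono :: "nat \<Rightarrow> 'v multiset \<Rightarrow> 'v option multiset" where
  "homog_mono d m = image_mset Some m + replicate_mset (d - size m) None"

lemma dehomogenise_homog_mono: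
  "image_mset the (filter_mset (\<lambda>v. v \<noteq> None) (homog_mono d m)) = m"
proof -
  have "filter_mset (\<lambda>v. v \<noteq> None) (image_mset Some m) = image_mset Some m"
    by (induct m) auto
  moreover have "filter_mset (\<lambda>v. v \<noteq> None) (replicate_mset n None) = {#}" for n
    by (induct n) auto
  moreover have "image_mset the (image_mset Some m) = m" by (induct m) auto
  ultimately show ?thesis unfolding homog_mono_def by simp
qed

lemma count_homog_mono_None: "count (homog_mono d m) None = d - size m"
proof -
  have "count (image_mset Some m) None = 0" by (induct m) auto
  thus ?thesis unfolding homog_mono_def by simp
qed

text \<open>A multiset of options splits into its \<open>Some\<close> part and its copies of
  \<open>None\<close>; the assumption fixes the number of the latter.\<close>

lemma homog_mono_dehomogenise:
  fixes M :: "'v option multiset"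
  defines "m \<equiv> image_mset the (filter_mset (\<lambda>v. v \<noteq> None) M)"
  assumes "count M None = d - size m"
  shows "homog_mono d m = M"
proof -
  have "image_mset Some m = filter_mset (\<lambda>v. v \<noteq> None) M"
    unfolding m_def by (induct M) auto
  moreover have "replicate_mset (d - size m) None = filter_mset (\<lambda>v. \<not> v \<noteq> None) M"
    unfolding assms(2)[symmetric] using filter_eq_replicate_mset[of None M] by simp
  ultimately show ?thesis unfolding homog_mono_def using multiset_partition[of M "\<lambda>v. v \<noteq> None"] by simp
qed

lemma homogenisation_homog_mono: "homogenisation k D (homog_mono (total_degree k D) m) = D m"
  unfolding homogenisation_def Let_def dehomogenise_homog_mono count_homog_mono_None by simp

lemma poly_support_homogenisation:
  "poly_support k (homogenisation k D) = homog_mono (total_degree k D) ` poly_support k D"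
proof (rule equalityI)
  show "poly_support k (homogenisation k D) \<subseteq> homog_mono (total_degree k D) ` poly_support k D"
  proof
    fix M assume M: "M \<in> poly_support k (homogenisation k D)"
    let ?m = "image_mset the (filter_mset (\<lambda>v. v \<noteq> None) M)"
    have "(if count M None = total_degree k D - size ?m then D ?m else \<zero>\<^bsub>k\<^esub>) \<noteq> \<zero>\<^bsub>k\<^esub>"
      using M unfolding poly_support_def homogenisation_def Let_def by blast
    hence "count M None = total_degree k D - size ?m" "?m \<in> poly_support k D"
      unfolding poly_support_def by (simp_all split: if_splits)
    thus "M \<in> homog_mono (total_degree k D) ` poly_support k D"
      using homog_mono_dehomogenise by (metis image_eqI)
  qed
  show "homog_mono (total_degree k D) ` poly_support k D \<subseteq> poly_support k (homogenisation k D)"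
    by (auto simp: poly_support_def homogenisation_homog_mono)
qed

text \<open>The map \<open>homog_mono\<close> has a left inverse and sends the support of
  \<open>D\<close> onto that of its homogenisation, so the defining sum can be taken over the
  support of \<open>D\<close>.\<close>

lemma (in cring) poly_value_homogenisation:
  assumes h: "\<And>m. h (D m) \<in> carrier R" and y: "y \<in> carrier R"
    and b: "\<And>m. m \<in> poly_support k D \<Longrightarrow> b \<in> set_mset m \<rightarrow> carrier R"
  shows "poly_value k R h (homogenisation k D) (case_option y b) =
    (\<Oplus>m\<in>poly_support k D. h (D m) \<otimes> (y [^] (total_degree k D - size m) \<otimes> mono_value R b m))"
proof -
  let ?d = "total_degree k D"
  let ?H = "homog_mono ?d"
  let ?x = "case_option y b"
  have inj: "inj_on ?H (poly_support k D)"
    by (rule inj_on_inverseI) (rule dehomogenise_homog_mono)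
  have v: "mono_value R ?x (?H m) = y [^] (?d - size m) \<otimes> mono_value R b m"
    if "m \<in> poly_support k D" for m
  proof -
    have "mono_value R ?x (?H m) =
        mono_value R ?x (image_mset Some m) \<otimes> mono_value R ?x (replicate_mset (?d - size m) None)"
      unfolding homog_mono_def using b[OF that] y
      by (intro mono_value_union) (auto split: if_splits)
    also have "\<dots> = mono_value R b m \<otimes> y [^] (?d - size m)"
      using mono_value_image_Some[OF b[OF that]] mono_value_replicate[of ?x None] y by simp
    finally show ?thesis using b[OF that] y by (simp add: m_comm)
  qed
  have c: "h (D m) \<otimes> mono_value R ?x (?H m) \<in> carrier R" if "m \<in> poly_support k D" for m
    unfolding v[OF that] using b[OF that] y h by simp
  have "poly_value k R h (homogenisation k D) ?x =
      (\<Oplus>M\<in>?H ` poly_support k D. h (homogenisation k D M) \<otimes> mono_value R ?x M)"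
    unfolding poly_value_def poly_support_homogenisation mono_value_def ..
  also have "\<dots> = (\<Oplus>m\<in>poly_support k D. h (homogenisation k D (?H m)) \<otimes> mono_value R ?x (?H m))"
    using inj c by (intro finsum_reindex) (auto simp: homogenisation_homog_mono)
  also have "\<dots> = (\<Oplus>m\<in>poly_support k D. h (D m) \<otimes> (y [^] (?d - size m) \<otimes> mono_value R b m))"
    using c by (intro finsum_cong') (auto simp: homogenisation_homog_mono v)
  finally show ?thesis .
qed

text \<open>Polynomials are generated from constants by sums and by multiplication with variables.
  Finiteness of the support, on which \<open>total_degree\<close> and the finite sums rely, follows
  by induction on this generation.\<close>

lemma (in ring) indexed_pset_support:
  assumes "P \<in> indexed_pset V (carrier R)"
  shows "finite (poly_support R P)" and "\<And>m. m \<in> poly_support R P \<Longrightarrow> set_mset m \<subseteq> V"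
proof -
  have "finite (poly_support R P) \<and> (\<forall>m\<in>poly_support R P. set_mset m \<subseteq> V)"
    using assms
  proof induct
    case (indexed_const c)
    have "poly_support R (indexed_const c) \<subseteq> {{#}}"
      unfolding poly_support_def indexed_const_def by auto
    thus ?case using finite_subset by fastforce
  next
    case (indexed_padd P Q)
    have "poly_support R (P \<Oplus> Q) \<subseteq> poly_support R P \<union> poly_support R Q"
      unfolding poly_support_def indexed_padd_def by auto
    thus ?case using indexed_padd finite_subset by fastforce
  next
    case (indexed_pmult P i)
    have "poly_support R (P \<Otimes> i) \<subseteq> add_mset i ` poly_support R P"
    proof
      fix m assume "m \<in> poly_support R (P \<Otimes> i)"
      hence "i \<in># m" "m - {#i#} \<in> poly_support R P"
        unfolding poly_support_def indexed_pmult_def by (auto split: if_splits)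
      thus "m \<in> add_mset i ` poly_support R P"
        by (intro image_eqI[of _ _ "m - {#i#}"]) simp_all
    qed
    thus ?case using indexed_pmult finite_subset by fastforce
  qed
  thus "finite (poly_support R P)" "\<And>m. m \<in> poly_support R P \<Longrightarrow> set_mset m \<subseteq> V" by auto
qed

text \<open>The elements of \<open>A\<close> with nonzero image form a submonoid because
  \<open>k\<close> is a domain, so only the generators of \<open>Sigma_set\<close> have to be
  checked.\<close>

lemma hom_Sigma_set_nonzero:
  assumes k: "field k" and A: "algebra k A" and \<psi>: "\<psi> \<in> ring_hom A k"
    and str: "\<And>c. c \<in> carrier k \<Longrightarrow> \<psi> (structure_map A c) = c"
    and a: "a \<in> carrier A" "\<psi> a \<noteq> \<zero>\<^bsub>k\<^esub>" and s: "s \<in> Sigma_set k A a"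
  shows "\<psi> s \<noteq> \<zero>\<^bsub>k\<^esub>"
proof -
  interpret k: field k by fact
  interpret A: cring A using A by (simp add: algebra_def)
  interpret \<psi>: ring_hom_cring A k \<psi> using \<psi> by unfold_locales
  have \<sigma>: "structure_map A c \<in> carrier A" if "c \<in> carrier k" for c
    using ring_hom_closed[OF structure_map_ring_hom[OF A] that] .
  have gen: "\<psi> (poly_value k A (structure_map A) (homogenisation k D) (case_option (a [^]\<^bsub>A\<^esub> n) b)) \<noteq> \<zero>\<^bsub>k\<^esub>
      \<and> poly_value k A (structure_map A) (homogenisation k D) (case_option (a [^]\<^bsub>A\<^esub> n) b) \<in> carrier A"
    if D: "(r, D) \<in> algebraic_signature k" and b: "b \<in> {..<r} \<rightarrow> carrier A" for r D b and n :: nat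
  proof -
    define d where "d = total_degree k D"
    define y where "y = a [^]\<^bsub>A\<^esub> n"
    have y: "y \<in> carrier A" "\<psi> y \<noteq> \<zero>\<^bsub>k\<^esub>" "\<psi> y \<in> carrier k"
      unfolding y_def using a k.nat_pow_nonzero[of "\<psi> a" n] by simp_all
    have DI: "D \<in> ring.indexed_pset k {..<r} (carrier k)"
      and Dn: "\<And>x. x \<in> {..<r} \<rightarrow> carrier k \<Longrightarrow> poly_value k k (\<lambda>c. c) D x \<noteq> \<zero>\<^bsub>k\<^esub>"
      using D unfolding algebraic_signature_def by auto
    have fin: "finite (poly_support k D)"
      and vars: "\<And>m. m \<in> poly_support k D \<Longrightarrow> set_mset m \<subseteq> {..<r}"
      using k.indexed_pset_support[OF DI] by auto
    have Dc: "D m \<in> carrier k" for m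
      using k.indexed_pset_in_carrier[OF subset_refl DI] k.carrier_coeffE by blast
    have bm: "b \<in> set_mset m \<rightarrow> carrier A" if "m \<in> poly_support k D" for m
      using b vars[OF that] by blast
    have sz: "size m \<le> d" if "m \<in> poly_support k D" for m
      unfolding d_def total_degree_def using fin that by simp
    have iu: "inv\<^bsub>k\<^esub> \<psi> y \<in> carrier k" "\<psi> y \<otimes>\<^bsub>k\<^esub> inv\<^bsub>k\<^esub> \<psi> y = \<one>\<^bsub>k\<^esub>"
      using y k.field_Units by simp_all
    \<comment> \<open>The rational point \<open>\<psi>(b) / \<psi>(y)\<close>, at which
      \<open>D\<close> cannot vanish.\<close>
    define u where "u = (\<lambda>i. inv\<^bsub>k\<^esub> \<psi> y \<otimes>\<^bsub>k\<^esub> \<psi> (b i))"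
    have u: "u \<in> {..<r} \<rightarrow> carrier k" unfolding u_def using b iu by auto
    have um: "u \<in> set_mset m \<rightarrow> carrier k" if "m \<in> poly_support k D" for m
      using u vars[OF that] by blast
    have \<psi>m: "\<psi> (mono_value A b m) = \<psi> y [^]\<^bsub>k\<^esub> size m \<otimes>\<^bsub>k\<^esub> mono_value k u m"
      if m: "m \<in> poly_support k D" for m
    proof -
      have "\<psi> (mono_value A b m) = mono_value k (\<lambda>i. \<psi> (b i)) m"
        using \<psi>.hom_mono_value[OF bm[OF m]] .
      also have "\<dots> = mono_value k (\<lambda>i. \<psi> y \<otimes>\<^bsub>k\<^esub> u i) m"
      proof (rule k.mono_value_cong)
        fix i assume "i \<in># m"
        hence "\<psi> (b i) \<in> carrier k" using bm[OF m] by auto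
        thus "\<psi> (b i) = \<psi> y \<otimes>\<^bsub>k\<^esub> u i"
          unfolding u_def using iu y(3) by (simp add: k.m_assoc[symmetric])
      qed (use um[OF m] y(3) in auto)
      also have "\<dots> = \<psi> y [^]\<^bsub>k\<^esub> size m \<otimes>\<^bsub>k\<^esub> mono_value k u m"
        using k.mono_value_scale[OF um[OF m] y(3)] .
      finally show ?thesis .
    qed
    let ?t = "\<lambda>m. structure_map A (D m) \<otimes>\<^bsub>A\<^esub> (y [^]\<^bsub>A\<^esub> (d - size m) \<otimes>\<^bsub>A\<^esub> mono_value A b m)"
    have t: "?t \<in> poly_support k D \<rightarrow> carrier A" using \<sigma> Dc y bm by auto
    have pv: "poly_value k A (structure_map A) (homogenisation k D) (case_option y b) =
        (\<Oplus>\<^bsub>A\<^esub>m\<in>poly_support k D. ?t m)"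
      unfolding d_def using A.poly_value_homogenisation[of "structure_map A" D y k b] \<sigma> Dc y bm by simp
    have "\<psi> (\<Oplus>\<^bsub>A\<^esub>m\<in>poly_support k D. ?t m) = (\<Oplus>\<^bsub>k\<^esub>m\<in>poly_support k D. (\<psi> \<circ> ?t) m)"
      using \<psi>.hom_finsum[OF t] by simp
    also have "\<dots> = (\<Oplus>\<^bsub>k\<^esub>m\<in>poly_support k D. \<psi> y [^]\<^bsub>k\<^esub> d \<otimes>\<^bsub>k\<^esub> (D m \<otimes>\<^bsub>k\<^esub> mono_value k u m))"
    proof (rule k.finsum_cong')
      fix m assume m: "m \<in> poly_support k D"
      have mv: "mono_value k u m \<in> carrier k" using um[OF m] by simp
      have "(\<psi> \<circ> ?t) m = D m \<otimes>\<^bsub>k\<^esub> (\<psi> y [^]\<^bsub>k\<^esub> (d - size m) \<otimes>\<^bsub>k\<^esub> (\<psi> y [^]\<^bsub>k\<^esub> size m \<otimes>\<^bsub>k\<^esub> mono_value k u m))"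
        using \<sigma> Dc y bm[OF m] str \<psi>m[OF m] by simp
      also have "\<dots> = D m \<otimes>\<^bsub>k\<^esub> ((\<psi> y [^]\<^bsub>k\<^esub> (d - size m) \<otimes>\<^bsub>k\<^esub> \<psi> y [^]\<^bsub>k\<^esub> size m) \<otimes>\<^bsub>k\<^esub> mono_value k u m)"
        using mv y by (simp add: k.m_assoc)
      also have "\<psi> y [^]\<^bsub>k\<^esub> (d - size m) \<otimes>\<^bsub>k\<^esub> \<psi> y [^]\<^bsub>k\<^esub> size m = \<psi> y [^]\<^bsub>k\<^esub> d"
        using k.nat_pow_mult[OF y(3)] sz[OF m] by simp
      finally show "(\<psi> \<circ> ?t) m = \<psi> y [^]\<^bsub>k\<^esub> d \<otimes>\<^bsub>k\<^esub> (D m \<otimes>\<^bsub>k\<^esub> mono_value k u m)"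
        using mv y Dc by (simp add: k.m_lcomm)
    qed (use um y Dc in auto)
    also have "\<dots> = \<psi> y [^]\<^bsub>k\<^esub> d \<otimes>\<^bsub>k\<^esub> poly_value k k (\<lambda>c. c) D u"
      unfolding poly_value_def mono_value_def[symmetric]
      using fin y um Dc by (intro k.finsum_rdistr[symmetric]) auto
    finally have "\<psi> (\<Oplus>\<^bsub>A\<^esub>m\<in>poly_support k D. ?t m) = \<psi> y [^]\<^bsub>k\<^esub> d \<otimes>\<^bsub>k\<^esub> poly_value k k (\<lambda>c. c) D u" .
    moreover have "poly_value k k (\<lambda>c. c) D u \<in> carrier k"
      unfolding poly_value_def mono_value_def[symmetric] using um Dc by (intro k.finsum_closed) auto
    ultimately have "\<psi> (\<Oplus>\<^bsub>A\<^esub>m\<in>poly_support k D. ?t m) \<noteq> \<zero>\<^bsub>k\<^esub>"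
      using Dn[OF u] k.nat_pow_nonzero[OF y(3,2), of d] k.integral_iff y(3) by simp
    thus ?thesis unfolding y_def[symmetric] pv using A.finsum_closed[OF t] by simp
  qed
  let ?T = "{s \<in> carrier A. \<psi> s \<noteq> \<zero>\<^bsub>k\<^esub>}"
  have T: "submonoid ?T A"
    by (rule submonoid.intro) (auto simp: k.integral_iff)
  have "?T \<supseteq> {a [^]\<^bsub>A\<^esub> m \<otimes>\<^bsub>A\<^esub>
          poly_value k A (structure_map A) (homogenisation k D) (case_option (a [^]\<^bsub>A\<^esub> n) b)
        | (m::nat) (n::nat) r D b.
          (r, D) \<in> algebraic_signature k \<and> b \<in> {..<r} \<rightarrow> carrier A}"
  proof safe
    fix m n :: nat and r D b
    assume D: "(r, D) \<in> algebraic_signature k" "b \<in> {..<r} \<rightarrow> carrier A"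
    let ?v = "poly_value k A (structure_map A) (homogenisation k D) (case_option (a [^]\<^bsub>A\<^esub> n) b)"
    have v: "?v \<in> carrier A" "\<psi> ?v \<noteq> \<zero>\<^bsub>k\<^esub>" using gen[OF D] by auto
    show "a [^]\<^bsub>A\<^esub> m \<otimes>\<^bsub>A\<^esub> ?v \<in> carrier A" using v a by simp
    assume "\<psi> (a [^]\<^bsub>A\<^esub> m \<otimes>\<^bsub>A\<^esub> ?v) = \<zero>\<^bsub>k\<^esub>"
    hence "\<psi> a [^]\<^bsub>k\<^esub> m \<otimes>\<^bsub>k\<^esub> \<psi> ?v = \<zero>\<^bsub>k\<^esub>" using v a by simp
    thus False using v a k.nat_pow_nonzero[of "\<psi> a" m] k.integral_iff by simp
  qed
  hence "Sigma_set k A a \<subseteq> ?T" unfolding Sigma_set_def using T by (intro hull_minimal)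
  thus ?thesis using s by blast
qed

section \<open>Polynomials as lists of terms\<close>

text \<open>Monomials may recur in the list and terms may cancel. Sums and products of polynomials
  then become list operations, and supports need attention only at the very end.\<close>

definition poly_of_terms :: "('k, 'n) ring_scheme \<Rightarrow> ('k \<times> 'v multiset) list \<Rightarrow> 'v multiset \<Rightarrow> 'k" where
  "poly_of_terms k L =
     foldr (\<lambda>(c, m) P m'. (if m' = m then c else \<zero>\<^bsub>k\<^esub>) \<oplus>\<^bsub>k\<^esub> P m') L (\<lambda>_. \<zero>\<^bsub>k\<^esub>)"

text \<open>The weight \<open>w\<close> of a monomial is left open: it is the value of the monomial
  at a point of \<open>k^r\<close>, or the value of its homogenisation in a fixed degree.\<close>

definition terms_value ::
    "('s, 'p) ring_scheme \<Rightarrow> ('k \<Rightarrow> 's) \<Rightarrow> ('v multiset \<Rightarrow> 's) \<Rightarrow> ('k \<times> 'v multiset) list \<Rightarrow> 's" where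
  "terms_value S h w L = foldr (\<lambda>(c, m) s. h c \<otimes>\<^bsub>S\<^esub> w m \<oplus>\<^bsub>S\<^esub> s) L \<zero>\<^bsub>S\<^esub>"

definition terms_mult ::
    "('k, 'n) ring_scheme \<Rightarrow> ('k \<times> 'v multiset) list \<Rightarrow> ('k \<times> 'v multiset) list \<Rightarrow> ('k \<times> 'v multiset) list" where
  "terms_mult k L L' = concat (map (\<lambda>(c, m). map (\<lambda>(c', m'). (c \<otimes>\<^bsub>k\<^esub> c', m + m')) L') L)"

lemma poly_of_terms_simps [simp]:
  "poly_of_terms k [] = (\<lambda>_. \<zero>\<^bsub>k\<^esub>)"
  "poly_of_terms k ((c, m) # L) = (\<lambda>m'. (if m' = m then c else \<zero>\<^bsub>k\<^esub>) \<oplus>\<^bsub>k\<^esub> poly_of_terms k L m')"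
  by (simp_all add: poly_of_terms_def)

lemma terms_value_simps [simp]:
  "terms_value S h w [] = \<zero>\<^bsub>S\<^esub>"
  "terms_value S h w ((c, m) # L) = h c \<otimes>\<^bsub>S\<^esub> w m \<oplus>\<^bsub>S\<^esub> terms_value S h w L"
  by (simp_all add: terms_value_def)

lemma terms_mult_simps [simp]:
  "terms_mult k [] L' = []"
  "terms_mult k ((c, m) # L) L' = map (\<lambda>(c', m'). (c \<otimes>\<^bsub>k\<^esub> c', m + m')) L' @ terms_mult k L L'"
  by (simp_all add: terms_mult_def)

lemma (in cring) poly_of_terms_closed:
  "\<forall>(c, m)\<in>set L. c \<in> carrier R \<Longrightarrow> poly_of_terms R L m \<in> carrier R"
  by (induct L) auto

lemma (in cring) poly_support_poly_of_terms:
  "\<forall>(c, m)\<in>set L. c \<in> carrier R \<Longrightarrow> poly_support R (poly_of_terms R L) \<subseteq> snd ` set L"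
proof (induct L)
  case (Cons t L)
  thus ?case using poly_of_terms_closed[of L]
    by (cases t) (fastforce simp: poly_support_def split: if_splits)
qed (simp add: poly_support_def)

lemma (in cring) poly_of_terms_indexed_pset:
  assumes "\<forall>(c, m)\<in>set L. c \<in> carrier R \<and> set_mset m \<subseteq> V"
  shows "poly_of_terms R L \<in> indexed_pset V (carrier R)"
  using assms
proof (induct L)
  case Nil
  have "indexed_const \<zero> \<in> indexed_pset V (carrier R)" by (intro indexed_pset.intros) simp
  thus ?case by (simp add: indexed_const_def)
next
  case (Cons t L)
  obtain c m where t: "t = (c, m)" by force
  have c: "c \<in> carrier R" and m: "set_mset m \<subseteq> V" using Cons.prems t by auto
  have "(\<lambda>m'. if m' = m then c else \<zero>) \<in> indexed_pset V (carrier R)" using m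
  proof (induct m)
    case empty
    thus ?case using indexed_pset.indexed_const[OF c, of V] by (simp add: indexed_const_def)
  next
    case (add i m)
    hence "indexed_pmult (\<lambda>m'. if m' = m then c else \<zero>) i \<in> indexed_pset V (carrier R)"
      by (intro indexed_pset.indexed_pmult) auto
    moreover have "indexed_pmult (\<lambda>m'. if m' = m then c else \<zero>) i =
        (\<lambda>m'. if m' = add_mset i m then c else \<zero>)"
      unfolding indexed_pmult_def by (auto simp: fun_eq_iff)
    ultimately show ?case by simp
  qed
  hence "indexed_padd (\<lambda>m'. if m' = m then c else \<zero>) (poly_of_terms R L) \<in> indexed_pset V (carrier R)"
    using Cons by (intro indexed_pset.indexed_padd) auto
  thus ?case unfolding t by (simp add: indexed_padd_def)
qed

lemma (in ring_hom_cring) terms_value_closed: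
  assumes "\<forall>(c, m)\<in>set L. c \<in> carrier R \<and> w m \<in> carrier S"
  shows "terms_value S h w L \<in> carrier S"
  using assms by (induct L) auto

text \<open>The sum is extended from the support to all monomials of the list, since cancelled ones
  contribute zero. On this fixed index set a further term changes a single summand.\<close>

lemma (in ring_hom_cring) finsum_poly_of_terms:
  assumes L: "\<forall>(c, m)\<in>set L. c \<in> carrier R \<and> w m \<in> carrier S"
  shows "(\<Oplus>\<^bsub>S\<^esub>m\<in>poly_support R (poly_of_terms R L). h (poly_of_terms R L m) \<otimes>\<^bsub>S\<^esub> w m) =
    terms_value S h w L"
proof -
  let ?T = "snd ` set L"
  have T: "finite ?T" and w: "w \<in> ?T \<rightarrow> carrier S" using L by auto
  have wT: "w m \<in> carrier S" if "(c, m) \<in> set L" for c m using L that by auto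
  \<comment> \<open>The induction runs over a second list \<open>L'\<close>, so that the index set
    \<open>?T\<close> of the sum stays that of \<open>L\<close>.\<close>
  have sum: "set L' \<subseteq> set L \<Longrightarrow>
      (\<Oplus>\<^bsub>S\<^esub>m\<in>?T. h (poly_of_terms R L' m) \<otimes>\<^bsub>S\<^esub> w m) = terms_value S h w L'" for L'
  proof (induct L')
    case Nil
    have "(\<Oplus>\<^bsub>S\<^esub>m\<in>?T. h (poly_of_terms R [] m) \<otimes>\<^bsub>S\<^esub> w m) = (\<Oplus>\<^bsub>S\<^esub>m\<in>?T. \<zero>\<^bsub>S\<^esub>)"
      using wT by (intro S.finsum_cong') auto
    thus ?case by simp
  next
    case (Cons t L')
    obtain c m where t: "t = (c, m)" by force
    have c: "c \<in> carrier R" and m: "m \<in> ?T" using Cons.prems L t by force+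
    have wm: "w m \<in> carrier S" using w m by auto
    have L': "\<forall>(c, m)\<in>set L'. c \<in> carrier R" using Cons.prems L by fastforce
    have cl: "poly_of_terms R L' m' \<in> carrier R" for m' using R.poly_of_terms_closed[OF L'] .
    have "(\<Oplus>\<^bsub>S\<^esub>m'\<in>?T. h (poly_of_terms R (t # L') m') \<otimes>\<^bsub>S\<^esub> w m') =
        (\<Oplus>\<^bsub>S\<^esub>m'\<in>?T. (if m = m' then h c \<otimes>\<^bsub>S\<^esub> w m' else \<zero>\<^bsub>S\<^esub>) \<oplus>\<^bsub>S\<^esub> h (poly_of_terms R L' m') \<otimes>\<^bsub>S\<^esub> w m')"
    proof (rule S.finsum_cong')
      fix m' assume "m' \<in> ?T"
      hence "w m' \<in> carrier S" using w by blast
      thus "h (poly_of_terms R (t # L') m') \<otimes>\<^bsub>S\<^esub> w m' =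
        (if m = m' then h c \<otimes>\<^bsub>S\<^esub> w m' else \<zero>\<^bsub>S\<^esub>) \<oplus>\<^bsub>S\<^esub> h (poly_of_terms R L' m') \<otimes>\<^bsub>S\<^esub> w m'"
        unfolding t using c cl by (simp add: S.l_distr)
    qed (use wT c cl in auto)
    also have "\<dots> = (\<Oplus>\<^bsub>S\<^esub>m'\<in>?T. if m = m' then h c \<otimes>\<^bsub>S\<^esub> w m' else \<zero>\<^bsub>S\<^esub>) \<oplus>\<^bsub>S\<^esub>
        (\<Oplus>\<^bsub>S\<^esub>m'\<in>?T. h (poly_of_terms R L' m') \<otimes>\<^bsub>S\<^esub> w m')"
      using wT c cl by (intro S.finsum_addf) auto
    also have "(\<Oplus>\<^bsub>S\<^esub>m'\<in>?T. if m = m' then h c \<otimes>\<^bsub>S\<^esub> w m' else \<zero>\<^bsub>S\<^esub>) = h c \<otimes>\<^bsub>S\<^esub> w m"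
      using S.finsum_singleton[OF m T, of "\<lambda>m'. h c \<otimes>\<^bsub>S\<^esub> w m'"] w c by auto
    also have "(\<Oplus>\<^bsub>S\<^esub>m'\<in>?T. h (poly_of_terms R L' m') \<otimes>\<^bsub>S\<^esub> w m') = terms_value S h w L'"
      using Cons by simp
    finally show ?case unfolding t by simp
  qed
  have "\<forall>(c, m)\<in>set L. c \<in> carrier R" using L by auto
  note sub = R.poly_support_poly_of_terms[OF this] and cl = R.poly_of_terms_closed[OF this]
  have "(\<Oplus>\<^bsub>S\<^esub>m\<in>poly_support R (poly_of_terms R L). h (poly_of_terms R L m) \<otimes>\<^bsub>S\<^esub> w m) =
      (\<Oplus>\<^bsub>S\<^esub>m\<in>?T. h (poly_of_terms R L m) \<otimes>\<^bsub>S\<^esub> w m)"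
  proof (rule S.add.finprod_mono_neutral_cong_left[OF T sub])
    fix m assume "m \<in> ?T - poly_support R (poly_of_terms R L)"
    hence "poly_of_terms R L m = \<zero>\<^bsub>R\<^esub>" "w m \<in> carrier S" using w unfolding poly_support_def by auto
    thus "h (poly_of_terms R L m) \<otimes>\<^bsub>S\<^esub> w m = \<zero>\<^bsub>S\<^esub>" by simp
  qed (use wT cl in auto)
  thus ?thesis using sum[of L] by simp
qed

lemma (in ring_hom_cring) terms_value_append:
  assumes "\<forall>(c, m)\<in>set L. c \<in> carrier R \<and> w m \<in> carrier S"
    and "\<forall>(c, m)\<in>set L'. c \<in> carrier R \<and> w m \<in> carrier S"
  shows "terms_value S h w (L @ L') = terms_value S h w L \<oplus>\<^bsub>S\<^esub> terms_value S h w L'"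
  using assms(1)
proof (induct L)
  case Nil
  thus ?case using terms_value_closed[OF assms(2)] by simp
next
  case (Cons t L)
  obtain c m where t: "t = (c, m)" by force
  thus ?case using Cons terms_value_closed[OF assms(2)] terms_value_closed[of L w]
    by (auto simp: S.a_assoc)
qed

text \<open>Three weights occur because the weight of a homogenised monomial depends on the degree:
  \<open>w\<close> and \<open>w'\<close> belong to degrees \<open>d\<close> and \<open>d'\<close> of
  the factors, \<open>v\<close> to \<open>d + d'\<close>.\<close>

lemma (in ring_hom_cring) terms_value_mult:
  assumes L: "\<forall>(c, m)\<in>set L. c \<in> carrier R \<and> w m \<in> carrier S"
    and L': "\<forall>(c, m)\<in>set L'. c \<in> carrier R \<and> w' m \<in> carrier S"
    and mult: "\<And>c m c' m'. (c, m) \<in> set L \<Longrightarrow> (c', m') \<in> set L' \<Longrightarrow> v (m + m') = w m \<otimes>\<^bsub>S\<^esub> w' m'"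
  shows "terms_value S h v (terms_mult R L L') = terms_value S h w L \<otimes>\<^bsub>S\<^esub> terms_value S h w' L'"
  using L mult
proof (induct L)
  case Nil
  thus ?case using terms_value_closed[OF L'] by simp
next
  case (Cons t L)
  obtain c m where t: "t = (c, m)" by force
  let ?f = "map (\<lambda>(c', m'). (c \<otimes>\<^bsub>R\<^esub> c', m + m'))"
  have c: "c \<in> carrier R" "w m \<in> carrier S" using Cons.prems(1) t by auto
  have IH: "terms_value S h v (terms_mult R L L') = terms_value S h w L \<otimes>\<^bsub>S\<^esub> terms_value S h w' L'"
  proof (rule Cons.hyps)
    show "\<forall>(c, m)\<in>set L. c \<in> carrier R \<and> w m \<in> carrier S" using Cons.prems(1) by simp
    show "v (m + m') = w m \<otimes>\<^bsub>S\<^esub> w' m'" if "(c, m) \<in> set L" "(c', m') \<in> set L'" for c m c' m'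
      using Cons.prems(2)[of c m c' m'] that by simp
  qed
  have v: "v (m + m') = w m \<otimes>\<^bsub>S\<^esub> w' m'" if "(c', m') \<in> set L'" for c' m'
    using Cons.prems(2)[of c m c' m'] that t by simp
  have 1: "set L'' \<subseteq> set L' \<Longrightarrow>
      terms_value S h v (?f L'') = (h c \<otimes>\<^bsub>S\<^esub> w m) \<otimes>\<^bsub>S\<^esub> terms_value S h w' L''" for L''
  proof (induct L'')
    case Nil
    thus ?case using c by simp
  next
    case (Cons t' L'')
    obtain c' m' where t': "t' = (c', m')" by force
    have c': "c' \<in> carrier R" "w' m' \<in> carrier S" using Cons.prems t' L' by auto
    have "terms_value S h w' L'' \<in> carrier S"
      using L' Cons.prems by (intro terms_value_closed) auto
    thus ?case using Cons v[of c' m'] c c' unfolding t' by (simp add: S.r_distr S.m_ac)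
  qed
  have "terms_value S h v (terms_mult R (t # L) L') =
      terms_value S h v (?f L') \<oplus>\<^bsub>S\<^esub> terms_value S h v (terms_mult R L L')"
    unfolding t terms_mult_simps
  proof (rule terms_value_append)
    show "\<forall>(c, m)\<in>set (?f L'). c \<in> carrier R \<and> v m \<in> carrier S"
      using c L' v by fastforce
    show "\<forall>(c, m)\<in>set (terms_mult R L L'). c \<in> carrier R \<and> v m \<in> carrier S"
    proof safe
      fix a n assume "(a, n) \<in> set (terms_mult R L L')"
      then obtain c1 m1 c2 m2 where 2: "(c1, m1) \<in> set L" "(c2, m2) \<in> set L'" "a = c1 \<otimes>\<^bsub>R\<^esub> c2" "n = m1 + m2"
        unfolding terms_mult_def by auto
      have "c1 \<in> carrier R" "w m1 \<in> carrier S" "c2 \<in> carrier R" "w' m2 \<in> carrier S"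
        using 2(1,2) Cons.prems(1) L' by auto
      moreover have "v n = w m1 \<otimes>\<^bsub>S\<^esub> w' m2" using 2 Cons.prems(2)[of c1 m1 c2 m2] by simp
      ultimately show "a \<in> carrier R" "v n \<in> carrier S" using 2(3) by simp_all
    qed
  qed
  also have "\<dots> = (h c \<otimes>\<^bsub>S\<^esub> w m) \<otimes>\<^bsub>S\<^esub> terms_value S h w' L' \<oplus>\<^bsub>S\<^esub>
      terms_value S h w L \<otimes>\<^bsub>S\<^esub> terms_value S h w' L'"
    using 1[of L'] IH by simp
  also have "\<dots> = terms_value S h w (t # L) \<otimes>\<^bsub>S\<^esub> terms_value S h w' L'"
    using c Cons.prems(1) terms_value_closed[OF L'] terms_value_closed[of L w]
    unfolding t by (simp add: S.l_distr)
  finally show ?case .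
qed

section \<open>Values of homogenised polynomials in a prescribed degree\<close>

locale homogeneous_evaluation =
  k: field k + A: cring A for k :: "('k, 'n) ring_scheme" and A :: "('a, 'm) ring_scheme" +
  fixes \<sigma> :: "'k \<Rightarrow> 'a" and r :: nat and b :: "nat \<Rightarrow> 'a" and y :: 'a
  assumes \<sigma>: "\<sigma> \<in> ring_hom k A" and b: "b \<in> {..<r} \<rightarrow> carrier A" and y: "y \<in> carrier A"
begin

text \<open>The value of \<open>X^m Y^(d - |m|)\<close> at \<open>(b, y)\<close>. The degree
  \<open>d\<close> is a free parameter, since the total degree of a sum may drop and only an upper
  bound can be tracked.\<close>

definition weight :: "nat \<Rightarrow> nat multiset \<Rightarrow> 'a" where
  "weight d m = y [^]\<^bsub>A\<^esub> (d - size m) \<otimes>\<^bsub>A\<^esub> mono_value A b m"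

definition bounded :: "nat \<Rightarrow> ('k \<times> nat multiset) list \<Rightarrow> bool" where
  "bounded d L \<longleftrightarrow> (\<forall>(c, m)\<in>set L. c \<in> carrier k \<and> set_mset m \<subseteq> {..<r} \<and> size m \<le> d)"

text \<open>\<open>represents d f z\<close>: some polynomial of degree at most \<open>d\<close> takes the values \<open>f\<close> on \<open>k\<^sup>r\<close>, and
  its homogenisation in degree \<open>d\<close> takes the value \<open>z\<close> at \<open>(b, y)\<close>.\<close>

definition represents :: "nat \<Rightarrow> ((nat \<Rightarrow> 'k) \<Rightarrow> 'k) \<Rightarrow> 'a \<Rightarrow> bool" where
  "represents d f z \<longleftrightarrow> (\<exists>L. bounded d L \<and>
     (\<forall>u\<in>{..<r} \<rightarrow> carrier k. terms_value k id (mono_value k u) L = f u) \<and>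
     terms_value A \<sigma> (weight d) L = z)"

sublocale \<sigma>: ring_hom_cring k A \<sigma>
  using \<sigma> by unfold_locales

sublocale id: ring_hom_cring k k id
  by unfold_locales simp

lemma weight_closed: "set_mset m \<subseteq> {..<r} \<Longrightarrow> weight d m \<in> carrier A"
  unfolding weight_def using b y by (intro A.m_closed A.mono_value_closed) auto

text \<open>The size bounds make the exponents of \<open>y\<close> add up, since subtraction is
  truncated.\<close>

lemma weight_mult:
  assumes "set_mset m \<subseteq> {..<r}" "size m \<le> d" "set_mset m' \<subseteq> {..<r}" "size m' \<le> d'"
  shows "weight (d + d') (m + m') = weight d m \<otimes>\<^bsub>A\<^esub> weight d' m'"
proof -
  have "mono_value A b (m + m') = mono_value A b m \<otimes>\<^bsub>A\<^esub> mono_value A b m'"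
    using assms b by (intro A.mono_value_union) auto
  moreover have "mono_value A b m \<in> carrier A" "mono_value A b m' \<in> carrier A"
    using assms b by (auto intro!: A.mono_value_closed)
  moreover have "y [^]\<^bsub>A\<^esub> ((d + d') - size (m + m')) = y [^]\<^bsub>A\<^esub> (d - size m) \<otimes>\<^bsub>A\<^esub> y [^]\<^bsub>A\<^esub> (d' - size m')"
    using A.nat_pow_mult[OF y, of "d - size m" "d' - size m'"] assms by simp
  ultimately show ?thesis unfolding weight_def using y by (simp add: A.m_ac)
qed

lemma bounded_terms:
  assumes "bounded d L"
  shows "\<forall>(c, m)\<in>set L. c \<in> carrier k \<and> weight d' m \<in> carrier A"
    and "u \<in> {..<r} \<rightarrow> carrier k \<Longrightarrow> \<forall>(c, m)\<in>set L. c \<in> carrier k \<and> mono_value k u m \<in> carrier k"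
proof -
  have L: "c \<in> carrier k" "set_mset m \<subseteq> {..<r}" if "(c, m) \<in> set L" for c m
    using assms that unfolding bounded_def by auto
  show "\<forall>(c, m)\<in>set L. c \<in> carrier k \<and> weight d' m \<in> carrier A"
    using L weight_closed by blast
  show "\<forall>(c, m)\<in>set L. c \<in> carrier k \<and> mono_value k u m \<in> carrier k"
    if u: "u \<in> {..<r} \<rightarrow> carrier k"
  proof safe
    fix c m assume cm: "(c, m) \<in> set L"
    show "c \<in> carrier k" using L(1)[OF cm] .
    have "u \<in> set_mset m \<rightarrow> carrier k" using u L(2)[OF cm] by blast
    thus "mono_value k u m \<in> carrier k" by simp
  qed
qed

lemma represents_closed: "represents d f z \<Longrightarrow> z \<in> carrier A"
  unfolding represents_def using \<sigma>.terms_value_closed[OF bounded_terms(1)] by blast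

lemma represents_add:
  assumes "represents d f z" and "represents d f' z'"
  shows "represents d (\<lambda>u. f u \<oplus>\<^bsub>k\<^esub> f' u) (z \<oplus>\<^bsub>A\<^esub> z')"
proof -
  obtain L L' where L: "bounded d L" "\<And>u. u\<in>{..<r} \<rightarrow> carrier k \<Longrightarrow> terms_value k id (mono_value k u) L = f u"
      "terms_value A \<sigma> (weight d) L = z"
    and L': "bounded d L'" "\<And>u. u\<in>{..<r} \<rightarrow> carrier k \<Longrightarrow> terms_value k id (mono_value k u) L' = f' u"
      "terms_value A \<sigma> (weight d) L' = z'"
    using assms unfolding represents_def by blast
  have "bounded d (L @ L')" using L(1) L'(1) unfolding bounded_def by auto
  moreover have "terms_value k id (mono_value k u) (L @ L') = f u \<oplus>\<^bsub>k\<^esub> f' u"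
    if "u\<in>{..<r} \<rightarrow> carrier k" for u
    using id.terms_value_append[OF bounded_terms(2)[OF L(1) that] bounded_terms(2)[OF L'(1) that]]
      L(2)[OF that] L'(2)[OF that] by simp
  moreover have "terms_value A \<sigma> (weight d) (L @ L') = z \<oplus>\<^bsub>A\<^esub> z'"
    using \<sigma>.terms_value_append[OF bounded_terms(1)[OF L(1)] bounded_terms(1)[OF L'(1)]] L(3) L'(3) by simp
  ultimately show ?thesis unfolding represents_def by blast
qed

lemma represents_mult:
  assumes "represents d f z" and "represents d' f' z'"
  shows "represents (d + d') (\<lambda>u. f u \<otimes>\<^bsub>k\<^esub> f' u) (z \<otimes>\<^bsub>A\<^esub> z')"
proof -
  obtain L L' where L: "bounded d L" "\<And>u. u\<in>{..<r} \<rightarrow> carrier k \<Longrightarrow> terms_value k id (mono_value k u) L = f u"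
      "terms_value A \<sigma> (weight d) L = z"
    and L': "bounded d' L'" "\<And>u. u\<in>{..<r} \<rightarrow> carrier k \<Longrightarrow> terms_value k id (mono_value k u) L' = f' u"
      "terms_value A \<sigma> (weight d') L' = z'"
    using assms unfolding represents_def by blast
  have "bounded (d + d') (terms_mult k L L')"
    unfolding bounded_def
  proof safe
    fix c m assume "(c, m) \<in> set (terms_mult k L L')"
    then obtain c1 m1 c2 m2 where 1: "(c1, m1) \<in> set L" "(c2, m2) \<in> set L'" "c = c1 \<otimes>\<^bsub>k\<^esub> c2" "m = m1 + m2"
      unfolding terms_mult_def by auto
    have 2: "c1 \<in> carrier k \<and> set_mset m1 \<subseteq> {..<r} \<and> size m1 \<le> d"
      "c2 \<in> carrier k \<and> set_mset m2 \<subseteq> {..<r} \<and> size m2 \<le> d'"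
      using 1(1,2) L(1) L'(1) unfolding bounded_def by auto
    show "c \<in> carrier k" using 1 2 by simp
    show "size m \<le> d + d'" using 1 2 by simp
    fix i assume "i \<in># m"
    thus "i < r" using 1 2 by auto
  qed
  moreover have "terms_value k id (mono_value k u) (terms_mult k L L') = f u \<otimes>\<^bsub>k\<^esub> f' u"
    if u: "u\<in>{..<r} \<rightarrow> carrier k" for u
  proof -
    have "mono_value k u (m + m') = mono_value k u m \<otimes>\<^bsub>k\<^esub> mono_value k u m'"
      if "(c, m) \<in> set L" "(c', m') \<in> set L'" for c m c' m'
    proof -
      have "set_mset m \<union> set_mset m' \<subseteq> {..<r}"
        using that L(1) L'(1) unfolding bounded_def by auto
      hence "u \<in> set_mset m \<union> set_mset m' \<rightarrow> carrier k" using u by blast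
      thus ?thesis by (rule k.mono_value_union)
    qed
    thus ?thesis
      using id.terms_value_mult[OF bounded_terms(2)[OF L(1) u] bounded_terms(2)[OF L'(1) u], of "mono_value k u"]
        L(2)[OF u] L'(2)[OF u] by simp
  qed
  moreover have "terms_value A \<sigma> (weight (d + d')) (terms_mult k L L') = z \<otimes>\<^bsub>A\<^esub> z'"
  proof -
    have "weight (d + d') (m + m') = weight d m \<otimes>\<^bsub>A\<^esub> weight d' m'"
      if "(c, m) \<in> set L" "(c', m') \<in> set L'" for c m c' m'
      using that L(1) L'(1) unfolding bounded_def by (intro weight_mult) auto
    thus ?thesis
      using \<sigma>.terms_value_mult[OF bounded_terms(1)[OF L(1)] bounded_terms(1)[OF L'(1)], of "weight (d + d')" d d']
        L(3) L'(3) by simp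
  qed
  ultimately show ?thesis unfolding represents_def by blast
qed

lemma represents_const: "c \<in> carrier k \<Longrightarrow> represents 0 (\<lambda>_. c) (\<sigma> c)"
  unfolding represents_def
  by (intro exI[of _ "[(c, {#})]"]) (simp add: bounded_def weight_def)

lemma represents_var:
  assumes "i < r"
  shows "represents 1 (\<lambda>u. u i) (b i)"
proof -
  have "mono_value k u {#i#} = u i" if "u \<in> {..<r} \<rightarrow> carrier k" for u
    using that assms k.mono_value_add_mset[of u i "{#}"] by auto
  moreover have "mono_value A b {#i#} = b i"
    using b assms A.mono_value_add_mset[of b i "{#}"] by auto
  moreover have "b i \<in> carrier A" using b assms by auto
  moreover have "u i \<in> carrier k" if "u \<in> {..<r} \<rightarrow> carrier k" for u :: "nat \<Rightarrow> 'k"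
    using that assms by auto
  ultimately show ?thesis
    unfolding represents_def using assms
    by (intro exI[of _ "[(\<one>\<^bsub>k\<^esub>, {#i#})]"]) (auto simp: bounded_def weight_def)
qed

text \<open>Homogenised in degree 1, the constant 1 becomes \<open>Y\<close>. Multiplying by it
  raises the degree without changing the polynomial.\<close>

lemma represents_one: "represents 1 (\<lambda>_. \<one>\<^bsub>k\<^esub>) y"
  unfolding represents_def using y
  by (intro exI[of _ "[(\<one>\<^bsub>k\<^esub>, {#})]"]) (simp add: bounded_def weight_def)

lemma represents_cong:
  "represents d f z \<Longrightarrow> (\<And>u. u \<in> {..<r} \<rightarrow> carrier k \<Longrightarrow> f u = f' u) \<Longrightarrow> represents d f' z"
  unfolding represents_def by metis

lemma represents_fun_closed: "represents d f z \<Longrightarrow> u \<in> {..<r} \<rightarrow> carrier k \<Longrightarrow> f u \<in> carrier k"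
  unfolding represents_def using id.terms_value_closed[OF bounded_terms(2)] by metis

text \<open>Serves to bring two polynomials to a common degree before they are added or inserted
  into a form.\<close>

lemma represents_lift:
  assumes "represents d f z"
  shows "represents (d + e) f (y [^]\<^bsub>A\<^esub> e \<otimes>\<^bsub>A\<^esub> z)"
proof (induct e)
  case 0
  thus ?case using assms represents_closed[OF assms] by simp
next
  case (Suc e)
  have "represents (d + e + 1) (\<lambda>u. f u \<otimes>\<^bsub>k\<^esub> \<one>\<^bsub>k\<^esub>) ((y [^]\<^bsub>A\<^esub> e \<otimes>\<^bsub>A\<^esub> z) \<otimes>\<^bsub>A\<^esub> y)"
    using represents_mult[OF Suc represents_one] .
  moreover have "(y [^]\<^bsub>A\<^esub> e \<otimes>\<^bsub>A\<^esub> z) \<otimes>\<^bsub>A\<^esub> y = y [^]\<^bsub>A\<^esub> Suc e \<otimes>\<^bsub>A\<^esub> z"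
    using y represents_closed[OF assms] by (simp add: A.m_ac)
  ultimately show ?case
    using represents_fun_closed[OF assms] by (auto intro: represents_cong)
qed

lemma represents_pow:
  assumes "represents d f z"
  shows "represents (d * n) (\<lambda>u. f u [^]\<^bsub>k\<^esub> n) (z [^]\<^bsub>A\<^esub> n)"
proof (induct n)
  case 0
  thus ?case using represents_const[OF k.one_closed] by simp
next
  case (Suc n)
  show ?case using represents_mult[OF Suc assms] by (simp add: add.commute)
qed

lemma represents_sum:
  assumes "finite F" and "\<And>i. i \<in> F \<Longrightarrow> represents d (f i) (z i)"
  shows "represents d (\<lambda>u. \<Oplus>\<^bsub>k\<^esub>i\<in>F. f i u) (\<Oplus>\<^bsub>A\<^esub>i\<in>F. z i)"
  using assms
proof (induct F)
  case empty
  have "represents d (\<lambda>_. \<zero>\<^bsub>k\<^esub>) \<zero>\<^bsub>A\<^esub>"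
    unfolding represents_def by (intro exI[of _ "[]"]) (simp add: bounded_def)
  thus ?case by simp
next
  case (insert i F)
  have "represents d (\<lambda>u. f i u \<oplus>\<^bsub>k\<^esub> (\<Oplus>\<^bsub>k\<^esub>i\<in>F. f i u)) (z i \<oplus>\<^bsub>A\<^esub> (\<Oplus>\<^bsub>A\<^esub>i\<in>F. z i))"
    using insert by (intro represents_add) auto
  moreover have "(\<Oplus>\<^bsub>A\<^esub>i\<in>insert i F. z i) = z i \<oplus>\<^bsub>A\<^esub> (\<Oplus>\<^bsub>A\<^esub>i\<in>F. z i)"
    using insert represents_closed by (intro A.finsum_insert) auto
  moreover have "f i u \<oplus>\<^bsub>k\<^esub> (\<Oplus>\<^bsub>k\<^esub>i\<in>F. f i u) = (\<Oplus>\<^bsub>k\<^esub>i\<in>insert i F. f i u)"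
    if u: "u \<in> {..<r} \<rightarrow> carrier k" for u
  proof -
    have "f j u \<in> carrier k" if "j \<in> insert i F" for j
      using represents_fun_closed[OF insert.prems[OF that] u] .
    thus ?thesis using insert.hyps by (intro k.finsum_insert[symmetric]) auto
  qed
  ultimately show ?case by (auto intro: represents_cong)
qed

text \<open>The total degree of the resulting \<open>D\<close> may be smaller than the tracked
  degree \<open>d\<close>; the exponent \<open>j\<close> is the difference of the two.\<close>

lemma represents_nonvanishing:
  assumes rep: "represents d f z" and nz: "\<And>u. u \<in> {..<r} \<rightarrow> carrier k \<Longrightarrow> f u \<noteq> \<zero>\<^bsub>k\<^esub>"
  shows "\<exists>D j. (r, D) \<in> algebraic_signature k \<and>
    z = y [^]\<^bsub>A\<^esub> (j::nat) \<otimes>\<^bsub>A\<^esub> poly_value k A \<sigma> (homogenisation k D) (case_option y b)"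
proof -
  obtain L where L: "bounded d L" "\<And>u. u\<in>{..<r} \<rightarrow> carrier k \<Longrightarrow> terms_value k id (mono_value k u) L = f u"
      "terms_value A \<sigma> (weight d) L = z"
    using rep unfolding represents_def by blast
  define D where "D = poly_of_terms k L"
  have Lc: "\<forall>(c, m)\<in>set L. c \<in> carrier k" using L(1) unfolding bounded_def by auto
  have DI: "D \<in> ring.indexed_pset k {..<r} (carrier k)"
    unfolding D_def using L(1) unfolding bounded_def by (intro k.poly_of_terms_indexed_pset) auto
  have Dv: "poly_value k k (\<lambda>c. c) D u = f u" if u: "u \<in> {..<r} \<rightarrow> carrier k" for u
    using id.finsum_poly_of_terms[OF bounded_terms(2)[OF L(1) u]] L(2)[OF u]
    unfolding poly_value_def D_def mono_value_def[symmetric] by simp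
  have sig: "(r, D) \<in> algebraic_signature k"
    unfolding algebraic_signature_def using DI Dv nz by simp
  have Dc: "D m \<in> carrier k" for m unfolding D_def using k.poly_of_terms_closed[OF Lc] .
  have fin: "finite (poly_support k D)"
    and vars: "\<And>m. m \<in> poly_support k D \<Longrightarrow> set_mset m \<subseteq> {..<r}"
    using k.indexed_pset_support[OF DI] by auto
  have szd: "size m \<le> d" if "m \<in> poly_support k D" for m
    using that k.poly_support_poly_of_terms[OF Lc] L(1) unfolding D_def bounded_def by fastforce
  \<comment> \<open>A polynomial without zeros is not the zero polynomial. Hence the maximum that
    defines its total degree is taken over a nonempty set.\<close>
  have ne: "poly_support k D \<noteq> {}"
  proof
    assume "poly_support k D = {}"
    hence "poly_value k k (\<lambda>c. c) D (\<lambda>_. \<zero>\<^bsub>k\<^esub>) = \<zero>\<^bsub>k\<^esub>" unfolding poly_value_def by simp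
    thus False using Dv[of "\<lambda>_. \<zero>\<^bsub>k\<^esub>"] nz[of "\<lambda>_. \<zero>\<^bsub>k\<^esub>"] by simp
  qed
  define e where "e = total_degree k D"
  have sze: "size m \<le> e" if "m \<in> poly_support k D" for m
    unfolding e_def total_degree_def using fin that by simp
  have ed: "e \<le> d"
    unfolding e_def total_degree_def using fin ne szd by (intro Max.boundedI) auto
  have bm: "b \<in> set_mset m \<rightarrow> carrier A" if "m \<in> poly_support k D" for m
    using b vars[OF that] by blast
  have pv: "poly_value k A \<sigma> (homogenisation k D) (case_option y b) =
      (\<Oplus>\<^bsub>A\<^esub>m\<in>poly_support k D. \<sigma> (D m) \<otimes>\<^bsub>A\<^esub> weight e m)"
    unfolding e_def weight_def using A.poly_value_homogenisation[of \<sigma> D y k b] Dc y bm by simp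
  have "y [^]\<^bsub>A\<^esub> (d - e) \<otimes>\<^bsub>A\<^esub> (\<Oplus>\<^bsub>A\<^esub>m\<in>poly_support k D. \<sigma> (D m) \<otimes>\<^bsub>A\<^esub> weight e m) =
      (\<Oplus>\<^bsub>A\<^esub>m\<in>poly_support k D. y [^]\<^bsub>A\<^esub> (d - e) \<otimes>\<^bsub>A\<^esub> (\<sigma> (D m) \<otimes>\<^bsub>A\<^esub> weight e m))"
    using fin y Dc weight_closed vars by (intro A.finsum_rdistr) auto
  also have "\<dots> = (\<Oplus>\<^bsub>A\<^esub>m\<in>poly_support k D. \<sigma> (D m) \<otimes>\<^bsub>A\<^esub> weight d m)"
  proof (rule A.finsum_cong')
    fix m assume m: "m \<in> poly_support k D"
    have mv: "mono_value A b m \<in> carrier A" using bm[OF m] by simp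
    have "y [^]\<^bsub>A\<^esub> (d - size m) = y [^]\<^bsub>A\<^esub> (d - e) \<otimes>\<^bsub>A\<^esub> y [^]\<^bsub>A\<^esub> (e - size m)"
      using A.nat_pow_mult[OF y, of "d - e" "e - size m"] sze[OF m] ed by simp
    thus "y [^]\<^bsub>A\<^esub> (d - e) \<otimes>\<^bsub>A\<^esub> (\<sigma> (D m) \<otimes>\<^bsub>A\<^esub> weight e m) = \<sigma> (D m) \<otimes>\<^bsub>A\<^esub> weight d m"
      unfolding weight_def using y mv Dc[of m] by (simp add: A.m_ac)
  qed (use Dc weight_closed vars in auto)
  also have "\<dots> = z"
    using \<sigma>.finsum_poly_of_terms[OF bounded_terms(1)[OF L(1)]] L(3) unfolding D_def by simp
  finally show ?thesis using sig pv by metis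
qed

end

section \<open>Anisotropic binary forms\<close>

text \<open>The power \<open>k^U\<close>. Its elements are extensional functions, because the ring
  laws are equalities between functions on the whole type.\<close>

definition fun_ring :: "'x set \<Rightarrow> ('k, 'n) ring_scheme \<Rightarrow> ('x \<Rightarrow> 'k) ring" where
  "fun_ring U k = \<lparr>carrier = U \<rightarrow>\<^sub>E carrier k,
     monoid.mult = (\<lambda>f g. \<lambda>x\<in>U. f x \<otimes>\<^bsub>k\<^esub> g x), monoid.one = (\<lambda>x\<in>U. \<one>\<^bsub>k\<^esub>),
     ring.zero = (\<lambda>x\<in>U. \<zero>\<^bsub>k\<^esub>), ring.add = (\<lambda>f g. \<lambda>x\<in>U. f x \<oplus>\<^bsub>k\<^esub> g x)\<rparr>"

lemma fun_ring_simps [simp]: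
  "carrier (fun_ring U k) = U \<rightarrow>\<^sub>E carrier k"
  "f \<otimes>\<^bsub>fun_ring U k\<^esub> g = (\<lambda>x\<in>U. f x \<otimes>\<^bsub>k\<^esub> g x)"
  "\<one>\<^bsub>fun_ring U k\<^esub> = (\<lambda>x\<in>U. \<one>\<^bsub>k\<^esub>)"
  "\<zero>\<^bsub>fun_ring U k\<^esub> = (\<lambda>x\<in>U. \<zero>\<^bsub>k\<^esub>)"
  "f \<oplus>\<^bsub>fun_ring U k\<^esub> g = (\<lambda>x\<in>U. f x \<oplus>\<^bsub>k\<^esub> g x)"
  by (simp_all add: fun_ring_def)

lemma (in cring) cring_fun_ring: "cring (fun_ring U R)"
proof -
  have mem: "f x \<in> carrier R" if "f \<in> U \<rightarrow>\<^sub>E carrier R" "x \<in> U" for f x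
    using that by auto
  show ?thesis
  proof (rule cringI)
    show "abelian_group (fun_ring U R)"
    proof (rule abelian_groupI)
      fix f assume f: "f \<in> carrier (fun_ring U R)"
      show "\<exists>g\<in>carrier (fun_ring U R). g \<oplus>\<^bsub>fun_ring U R\<^esub> f = \<zero>\<^bsub>fun_ring U R\<^esub>"
      proof (intro bexI)
        show "(\<lambda>x\<in>U. \<ominus> f x) \<oplus>\<^bsub>fun_ring U R\<^esub> f = \<zero>\<^bsub>fun_ring U R\<^esub>"
          using f by (auto simp: mem l_neg intro!: restrict_ext)
        show "(\<lambda>x\<in>U. \<ominus> f x) \<in> carrier (fun_ring U R)" using f by auto
      qed
    next
      fix f assume f: "f \<in> carrier (fun_ring U R)"
      show "\<zero>\<^bsub>fun_ring U R\<^esub> \<oplus>\<^bsub>fun_ring U R\<^esub> f = f"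
        using f by (intro extensionalityI[of _ U]) (auto simp: mem PiE_def)
    qed (auto simp: mem a_ac intro!: restrict_ext)
    show "comm_monoid (fun_ring U R)"
    proof (rule comm_monoidI)
      fix f assume f: "f \<in> carrier (fun_ring U R)"
      show "\<one>\<^bsub>fun_ring U R\<^esub> \<otimes>\<^bsub>fun_ring U R\<^esub> f = f"
        using f by (intro extensionalityI[of _ U]) (auto simp: mem PiE_def)
    qed (auto simp: mem m_ac intro!: restrict_ext)
  qed (auto simp: mem l_distr intro!: restrict_ext)
qed

lemma RDirProd_simps [simp]:
  "(f, z) \<otimes>\<^bsub>RDirProd R S\<^esub> (g, w) = (f \<otimes>\<^bsub>R\<^esub> g, z \<otimes>\<^bsub>S\<^esub> w)"
  "(f, z) \<oplus>\<^bsub>RDirProd R S\<^esub> (g, w) = (f \<oplus>\<^bsub>R\<^esub> g, z \<oplus>\<^bsub>S\<^esub> w)"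
  "\<one>\<^bsub>RDirProd R S\<^esub> = (\<one>\<^bsub>R\<^esub>, \<one>\<^bsub>S\<^esub>)"
  "\<zero>\<^bsub>RDirProd R S\<^esub> = (\<zero>\<^bsub>R\<^esub>, \<zero>\<^bsub>S\<^esub>)"
  by (simp_all add: RDirProd_def DirProd_def monoid.defs)

lemma cring_RDirProd:
  assumes "cring R" and "cring S"
  shows "cring (RDirProd R S)"
proof -
  interpret R: cring R by fact
  interpret S: cring S by fact
  interpret P: ring "RDirProd R S" using RDirProd_ring[OF R.ring_axioms S.ring_axioms] .
  show ?thesis
    by unfold_locales (auto simp: RDirProd_carrier R.m_comm S.m_comm)
qed

text \<open>The form \<open>N\<close>, with coefficients transported by \<open>h\<close>: the same
  \<open>c\<close> gives compatible forms over \<open>k\<close>, over \<open>A\<close> and over the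
  ring of polynomial functions.\<close>

definition binary_form ::
    "('s, 'p) ring_scheme \<Rightarrow> ('k \<Rightarrow> 's) \<Rightarrow> (nat \<Rightarrow> 'k) \<Rightarrow> nat \<Rightarrow> 's \<Rightarrow> 's \<Rightarrow> 's" where
  "binary_form S h c d s t =
     (\<Oplus>\<^bsub>S\<^esub>i\<in>{..d}. h (c i) \<otimes>\<^bsub>S\<^esub> (s [^]\<^bsub>S\<^esub> i \<otimes>\<^bsub>S\<^esub> t [^]\<^bsub>S\<^esub> (d - i)))"

lemma (in ring_hom_cring) hom_binary_form:
  assumes "\<And>i. g (c i) \<in> carrier R" and "s \<in> carrier R" and "t \<in> carrier R"
  shows "h (binary_form R g c d s t) = binary_form S (\<lambda>c. h (g c)) c d (h s) (h t)"
proof -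
  have "h (binary_form R g c d s t) =
      (\<Oplus>\<^bsub>S\<^esub>i\<in>{..d}. (h \<circ> (\<lambda>i. g (c i) \<otimes>\<^bsub>R\<^esub> (s [^]\<^bsub>R\<^esub> i \<otimes>\<^bsub>R\<^esub> t [^]\<^bsub>R\<^esub> (d - i)))) i)"
    unfolding binary_form_def using assms by (subst hom_finsum) auto
  also have "\<dots> = binary_form S (\<lambda>c. h (g c)) c d (h s) (h t)"
    unfolding binary_form_def using assms by (intro S.finsum_cong') auto
  finally show ?thesis .
qed

lemma (in ideal) finsum_in_ideal:
  assumes "\<And>i. i \<in> F \<Longrightarrow> f i \<in> I"
  shows "finsum R f F \<in> I"
  using assms
proof (induct F rule: infinite_finite_induct)
  case (insert i F)
  moreover have "finsum R f (insert i F) = f i \<oplus> finsum R f F"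
    using insert Icarr by (intro finsum_insert) auto
  ultimately show ?case by simp
qed simp_all

lemma (in ideal) nat_pow_in_ideal:
  assumes "s \<in> I" and "i > 0"
  shows "s [^] (i::nat) \<in> I"
proof -
  obtain j where "i = Suc j" using assms(2) gr0_implies_Suc by blast
  thus ?thesis using I_l_closed[OF assms(1)] Icarr[OF assms(1)] by simp
qed

text \<open>As \<open>d > 0\<close>, every product \<open>s^i t^(d - i)\<close> contains a factor
  \<open>s\<close> or a factor \<open>t\<close>.\<close>

lemma binary_form_in_ideal:
  assumes "cring R" and I: "ideal I R"
    and c: "\<And>i. h (c i) \<in> carrier R" and s: "s \<in> I" and t: "t \<in> I" and d: "d > 0"
  shows "binary_form R h c d s t \<in> I"
proof -
  interpret R: cring R by fact
  interpret I: ideal I R by fact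
  have st: "s \<in> carrier R" "t \<in> carrier R" using s t I.Icarr by auto
  show ?thesis unfolding binary_form_def
  proof (rule I.finsum_in_ideal)
    fix i assume "i \<in> {..d}"
    have "s [^]\<^bsub>R\<^esub> i \<otimes>\<^bsub>R\<^esub> t [^]\<^bsub>R\<^esub> (d - i) \<in> I"
    proof (cases "i > 0")
      case True
      thus ?thesis using I.I_r_closed[OF I.nat_pow_in_ideal[OF s True]] st by simp
    next
      case False
      thus ?thesis using I.nat_pow_in_ideal[OF t, of d] I.Icarr st d by simp
    qed
    thus "h (c i) \<otimes>\<^bsub>R\<^esub> (s [^]\<^bsub>R\<^esub> i \<otimes>\<^bsub>R\<^esub> t [^]\<^bsub>R\<^esub> (d - i)) \<in> I"
      using I.I_l_closed c by simp
  qed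
qed

text \<open>A zero with nonzero \<open>t\<close> would make \<open>s / t\<close> a root; for
  \<open>t = 0\<close> only the term \<open>c_d s^d\<close> remains.\<close>

lemma (in field) binary_form_anisotropic:
  assumes c: "c \<in> UNIV \<rightarrow> carrier R" and cd: "c d \<noteq> \<zero>"
    and noroot: "\<And>s. s \<in> carrier R \<Longrightarrow> (\<Oplus>i\<in>{..d}. c i \<otimes> s [^] i) \<noteq> \<zero>"
    and s: "s \<in> carrier R" and t: "t \<in> carrier R"
    and zero: "binary_form R id c d s t = \<zero>"
  shows "s = \<zero> \<and> t = \<zero>"
proof -
  have ci: "c i \<in> carrier R" for i using c by auto
  have t0: "t = \<zero>"
  proof (rule ccontr)
    assume tn: "t \<noteq> \<zero>"
    hence u: "inv t \<in> carrier R" "t \<otimes> inv t = \<one>" using t field_Units by simp_all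
    let ?v = "inv t \<otimes> s"
    have v: "?v \<in> carrier R" using u s by simp
    have s': "s = t \<otimes> ?v" using u s t by (simp add: m_assoc[symmetric])
    have "binary_form R id c d s t = (\<Oplus>i\<in>{..d}. t [^] d \<otimes> (c i \<otimes> ?v [^] i))"
      unfolding binary_form_def
    proof (rule finsum_cong')
      fix i assume i: "i \<in> {..d}"
      have "s [^] i = t [^] i \<otimes> ?v [^] i" by (subst s') (rule nat_pow_distrib[OF t v])
      moreover have "t [^] d = t [^] i \<otimes> t [^] (d - i)" using nat_pow_mult[OF t, of i "d - i"] i by simp
      ultimately show "id (c i) \<otimes> (s [^] i \<otimes> t [^] (d - i)) = t [^] d \<otimes> (c i \<otimes> ?v [^] i)"
        using ci t v by (simp add: m_ac)
    qed (use ci t v in auto)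
    also have "\<dots> = t [^] d \<otimes> (\<Oplus>i\<in>{..d}. c i \<otimes> ?v [^] i)"
      using ci t v by (intro finsum_rdistr[symmetric]) auto
    finally have "t [^] d \<otimes> (\<Oplus>i\<in>{..d}. c i \<otimes> ?v [^] i) = \<zero>" using zero by simp
    moreover have "(\<Oplus>i\<in>{..d}. c i \<otimes> ?v [^] i) \<in> carrier R"
      using ci v by (intro finsum_closed) auto
    ultimately show False
      using noroot[OF v] nat_pow_nonzero[OF t tn, of d] t integral_iff by simp
  qed
  have "binary_form R id c d s t = (\<Oplus>i\<in>{..d}. if d = i then c i \<otimes> s [^] i else \<zero>)"
    unfolding binary_form_def t0
  proof (rule finsum_cong')
    fix i assume "i \<in> {..d}"
    thus "id (c i) \<otimes> (s [^] i \<otimes> \<zero> [^] (d - i)) = (if d = i then c i \<otimes> s [^] i else \<zero>)"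
      using ci s by (auto simp: nat_pow_zero)
  qed (use ci s in auto)
  also have "\<dots> = c d \<otimes> s [^] d"
    using finsum_singleton[of d "{..d}" "\<lambda>i. c i \<otimes> s [^] i"] ci s by simp
  finally have "c d \<otimes> s [^] d = \<zero>" using zero by simp
  hence "s [^] d = \<zero>" using cd ci s integral_iff by simp
  hence "s = \<zero>" using nat_pow_nonzero[OF s] by blast
  thus ?thesis using t0 by blast
qed

text \<open>Both arguments are represented in the same degree \<open>e\<close>, so that all summands
  of the form have the common degree \<open>e i + e (d - i) = e d\<close>.\<close>

lemma (in homogeneous_evaluation) represents_binary_form:
  assumes "represents e f z" and "represents e g w" and c: "\<And>i. c i \<in> carrier k"
  shows "represents (e * d) (\<lambda>u. binary_form k id c d (f u) (g u)) (binary_form A \<sigma> c d z w)"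
  unfolding binary_form_def
proof (rule represents_sum)
  fix i assume i: "i \<in> {..d}"
  have "e * i + e * (d - i) = e * d" using i by (simp flip: add_mult_distrib2)
  thus "represents (e * d) (\<lambda>u. id (c i) \<otimes>\<^bsub>k\<^esub> (f u [^]\<^bsub>k\<^esub> i \<otimes>\<^bsub>k\<^esub> g u [^]\<^bsub>k\<^esub> (d - i)))
      (\<sigma> (c i) \<otimes>\<^bsub>A\<^esub> (z [^]\<^bsub>A\<^esub> i \<otimes>\<^bsub>A\<^esub> w [^]\<^bsub>A\<^esub> (d - i)))"
    using represents_mult[OF represents_const[OF c[of i]]
      represents_mult[OF represents_pow[OF assms(1), of i] represents_pow[OF assms(2), of "d - i"]]]
    by simp
qed simp

lemma homogeneous_evaluation_structure_map:
  assumes "field k" and A: "algebra k A" and "b \<in> {..<r} \<rightarrow> carrier A" and "a \<in> carrier A"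
  shows "homogeneous_evaluation k A (structure_map A) r b a"
proof -
  interpret k: field k by fact
  interpret A: cring A using A by (simp add: algebra_def)
  show ?thesis using assms structure_map_ring_hom[OF A] by unfold_locales
qed

text \<open>This is \<open>represents_nonvanishing\<close> for \<open>y = a\<close>, that is with
  \<open>n = 1\<close> in the generators; the additional power of \<open>a\<close> is merged into
  \<open>a^m\<close>.\<close>

lemma nonvanishing_in_Sigma_set:
  assumes "field k" and A: "algebra k A" and b: "b \<in> {..<r} \<rightarrow> carrier A" and a: "a \<in> carrier A"
    and rep: "homogeneous_evaluation.represents k A (structure_map A) r b a d f z"
    and nz: "\<And>u. u \<in> {..<r} \<rightarrow> carrier k \<Longrightarrow> f u \<noteq> \<zero>\<^bsub>k\<^esub>"
  shows "a [^]\<^bsub>A\<^esub> (j::nat) \<otimes>\<^bsub>A\<^esub> z \<in> Sigma_set k A a"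
proof -
  interpret E: homogeneous_evaluation k A "structure_map A" r b a
    using homogeneous_evaluation_structure_map[OF assms(1-4)] .
  obtain D i where D: "(r, D) \<in> algebraic_signature k"
    "z = a [^]\<^bsub>A\<^esub> (i::nat) \<otimes>\<^bsub>A\<^esub> poly_value k A (structure_map A) (homogenisation k D) (case_option a b)"
    using E.represents_nonvanishing[OF rep nz] by blast
  let ?v = "poly_value k A (structure_map A) (homogenisation k D) (case_option a b)"
  have DI: "D \<in> ring.indexed_pset k {..<r} (carrier k)"
    using D(1) unfolding algebraic_signature_def by auto
  have Dc: "D m \<in> carrier k" for m
    using E.k.indexed_pset_in_carrier[OF subset_refl DI] E.k.carrier_coeffE by blast
  have bm: "b \<in> set_mset m \<rightarrow> carrier A" if "m \<in> poly_support k D" for m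
    using b E.k.indexed_pset_support(2)[OF DI that] by blast
  have v: "?v \<in> carrier A"
    using E.A.poly_value_homogenisation[of "structure_map A" D a k b] Dc bm a
    by (simp add: E.A.finsum_closed Pi_def)
  have "a [^]\<^bsub>A\<^esub> j \<otimes>\<^bsub>A\<^esub> z = a [^]\<^bsub>A\<^esub> (j + i) \<otimes>\<^bsub>A\<^esub>
      poly_value k A (structure_map A) (homogenisation k D) (case_option (a [^]\<^bsub>A\<^esub> (1::nat)) b)"
    using D(2) v a by (simp add: E.A.m_assoc[symmetric] E.A.nat_pow_mult)
  thus ?thesis unfolding Sigma_set_def using D(1) b by (intro hull_inc) blast
qed

section \<open>Points of a finitely generated algebra\<close>

lemma (in ring_hom_ring) hom_generate_ring:
  assumes "H \<subseteq> carrier R" and "x \<in> generate_ring R H"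
  shows "h x \<in> generate_ring S (h ` H)"
  using assms(2)
proof induct
  case (incl x)
  thus ?case by (intro generate_ring.incl) blast
next
  case (a_inv x)
  thus ?case using R.generate_ring_in_carrier[OF assms(1)] by (simp add: generate_ring.a_inv)
next
  case (eng_add x y)
  thus ?case using R.generate_ring_in_carrier[OF assms(1)] by (simp add: generate_ring.eng_add)
next
  case (eng_mult x y)
  thus ?case using R.generate_ring_in_carrier[OF assms(1)] by (simp add: generate_ring.eng_mult)
qed (simp add: generate_ring.one)

text \<open>Modulo a prime ideal that contains \<open>I\<close> but not \<open>a\<close>, the
  algebra is a finitely generated domain in which \<open>a\<close> is nonzero. A point of this
  quotient keeping \<open>a\<close> nonzero is composed with the projection.\<close>

lemma rational_point_avoiding_powers:
  assumes k: "field k" and roots: "polys_have_roots k" and fg: "finitely_generated_algebra k A"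
    and I: "ideal I A" and a: "a \<in> carrier A" and pow: "\<And>n::nat. a [^]\<^bsub>A\<^esub> n \<notin> I"
  shows "\<exists>\<psi>\<in>ring_hom A k. (\<forall>c\<in>carrier k. \<psi> (structure_map A c) = c) \<and>
    (\<forall>z\<in>I. \<psi> z = \<zero>\<^bsub>k\<^esub>) \<and> \<psi> a \<noteq> \<zero>\<^bsub>k\<^esub>"
proof -
  interpret k: field k by fact
  have A: "algebra k A" using fg unfolding finitely_generated_algebra_def by blast
  obtain S where S: "finite S" "S \<subseteq> carrier A"
    and gen: "generate_ring A (structure_map A ` carrier k \<union> S) = carrier A"
    using fg unfolding finitely_generated_algebra_def by blast
  interpret A: cring A using A by (simp add: algebra_def)
  obtain M where M: "primeideal M A" "I \<subseteq> M" "a \<notin> M"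
    using A.exists_primeideal_avoiding_powers[OF I a pow] by blast
  interpret M: primeideal M A by fact
  let ?R = "A Quot M"
  let ?h = "(+>\<^bsub>A\<^esub>) M"
  interpret h: ring_hom_ring A ?R ?h using M.rcos_ring_hom_ring .
  have surj: "?h ` carrier A = carrier ?R"
    unfolding FactRing_def A_RCOSETS_def' by auto
  let ?\<sigma> = "?h \<circ> structure_map A"
  have \<sigma>: "?\<sigma> \<in> ring_hom k ?R"
    using ring_hom_trans[OF structure_map_ring_hom[OF A] M.rcos_ring_hom] .
  have H: "structure_map A ` carrier k \<union> S \<subseteq> carrier A"
    using S ring_hom_closed[OF structure_map_ring_hom[OF A]] by blast
  have hS: "finite (?h ` S)" "?h ` S \<subseteq> carrier ?R" using S by auto
  have "?\<sigma> ` carrier k \<union> ?h ` S \<subseteq> carrier ?R"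
    using ring_hom_closed[OF \<sigma>] hS(2) by blast
  hence "generate_ring ?R (?\<sigma> ` carrier k \<union> ?h ` S) \<subseteq> carrier ?R"
    by (rule h.S.generate_ring_incl)
  moreover have eq: "?h ` (structure_map A ` carrier k \<union> S) = ?\<sigma> ` carrier k \<union> ?h ` S"
    by (simp only: image_Un image_comp)
  have "?h ` carrier A \<subseteq> generate_ring ?R (?\<sigma> ` carrier k \<union> ?h ` S)"
    using h.hom_generate_ring[OF H] unfolding gen eq by (rule image_subsetI)
  ultimately have gen': "generate_ring ?R (?\<sigma> ` carrier k \<union> ?h ` S) = carrier ?R"
    unfolding surj by (rule equalityI)
  have zero: "\<zero>\<^bsub>?R\<^esub> = M" unfolding FactRing_def by simp
  have nz: "?h a \<noteq> \<zero>\<^bsub>?R\<^esub>" unfolding zero using M.rcos_const_imp_mem[OF a] M(3) by blast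
  obtain \<psi> where \<psi>: "\<psi> \<in> ring_hom ?R k" "\<forall>c\<in>carrier k. \<psi> (?\<sigma> c) = c" "\<psi> (?h a) \<noteq> \<zero>\<^bsub>k\<^esub>"
    using exists_rational_point_nonzero[OF k roots M.quotient_is_domain \<sigma> hS gen' h.hom_closed[OF a] nz]
    by blast
  have "\<psi> (?h z) = \<zero>\<^bsub>k\<^esub>" if "z \<in> I" for z
  proof -
    have "?h z = \<zero>\<^bsub>?R\<^esub>" unfolding zero using A.a_rcos_zero[OF M.is_ideal] that M(2) by blast
    thus ?thesis using ring_hom_zero[OF \<psi>(1) h.S.ring_axioms k.ring_axioms] by simp
  qed
  moreover have "\<psi> \<circ> ?h \<in> ring_hom A k" using ring_hom_trans[OF M.rcos_ring_hom \<psi>(1)] .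
  ultimately show ?thesis using \<psi>(2,3) by (intro bexI[of _ "\<psi> \<circ> ?h"]) simp_all
qed

section \<open>Polynomial functions paired with their values in the algebra\<close>

locale point_value_algebra =
  k: field k + A: cring A for k :: "('k, 'n) ring_scheme" and A :: "('a, 'm) ring_scheme" +
  fixes \<sigma> :: "'k \<Rightarrow> 'a" and n :: nat and x :: "nat \<Rightarrow> 'a"
  assumes \<sigma>: "\<sigma> \<in> ring_hom k A" and x: "x \<in> {..<n} \<rightarrow> carrier A"
    and gen: "generate_ring A (\<sigma> ` carrier k \<union> x ` {..<n}) = carrier A"
begin

definition points :: "(nat \<Rightarrow> 'k) set" where "points = {..<n} \<rightarrow>\<^sub>E carrier k"

text \<open>\<open>V\<close> consists of pairs of a polynomial function on \<open>k\<^sup>n\<close> and the value at \<open>x\<close> of a polynomial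
  inducing it. It is noetherian without any reference to a polynomial ring in \<open>n\<close> variables.\<close>

definition W :: "(((nat \<Rightarrow> 'k) \<Rightarrow> 'k) \<times> 'a) ring" where
  "W = RDirProd (fun_ring points k) A"

definition const :: "'k \<Rightarrow> ((nat \<Rightarrow> 'k) \<Rightarrow> 'k) \<times> 'a" where
  "const c = ((\<lambda>u\<in>points. c), \<sigma> c)"

definition coord :: "nat \<Rightarrow> ((nat \<Rightarrow> 'k) \<Rightarrow> 'k) \<times> 'a" where
  "coord i = ((\<lambda>u\<in>points. u i), x i)"

definition V :: "(((nat \<Rightarrow> 'k) \<Rightarrow> 'k) \<times> 'a) ring" where
  "V = W\<lparr>carrier := generate_ring W (const ` carrier k \<union> coord ` {..<n})\<rparr>"

sublocale \<sigma>: ring_hom_cring k A \<sigma>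
  using \<sigma> by unfold_locales

sublocale W: cring W
  unfolding W_def by (intro cring_RDirProd k.cring_fun_ring A.is_cring)

lemma const_ring_hom: "const \<in> ring_hom k W"
  by (rule ring_hom_memI) (auto simp: const_def W_def RDirProd_carrier)

lemma coord_closed: "i < n \<Longrightarrow> coord i \<in> carrier W"
  using x by (auto simp: coord_def W_def RDirProd_carrier points_def)

lemma generators_closed: "const ` carrier k \<union> coord ` {..<n} \<subseteq> carrier W"
  using ring_hom_closed[OF const_ring_hom] coord_closed by auto

lemma carrier_V: "carrier V = generate_ring W (const ` carrier k \<union> coord ` {..<n})"
  unfolding V_def by simp

lemma V_ops [simp]:
  "p \<otimes>\<^bsub>V\<^esub> q = p \<otimes>\<^bsub>W\<^esub> q" "p \<oplus>\<^bsub>V\<^esub> q = p \<oplus>\<^bsub>W\<^esub> q" "\<one>\<^bsub>V\<^esub> = \<one>\<^bsub>W\<^esub>" "\<zero>\<^bsub>V\<^esub> = \<zero>\<^bsub>W\<^esub>"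
  unfolding V_def by simp_all

lemma subring_V: "subring (carrier V) W"
  unfolding carrier_V using W.generate_ring_is_subring[OF generators_closed] .

lemma V_subset: "p \<in> carrier V \<Longrightarrow> p \<in> carrier W"
  using subringE(1)[OF subring_V] by blast

sublocale V: cring V
  using W.subcring_iff[OF subringE(1)[OF subring_V]] W.subcringI'[OF subring_V]
  unfolding V_def[symmetric] carrier_V by (simp add: V_def)

text \<open>\<open>V\<close> is generated by the \<open>n\<close> coordinates over the image of the
  field \<open>k\<close>, and a field is noetherian. Both components of the pairs matter: over a
  finite field a polynomial function does not determine the value at \<open>x\<close>, nor need that
  value determine the function.\<close>

lemma noetherian_V: "noetherian_ring V"
proof -
  let ?K = "W\<lparr>carrier := const ` carrier k\<rparr>"
  interpret c: ring_hom_ring k W const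
    by (intro ring_hom_ringI2 k.ring_axioms W.ring_axioms const_ring_hom)
  have K: "subring (const ` carrier k) W" using c.img_is_subring[OF k.carrier_is_subring] .
  have "ring_hom_ring k ?K const"
    using const_ring_hom W.subring_is_ring[OF K]
    by (intro ring_hom_ringI2 k.ring_axioms) (auto simp: ring_hom_def)
  hence "noetherian_ring ?K"
    by (rule noetherian_ring_surj_hom[OF k.noetherian_ring_axioms]) simp
  thus ?thesis
    unfolding V_def using W.noetherian_generate_ring[OF K, of "coord ` {..<n}"] coord_closed by auto
qed

lemma snd_ring_hom_W: "snd \<in> ring_hom W A"
  by (rule ring_hom_memI) (auto simp: W_def RDirProd_carrier)

lemma value_ring_hom_W: "u \<in> points \<Longrightarrow> (\<lambda>p. fst p u) \<in> ring_hom W k"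
  by (rule ring_hom_memI) (auto simp: W_def RDirProd_carrier)

lemma ring_hom_V: "h \<in> ring_hom W S \<Longrightarrow> h \<in> ring_hom V S"
  using V_subset by (auto simp: ring_hom_def)

lemmas snd_ring_hom = ring_hom_V[OF snd_ring_hom_W]
lemmas value_ring_hom = ring_hom_V[OF value_ring_hom_W]

lemma const_ring_hom_V: "const \<in> ring_hom k V"
  using const_ring_hom by (auto simp: ring_hom_def carrier_V intro: generate_ring.incl)

text \<open>The image is a subring containing the generators of \<open>A\<close>. Every element of
  \<open>A\<close> thus lifts to a polynomial function, as is needed for \<open>a\<close> and for
  elements of \<open>I\<close>.\<close>

lemma snd_surj: "snd ` carrier V = carrier A"
proof -
  interpret s: ring_hom_ring W A snd
    by (intro ring_hom_ringI2 W.ring_axioms A.ring_axioms snd_ring_hom_W)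
  have sub: "subring (snd ` carrier V) A" using s.img_is_subring[OF subring_V] .
  have H: "\<sigma> ` carrier k \<union> x ` {..<n} \<subseteq> carrier A" using x by auto
  have "const ` carrier k \<union> coord ` {..<n} \<subseteq> carrier V"
    unfolding carrier_V by (auto intro: generate_ring.incl)
  hence "snd ` (const ` carrier k \<union> coord ` {..<n}) \<subseteq> snd ` carrier V" by (rule image_mono)
  hence "\<sigma> ` carrier k \<union> x ` {..<n} \<subseteq> snd ` carrier V"
    by (auto simp: image_Un image_image const_def coord_def)
  hence "carrier A \<subseteq> snd ` carrier V"
    using A.generate_ring_min_subring1[OF H sub] gen by simp
  thus ?thesis using subringE(1)[OF sub] by blast
qed

text \<open>The finitely many generators of \<open>J\<close> are absorbed one by one: the form
  applied to \<open>p\<close> and \<open>q\<close> stays in \<open>J\<close>, and by anisotropy its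
  zeros are the common zeros of \<open>p\<close> and \<open>q\<close>.\<close>

lemma common_zero_of_ideal:
  fixes c :: "nat \<Rightarrow> 'k"
  assumes J: "ideal J V" and c: "c \<in> UNIV \<rightarrow> carrier k" and d: "d > 0" and cd: "c d \<noteq> \<zero>\<^bsub>k\<^esub>"
    and noroot: "\<And>s. s \<in> carrier k \<Longrightarrow> (\<Oplus>\<^bsub>k\<^esub>i\<in>{..d}. c i \<otimes>\<^bsub>k\<^esub> s [^]\<^bsub>k\<^esub> i) \<noteq> \<zero>\<^bsub>k\<^esub>"
  shows "\<exists>q\<in>J. \<forall>u\<in>points. fst q u = \<zero>\<^bsub>k\<^esub> \<longrightarrow> (\<forall>p\<in>J. fst p u = \<zero>\<^bsub>k\<^esub>)"
proof -
  interpret N: noetherian_ring V by (rule noetherian_V)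
  interpret J: ideal J V by fact
  have cc: "const (c i) \<in> carrier V" for i using ring_hom_closed[OF const_ring_hom_V] c by auto
  obtain G where G: "finite G" "G \<subseteq> carrier V" "J = genideal V G"
    using N.finetely_gen[OF J] by blast
  have GJ: "G \<subseteq> J" using G V.genideal_self by simp
  have "\<exists>q\<in>J. \<forall>u\<in>points. fst q u = \<zero>\<^bsub>k\<^esub> \<longrightarrow> (\<forall>p\<in>G. fst p u = \<zero>\<^bsub>k\<^esub>)"
    using G(1) GJ
  proof (induct G)
    case empty
    thus ?case using J.zero_closed by blast
  next
    case (insert p G)
    then obtain q where q: "q \<in> J" "\<And>u. u\<in>points \<Longrightarrow> fst q u = \<zero>\<^bsub>k\<^esub> \<Longrightarrow> \<forall>p\<in>G. fst p u = \<zero>\<^bsub>k\<^esub>"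
      by auto
    have p: "p \<in> J" using insert.prems by simp
    have pq: "p \<in> carrier V" "q \<in> carrier V" using p q(1) J.Icarr by auto
    let ?q = "binary_form V const c d p q"
    have "?q \<in> J" using binary_form_in_ideal[OF V.is_cring J _ p q(1) d] cc by blast
    moreover have "\<forall>p'\<in>insert p G. fst p' u = \<zero>\<^bsub>k\<^esub>"
      if u: "u \<in> points" and z: "fst ?q u = \<zero>\<^bsub>k\<^esub>" for u
    proof -
      interpret e: ring_hom_cring V k "\<lambda>p. fst p u"
        using value_ring_hom[OF u] by unfold_locales
      have "fst ?q u = binary_form k (\<lambda>c. fst (const c) u) c d (fst p u) (fst q u)"
        using e.hom_binary_form[of const c p q d] cc pq by blast
      also have "\<dots> = binary_form k id c d (fst p u) (fst q u)"
        using u unfolding binary_form_def const_def by simp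
      finally have "binary_form k id c d (fst p u) (fst q u) = \<zero>\<^bsub>k\<^esub>" using z by metis
      hence "fst p u = \<zero>\<^bsub>k\<^esub> \<and> fst q u = \<zero>\<^bsub>k\<^esub>"
        using k.binary_form_anisotropic[OF c cd noroot, of "fst p u" "fst q u"]
          e.hom_closed[OF pq(1)] e.hom_closed[OF pq(2)] by blast
      thus ?thesis using q(2)[OF u] by blast
    qed
    ultimately show ?case by blast
  qed
  then obtain q where q: "q \<in> J" "\<And>u. u\<in>points \<Longrightarrow> fst q u = \<zero>\<^bsub>k\<^esub> \<Longrightarrow> \<forall>p\<in>G. fst p u = \<zero>\<^bsub>k\<^esub>"
    by blast
  have "\<forall>p\<in>J. fst p u = \<zero>\<^bsub>k\<^esub>" if u: "u \<in> points" "fst q u = \<zero>\<^bsub>k\<^esub>" for u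
  proof -
    interpret e: ring_hom_ring V k "\<lambda>p. fst p u"
      by (intro ring_hom_ringI2 V.ring_axioms k.ring_axioms value_ring_hom u)
    \<comment> \<open>Vanishing passes from the generators to \<open>J\<close>, because the elements
      of \<open>V\<close> that vanish at \<open>u\<close> form an ideal.\<close>
    have "J \<subseteq> {p \<in> carrier V. fst p u \<in> {\<zero>\<^bsub>k\<^esub>}}"
      unfolding G(3) using q(2)[OF u] G(2) by (intro V.genideal_minimal[OF e.ideal_vimage[OF k.zeroideal]]) auto
    thus ?thesis by blast
  qed
  thus ?thesis using q(1) by blast
qed

text \<open>A pair with second component zero vanishes at \<open>u\<close>, so the value at
  \<open>u\<close> depends only on the second component and defines a map on
  \<open>A\<close>.\<close>

lemma point_hom:
  assumes u: "u \<in> points" and I: "ideal I A"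
    and van: "\<And>p. p \<in> carrier V \<Longrightarrow> snd p \<in> I \<Longrightarrow> fst p u = \<zero>\<^bsub>k\<^esub>"
  shows "\<exists>\<psi>\<in>ring_hom A k. (\<forall>p\<in>carrier V. \<psi> (snd p) = fst p u)"
proof -
  interpret I: ideal I A by fact
  have "fst p u = \<zero>\<^bsub>k\<^esub>" if "p \<in> carrier V" "snd p = \<zero>\<^bsub>A\<^esub>" for p
    using van[OF that(1)] that(2) I.zero_closed by simp
  then obtain \<psi> where \<psi>: "\<psi> \<in> ring_hom (A\<lparr>carrier := snd ` carrier V\<rparr>) k"
    "\<And>p. p \<in> carrier V \<Longrightarrow> \<psi> (snd p) = fst p u"
    using ring_hom_factor[OF V.ring_axioms A.ring_axioms k.ring_axioms snd_ring_hom value_ring_hom[OF u]]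
    by blast
  have "\<psi> \<in> ring_hom A k" using \<psi>(1) unfolding snd_surj ring_hom_def by simp
  thus ?thesis using \<psi>(2) by blast
qed

text \<open>Homogenising in degree \<open>d\<close> and inserting \<open>X = a x\<close>,
  \<open>Y = a\<close> yields \<open>a^d p(x)\<close>. The last entry \<open>b n = 1\<close> is the
  place of the Rabinowitsch variable, whose value is then \<open>1 / a\<close>. The degree comes
  from induction on the generation of \<open>V\<close>; sums are formed after lifting both summands
  to a common degree.\<close>

lemma represents_V:
  assumes a: "a \<in> carrier A" and p: "p \<in> carrier V"
  defines "b \<equiv> \<lambda>i. if i < n then a \<otimes>\<^bsub>A\<^esub> x i else \<one>\<^bsub>A\<^esub>"
  shows "\<exists>d. homogeneous_evaluation.represents k A \<sigma> (Suc n) b a d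
    (\<lambda>u. fst p (restrict u {..<n})) (a [^]\<^bsub>A\<^esub> d \<otimes>\<^bsub>A\<^esub> snd p)"
proof -
  have b: "b \<in> {..<Suc n} \<rightarrow> carrier A" using a x by (auto simp: b_def intro!: A.m_closed)
  interpret E: homogeneous_evaluation k A \<sigma> "Suc n" b a
    using \<sigma> b a by unfold_locales
  have pt: "restrict u {..<n} \<in> points" if "u \<in> {..<Suc n} \<rightarrow> carrier k" for u :: "nat \<Rightarrow> 'k"
    using that unfolding points_def by auto
  let ?rep = "\<lambda>d p. E.represents d (\<lambda>u. fst p (restrict u {..<n})) (a [^]\<^bsub>A\<^esub> d \<otimes>\<^bsub>A\<^esub> snd p)"
  have const: "?rep 0 (const c)" if c: "c \<in> carrier k" for c
    using E.represents_const[OF c] c pt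
    by (auto simp: const_def intro: E.represents_cong)
  have lift: "?rep (d + e) p" if "?rep d p" "snd p \<in> carrier A" for d e p
  proof -
    have "a [^]\<^bsub>A\<^esub> e \<otimes>\<^bsub>A\<^esub> (a [^]\<^bsub>A\<^esub> d \<otimes>\<^bsub>A\<^esub> snd p) = a [^]\<^bsub>A\<^esub> (d + e) \<otimes>\<^bsub>A\<^esub> snd p"
      using a that(2) A.nat_pow_mult[OF a, of e d] by (simp add: A.m_assoc[symmetric] add.commute)
    thus ?thesis using E.represents_lift[OF that(1), of e] by simp
  qed
  have WA: "snd p \<in> carrier A" if "p \<in> carrier W" for p using ring_hom_closed[OF snd_ring_hom_W that] .
  have mult: "\<exists>d. ?rep d (p \<otimes>\<^bsub>W\<^esub> q)" if pq: "p \<in> carrier W" "q \<in> carrier W" "\<exists>d. ?rep d p" "\<exists>d. ?rep d q" for p q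
  proof -
    obtain d e where de: "?rep d p" "?rep e q" using pq by blast
    have "(a [^]\<^bsub>A\<^esub> d \<otimes>\<^bsub>A\<^esub> snd p) \<otimes>\<^bsub>A\<^esub> (a [^]\<^bsub>A\<^esub> e \<otimes>\<^bsub>A\<^esub> snd q) = a [^]\<^bsub>A\<^esub> (d + e) \<otimes>\<^bsub>A\<^esub> snd (p \<otimes>\<^bsub>W\<^esub> q)"
      using a WA pq(1,2) ring_hom_mult[OF snd_ring_hom_W pq(1,2)] A.nat_pow_mult[OF a, of d e, symmetric]
      by (simp add: A.m_ac)
    moreover have "fst p (restrict u {..<n}) \<otimes>\<^bsub>k\<^esub> fst q (restrict u {..<n}) = fst (p \<otimes>\<^bsub>W\<^esub> q) (restrict u {..<n})"
      if "u \<in> {..<Suc n} \<rightarrow> carrier k" for u :: "nat \<Rightarrow> 'k"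
      using ring_hom_mult[OF value_ring_hom_W[OF pt[OF that]] pq(1,2)] by simp
    ultimately have "?rep (d + e) (p \<otimes>\<^bsub>W\<^esub> q)"
      using E.represents_cong[OF E.represents_mult[OF de]] by simp
    thus ?thesis by blast
  qed
  have add: "\<exists>d. ?rep d (p \<oplus>\<^bsub>W\<^esub> q)" if pq: "p \<in> carrier W" "q \<in> carrier W" "\<exists>d. ?rep d p" "\<exists>d. ?rep d q" for p q
  proof -
    obtain d e where "?rep d p" "?rep e q" using pq by blast
    hence de: "?rep (d + e) p" "?rep (d + e) q"
      using lift[of d p e] lift[of e q d] WA pq(1,2) by (simp_all add: add.commute)
    have "a [^]\<^bsub>A\<^esub> (d + e) \<otimes>\<^bsub>A\<^esub> snd p \<oplus>\<^bsub>A\<^esub> a [^]\<^bsub>A\<^esub> (d + e) \<otimes>\<^bsub>A\<^esub> snd q = a [^]\<^bsub>A\<^esub> (d + e) \<otimes>\<^bsub>A\<^esub> snd (p \<oplus>\<^bsub>W\<^esub> q)"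
      using a WA pq(1,2) ring_hom_add[OF snd_ring_hom_W pq(1,2)] by (simp add: A.r_distr)
    moreover have "fst p (restrict u {..<n}) \<oplus>\<^bsub>k\<^esub> fst q (restrict u {..<n}) = fst (p \<oplus>\<^bsub>W\<^esub> q) (restrict u {..<n})"
      if "u \<in> {..<Suc n} \<rightarrow> carrier k" for u :: "nat \<Rightarrow> 'k"
      using ring_hom_add[OF value_ring_hom_W[OF pt[OF that]] pq(1,2)] by simp
    ultimately have "?rep (d + e) (p \<oplus>\<^bsub>W\<^esub> q)"
      using E.represents_cong[OF E.represents_add[OF de]] by simp
    thus ?thesis by blast
  qed
  interpret c: ring_hom_cring k W const using const_ring_hom by unfold_locales
  have "\<exists>d. ?rep d p" if "p \<in> generate_ring W (const ` carrier k \<union> coord ` {..<n})" for p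
    using that
  proof induct
    case one
    have "?rep 0 \<one>\<^bsub>W\<^esub>" using const[OF k.one_closed] unfolding c.hom_one .
    thus ?case by blast
  next
    case (incl h)
    show ?case
    proof (cases "h \<in> const ` carrier k")
      case True
      thus ?thesis using const by blast
    next
      case False
      then obtain i where i: "i < n" "h = coord i" using incl by auto
      have "x i \<in> carrier A" using x i by auto
      hence "b i = a [^]\<^bsub>A\<^esub> (1::nat) \<otimes>\<^bsub>A\<^esub> snd h" using i a by (simp add: b_def coord_def)
      moreover have "u i = fst h (restrict u {..<n})" if "u \<in> {..<Suc n} \<rightarrow> carrier k" for u
        using pt[OF that] i by (simp add: coord_def)
      ultimately have "?rep 1 h"
        using E.represents_cong[OF E.represents_var[of i]] i by simp
      thus ?thesis by blast
    qed
  next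
    case (a_inv h)
    have h: "h \<in> carrier W" using W.generate_ring_in_carrier[OF generators_closed a_inv(1)] .
    \<comment> \<open>Negation is multiplication by the constant -1, which is represented in degree
      0.\<close>
    have "\<ominus>\<^bsub>W\<^esub> h = const (\<ominus>\<^bsub>k\<^esub> \<one>\<^bsub>k\<^esub>) \<otimes>\<^bsub>W\<^esub> h" using h by (simp add: W.l_minus)
    moreover have "\<exists>d. ?rep d (const (\<ominus>\<^bsub>k\<^esub> \<one>\<^bsub>k\<^esub>))" using const[of "\<ominus>\<^bsub>k\<^esub> \<one>\<^bsub>k\<^esub>"] by blast
    moreover have "const (\<ominus>\<^bsub>k\<^esub> \<one>\<^bsub>k\<^esub>) \<in> carrier W" by (intro c.hom_closed) simp
    ultimately show ?case using mult[OF _ h _ a_inv(2)] by metis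
  next
    case (eng_add h1 h2)
    thus ?case using add W.generate_ring_in_carrier[OF generators_closed] by blast
  next
    case (eng_mult h1 h2)
    thus ?case using mult W.generate_ring_in_carrier[OF generators_closed] by blast
  qed
  thus ?thesis using p unfolding carrier_V by blast
qed

end

text \<open>The nontrivial inclusion in contrapositive form: if \<open>a\<close> is outside the
  right-hand side, some point kills \<open>I\<close> but not \<open>a\<close>.\<close>

lemma rational_point_avoiding_Sigma_set:
  assumes k: "field k" and fg: "finitely_generated_algebra k A" and I: "ideal I A"
    and a: "a \<in> carrier A" and disj: "I \<inter> Sigma_set k A a = {}"
  shows "\<exists>\<psi>\<in>ring_hom A k. (\<forall>c\<in>carrier k. \<psi> (structure_map A c) = c) \<and>
    (\<forall>z\<in>I. \<psi> z = \<zero>\<^bsub>k\<^esub>) \<and> \<psi> a \<noteq> \<zero>\<^bsub>k\<^esub>"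
proof (cases "polys_have_roots k")
  case True
  interpret k: field k by fact
  have A: "algebra k A" using fg unfolding finitely_generated_algebra_def by blast
  \<comment> \<open>The constant polynomial 1 in no variables shows that all powers of
    \<open>a\<close> belong to \<open>Sigma_set\<close>.\<close>
  interpret E: homogeneous_evaluation k A "structure_map A" 0 undefined a
    using homogeneous_evaluation_structure_map[OF k A _ a, of undefined 0] by simp
  have "a [^]\<^bsub>A\<^esub> (j::nat) \<otimes>\<^bsub>A\<^esub> structure_map A \<one>\<^bsub>k\<^esub> \<in> Sigma_set k A a" for j
    using nonvanishing_in_Sigma_set[OF k A _ a E.represents_const[OF k.one_closed]] by simp
  hence "a [^]\<^bsub>A\<^esub> (j::nat) \<in> Sigma_set k A a" for j using a by simp
  hence "a [^]\<^bsub>A\<^esub> (j::nat) \<notin> I" for j using disj by blast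
  thus ?thesis using rational_point_avoiding_powers[OF k True fg I a] by blast
next
  case False
  interpret k: field k by fact
  have A: "algebra k A" using fg unfolding finitely_generated_algebra_def by blast
  interpret A: cring A using A by (simp add: algebra_def)
  interpret I: ideal I A by fact
  obtain d c where d: "d > 0" and c: "c \<in> UNIV \<rightarrow> carrier k" and cd: "c d \<noteq> \<zero>\<^bsub>k\<^esub>"
    and noroot: "\<And>s. s \<in> carrier k \<Longrightarrow> (\<Oplus>\<^bsub>k\<^esub>i\<in>{..d::nat}. c i \<otimes>\<^bsub>k\<^esub> s [^]\<^bsub>k\<^esub> i) \<noteq> \<zero>\<^bsub>k\<^esub>"
    using False unfolding polys_have_roots_def by blast
  obtain S where S: "finite S" "S \<subseteq> carrier A"
    and gen: "generate_ring A (structure_map A ` carrier k \<union> S) = carrier A"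
    using fg unfolding finitely_generated_algebra_def by blast
  obtain n x where nx: "S = x ` {..<n::nat}"
    using finite_imp_nat_seg_image_inj_on[OF S(1)] unfolding lessThan_def by blast
  have x: "x \<in> {..<n} \<rightarrow> carrier A" using S(2) nx by blast
  interpret P: point_value_algebra k A "structure_map A" n x
    using structure_map_ring_hom[OF A] x gen[unfolded nx] by unfold_locales
  \<comment> \<open>The equations of \<open>A / I\<close>, as an ideal of \<open>V\<close>. A point
    at which they all vanish is a point of \<open>A\<close> that kills \<open>I\<close>.\<close>
  let ?J = "{p \<in> carrier P.V. snd p \<in> I}"
  interpret s: ring_hom_ring P.V A snd
    by (intro ring_hom_ringI2 P.V.ring_axioms A.ring_axioms P.snd_ring_hom)
  obtain q where q: "q \<in> carrier P.V" "snd q \<in> I"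
    and qz: "\<And>u p. \<lbrakk>u \<in> P.points; fst q u = \<zero>\<^bsub>k\<^esub>; p \<in> carrier P.V; snd p \<in> I\<rbrakk> \<Longrightarrow> fst p u = \<zero>\<^bsub>k\<^esub>"
    using P.common_zero_of_ideal[OF s.ideal_vimage[OF I] c d cd noroot] by blast
  obtain \<alpha> where \<alpha>: "\<alpha> \<in> carrier P.V" "snd \<alpha> = a"
    using a P.snd_surj by (metis imageE)
  show ?thesis
  \<comment> \<open>Either some zero of \<open>q\<close> is the desired point, or
    \<open>\<alpha>\<close> vanishes wherever \<open>q\<close> does; in the latter case an element
    of \<open>I\<close> is exhibited in \<open>Sigma_set\<close>.\<close>
  proof (cases "\<exists>u\<in>P.points. fst q u = \<zero>\<^bsub>k\<^esub> \<and> fst \<alpha> u \<noteq> \<zero>\<^bsub>k\<^esub>")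
    case True
    then obtain u where u: "u \<in> P.points" "fst q u = \<zero>\<^bsub>k\<^esub>" "fst \<alpha> u \<noteq> \<zero>\<^bsub>k\<^esub>" by blast
    obtain \<psi> where \<psi>: "\<psi> \<in> ring_hom A k" "\<And>p. p \<in> carrier P.V \<Longrightarrow> \<psi> (snd p) = fst p u"
      using P.point_hom[OF u(1) I qz[OF u(1,2)]] by blast
    have "\<psi> (structure_map A c) = c" if "c \<in> carrier k" for c
      using \<psi>(2)[OF ring_hom_closed[OF P.const_ring_hom_V that]] u(1) by (simp add: P.const_def)
    moreover have "\<psi> z = \<zero>\<^bsub>k\<^esub>" if z: "z \<in> I" for z
    proof -
      obtain p where p: "p \<in> carrier P.V" "snd p = z" using I.Icarr[OF z] P.snd_surj by (metis imageE)
      thus ?thesis using \<psi>(2)[OF p(1)] qz[OF u(1,2) p(1)] z by simp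
    qed
    moreover have "\<psi> a \<noteq> \<zero>\<^bsub>k\<^esub>" using \<psi>(2)[OF \<alpha>(1)] \<alpha>(2) u(3) by simp
    ultimately show ?thesis using \<psi>(1) by blast
  next
    case False
    define b where "b = (\<lambda>i. if i < n then a \<otimes>\<^bsub>A\<^esub> x i else \<one>\<^bsub>A\<^esub>)"
    have b: "b \<in> {..<Suc n} \<rightarrow> carrier A" using a x by (auto simp: b_def intro!: A.m_closed)
    interpret E: homogeneous_evaluation k A "structure_map A" "Suc n" b a
      using homogeneous_evaluation_structure_map[OF k A b a] .
    let ?f = "\<lambda>u. fst q (restrict u {..<n})"
    \<comment> \<open>This is \<open>1 - \<alpha> T\<close>, with the variable \<open>T\<close> in
      position \<open>n\<close>.\<close>
    let ?g = "\<lambda>u. \<one>\<^bsub>k\<^esub> \<oplus>\<^bsub>k\<^esub> (\<ominus>\<^bsub>k\<^esub> \<one>\<^bsub>k\<^esub>) \<otimes>\<^bsub>k\<^esub> (fst \<alpha> (restrict u {..<n}) \<otimes>\<^bsub>k\<^esub> u n)"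
    obtain d1 where d1: "E.represents d1 ?f (a [^]\<^bsub>A\<^esub> d1 \<otimes>\<^bsub>A\<^esub> snd q)"
      using P.represents_V[OF a q(1)] unfolding b_def by blast
    obtain d2 where d2: "E.represents d2 (\<lambda>u. fst \<alpha> (restrict u {..<n})) (a [^]\<^bsub>A\<^esub> d2 \<otimes>\<^bsub>A\<^esub> a)"
      using P.represents_V[OF a \<alpha>(1)] unfolding b_def \<alpha>(2) by blast
    \<comment> \<open>The homogenised value is \<open>a^(d2 + 1) - (a^d2 a) 1 = 0\<close>, which is
      \<open>1 - a (1/a) = 0\<close> with denominators cleared.\<close>
    have g: "E.represents (d2 + 1) ?g \<zero>\<^bsub>A\<^esub>"
    proof -
      have "E.represents (d2 + 1) (\<lambda>u. fst \<alpha> (restrict u {..<n}) \<otimes>\<^bsub>k\<^esub> u n) (a [^]\<^bsub>A\<^esub> d2 \<otimes>\<^bsub>A\<^esub> a \<otimes>\<^bsub>A\<^esub> b n)"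
        using E.represents_mult[OF d2 E.represents_var[of n]] by simp
      hence "E.represents (0 + (d2 + 1)) (\<lambda>u. (\<ominus>\<^bsub>k\<^esub> \<one>\<^bsub>k\<^esub>) \<otimes>\<^bsub>k\<^esub> (fst \<alpha> (restrict u {..<n}) \<otimes>\<^bsub>k\<^esub> u n))
          (structure_map A (\<ominus>\<^bsub>k\<^esub> \<one>\<^bsub>k\<^esub>) \<otimes>\<^bsub>A\<^esub> (a [^]\<^bsub>A\<^esub> d2 \<otimes>\<^bsub>A\<^esub> a \<otimes>\<^bsub>A\<^esub> b n))"
        by (intro E.represents_mult[OF E.represents_const]) simp_all
      moreover have "E.represents (0 + (d2 + 1)) (\<lambda>_. \<one>\<^bsub>k\<^esub>) (a [^]\<^bsub>A\<^esub> (d2 + 1) \<otimes>\<^bsub>A\<^esub> structure_map A \<one>\<^bsub>k\<^esub>)"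
        by (intro E.represents_lift[OF E.represents_const]) simp
      ultimately have "E.represents (0 + (d2 + 1)) ?g (a [^]\<^bsub>A\<^esub> (d2 + 1) \<otimes>\<^bsub>A\<^esub> structure_map A \<one>\<^bsub>k\<^esub> \<oplus>\<^bsub>A\<^esub>
          structure_map A (\<ominus>\<^bsub>k\<^esub> \<one>\<^bsub>k\<^esub>) \<otimes>\<^bsub>A\<^esub> (a [^]\<^bsub>A\<^esub> d2 \<otimes>\<^bsub>A\<^esub> a \<otimes>\<^bsub>A\<^esub> b n))"
        by (intro E.represents_add)
      moreover have "a [^]\<^bsub>A\<^esub> (d2 + 1) \<otimes>\<^bsub>A\<^esub> structure_map A \<one>\<^bsub>k\<^esub> \<oplus>\<^bsub>A\<^esub>
          structure_map A (\<ominus>\<^bsub>k\<^esub> \<one>\<^bsub>k\<^esub>) \<otimes>\<^bsub>A\<^esub> (a [^]\<^bsub>A\<^esub> d2 \<otimes>\<^bsub>A\<^esub> a \<otimes>\<^bsub>A\<^esub> b n) = \<zero>\<^bsub>A\<^esub>"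
        using a by (simp add: b_def A.l_minus A.r_neg)
      ultimately show ?thesis by simp
    qed
    \<comment> \<open>The common degree to which \<open>?f\<close> and \<open>?g\<close> are lifted
      so that both can be inserted into the form; \<open>z\<close> is the lifted value of
      \<open>?f\<close>.\<close>
    define e where "e = d1 + (d2 + 1)"
    define z where "z = a [^]\<^bsub>A\<^esub> (d2 + 1) \<otimes>\<^bsub>A\<^esub> (a [^]\<^bsub>A\<^esub> d1 \<otimes>\<^bsub>A\<^esub> snd q)"
    have zI: "z \<in> I" unfolding z_def using a q(2) by (intro I.I_l_closed) simp_all
    have "E.represents e ?f z" unfolding e_def z_def by (rule E.represents_lift[OF d1])
    moreover have "E.represents e ?g \<zero>\<^bsub>A\<^esub>"
      using E.represents_lift[OF g, of d1] a unfolding e_def by (simp add: add.commute)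
    ultimately have rep: "E.represents (e * d) (\<lambda>u. binary_form k id c d (?f u) (?g u))
        (binary_form A (structure_map A) c d z \<zero>\<^bsub>A\<^esub>)"
      using c by (intro E.represents_binary_form) auto
    \<comment> \<open>At a zero both arguments of the form vanish. Then \<open>q\<close> vanishes at
      the point, hence so does \<open>\<alpha>\<close>, and \<open>1 - \<alpha> T\<close> equals 1
      there, a contradiction.\<close>
    have nz: "binary_form k id c d (?f u) (?g u) \<noteq> \<zero>\<^bsub>k\<^esub>" if u: "u \<in> {..<Suc n} \<rightarrow> carrier k" for u
    proof
      assume *: "binary_form k id c d (?f u) (?g u) = \<zero>\<^bsub>k\<^esub>"
      have pt: "restrict u {..<n} \<in> P.points" using u unfolding P.points_def by auto
      have un: "u n \<in> carrier k" using u by auto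
      have fc: "?f u \<in> carrier k" "fst \<alpha> (restrict u {..<n}) \<in> carrier k"
        using ring_hom_closed[OF P.value_ring_hom[OF pt]] q(1) \<alpha>(1) by auto
      have gc: "?g u \<in> carrier k" using fc un by simp
      have fg0: "?f u = \<zero>\<^bsub>k\<^esub>" "?g u = \<zero>\<^bsub>k\<^esub>"
        using k.binary_form_anisotropic[OF c cd noroot fc(1) gc *] by blast+
      have "fst \<alpha> (restrict u {..<n}) = \<zero>\<^bsub>k\<^esub>" using False pt fg0(1) by blast
      hence "?g u = \<one>\<^bsub>k\<^esub>" using un by simp
      thus False using fg0(2) by simp
    qed
    have "a [^]\<^bsub>A\<^esub> (0::nat) \<otimes>\<^bsub>A\<^esub> binary_form A (structure_map A) c d z \<zero>\<^bsub>A\<^esub> \<in> Sigma_set k A a"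
      using nonvanishing_in_Sigma_set[OF k A b a rep nz] .
    moreover have "binary_form A (structure_map A) c d z \<zero>\<^bsub>A\<^esub> \<in> I"
    proof (rule binary_form_in_ideal[OF A.is_cring I _ zI _ d])
      show "structure_map A (c i) \<in> carrier A" for i using c by auto
      show "\<zero>\<^bsub>A\<^esub> \<in> I" by simp
    qed
    ultimately have False using disj I.Icarr by (auto simp: disjoint_iff)
    thus ?thesis by blast
  qed
qed

theorem theorem2p15:
  fixes k :: "('k, 'n) ring_scheme"
    and A :: "('k, 'a, 'm) module_scheme"
    and I :: "'a set"
  assumes "field k"
    and "finitely_generated_algebra k A"
    and "ideal I A"
  shows "equiradical k A I = {a \<in> carrier A. I \<inter> Sigma_set k A a \<noteq> {}}"
proof -
  have A: "algebra k A" using assms(2) unfolding finitely_generated_algebra_def by blast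
  interpret I: ideal I A by fact
  show ?thesis
  proof (intro equalityI subsetI)
    fix a assume "a \<in> equiradical k A I"
    hence a: "a \<in> carrier A" and mem: "\<And>M. essential_maximal_ideal k A M \<Longrightarrow> I \<subseteq> M \<Longrightarrow> a \<in> M"
      unfolding equiradical_def by auto
    have "I \<inter> Sigma_set k A a \<noteq> {}"
    proof
      assume "I \<inter> Sigma_set k A a = {}"
      then obtain \<psi> where \<psi>: "\<psi> \<in> ring_hom A k" "\<And>c. c \<in> carrier k \<Longrightarrow> \<psi> (structure_map A c) = c"
        "\<And>z. z \<in> I \<Longrightarrow> \<psi> z = \<zero>\<^bsub>k\<^esub>" "\<psi> a \<noteq> \<zero>\<^bsub>k\<^esub>"
        using rational_point_avoiding_Sigma_set[OF assms a] by blast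
      \<comment> \<open>The kernel of the point is an essential maximal ideal above \<open>I\<close>
        that does not contain \<open>a\<close>.\<close>
      have "I \<subseteq> a_kernel A k \<psi>" unfolding a_kernel_def' using \<psi>(3) I.Icarr by blast
      hence "a \<in> a_kernel A k \<psi>"
        using mem[OF essential_maximal_ideal_kernel[OF assms(1) A \<psi>(1,2)]] by blast
      thus False using \<psi>(4) unfolding a_kernel_def' by blast
    qed
    thus "a \<in> {a \<in> carrier A. I \<inter> Sigma_set k A a \<noteq> {}}" using a by blast
  next
    fix a assume "a \<in> {a \<in> carrier A. I \<inter> Sigma_set k A a \<noteq> {}}"
    then obtain s where a: "a \<in> carrier A" and s: "s \<in> I" "s \<in> Sigma_set k A a" by blast
    have "a \<in> M" if M: "essential_maximal_ideal k A M" "I \<subseteq> M" for M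
    proof -
      obtain \<psi> where \<psi>: "\<psi> \<in> ring_hom A k" "\<And>c. c \<in> carrier k \<Longrightarrow> \<psi> (structure_map A c) = c"
        "\<And>x. x \<in> carrier A \<Longrightarrow> \<psi> x = \<zero>\<^bsub>k\<^esub> \<longleftrightarrow> x \<in> M"
        using essential_maximal_ideal_hom[OF assms(1) A M(1)] by blast
      have "\<psi> s = \<zero>\<^bsub>k\<^esub>" using \<psi>(3)[OF I.Icarr[OF s(1)]] s(1) M(2) by blast
      thus ?thesis
        using hom_Sigma_set_nonzero[OF assms(1) A \<psi>(1,2) a _ s(2)] \<psi>(3)[OF a] by blast
    qed
    thus "a \<in> equiradical k A I" unfolding equiradical_def using a by blast
  qed
qed

end
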